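(* Let $F$ be an algebraically closed field of characteristic zero. Let $f$ be a cubic form on a finite dimensional $F$-vector space $V$ such that its multiplicative Legendre transform $f_*$ (is defined and) is also a cubic form. Then, up to a linear isomorphism, $(V,f)$ is one of the following: 1. $V=F$, $f(x)=x^3$; 2. $V=F^3$, $f(x_1,x_2,x_3)=x_1x_2x_3$; 3. $V=S^2F^3$ (symmetric $3\times3$ matrices), $f=\det$; 4. $V=F^3\otimes(F^3)^*$ ($3\times 3$ matrices), $f=\det$; 5. $V=\Lambda^2F^6$ (skew-symmetric $6\times6$ matrices), $f=\mathrm{Pf}$, the Pfaffian; 6. $V$ is the $27$-dimensional irreducible representation of $E_6$, and $f$ is the invariant cubic form; 7. $V=F^N\oplus F$, $f(v,x)=q(v)x$, where $q$ is a nondegenerate quadratic form on $F^N$.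
   Context: A cubic form is a homogeneous polynomial of degree 3. For a homogeneous function $f$ on $V$ such that $\det((f'/f)')$ is not identically zero (where $f':V\to V^*$ is the differential of $f$, and $f'/f$ is regarded as a map to $V^*$), the multiplicative Legendre transform $f_*$ of $f$ is the function on $V^*$ (a priori defined locally/formally) determined by $f_*\left(\frac{f'(x)}{f(x)}\right)=\frac1{f(x)}$; it is homogeneous of the same degree as $f$. *)

theory Defs
  imports "HOL-Analysis.Analysis" "HOL-Library.Function_Algebras"
begin

section \<open>Polynomial forms\<close>

text \<open>
  Vector spaces over a field occur below as subspaces \<open>W\<close> of a type carrying a scalar
  multiplication \<open>s\<close>. Functions are total; only their values on \<open>W\<close> matter.
\<close>

definition linear_functional_on :: "('a::field \<Rightarrow> 'b::ab_group_add \<Rightarrow> 'b) \<Rightarrow> 'b set \<Rightarrow> ('b \<Rightarrow> 'a) \<Rightarrow> bool"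
  where "linear_functional_on s W l \<longleftrightarrow>
    (\<forall>x\<in>W. \<forall>y\<in>W. l (x + y) = l x + l y) \<and> (\<forall>c. \<forall>x\<in>W. l (s c x) = c * l x)"

text \<open>
  \<open>form_on s W d p\<close>: on \<open>W\<close>, the function \<open>p\<close> is a homogeneous polynomial of degree \<open>d\<close>, i.e.
  an element of the degree \<open>d\<close> part of the algebra generated by the linear functionals on \<open>W\<close>.
  All fields considered are infinite, so polynomials are identified with polynomial functions.
\<close>

inductive form_on :: "('a::field \<Rightarrow> 'b::ab_group_add \<Rightarrow> 'b) \<Rightarrow> 'b set \<Rightarrow> nat \<Rightarrow> ('b \<Rightarrow> 'a) \<Rightarrow> bool"
  for s W
  where
    const: "form_on s W 0 (\<lambda>_. c)"
  | linear: "linear_functional_on s W l \<Longrightarrow> form_on s W 1 l"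
  | add: "form_on s W d p \<Longrightarrow> form_on s W d q \<Longrightarrow> form_on s W d (\<lambda>x. p x + q x)"
  | mult: "form_on s W d p \<Longrightarrow> form_on s W e q \<Longrightarrow> form_on s W (d + e) (\<lambda>x. p x * q x)"
  | cong: "form_on s W d p \<Longrightarrow> (\<And>x. x \<in> W \<Longrightarrow> q x = p x) \<Longrightarrow> form_on s W d q"

abbreviation cubic_form_on :: "('a::field \<Rightarrow> 'b::ab_group_add \<Rightarrow> 'b) \<Rightarrow> 'b set \<Rightarrow> ('b \<Rightarrow> 'a) \<Rightarrow> bool"
  where "cubic_form_on s W \<equiv> form_on s W 3"

abbreviation quadratic_form_on :: "('a::field \<Rightarrow> 'b::ab_group_add \<Rightarrow> 'b) \<Rightarrow> 'b set \<Rightarrow> ('b \<Rightarrow> 'a) \<Rightarrow> bool"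
  where "quadratic_form_on s W \<equiv> form_on s W 2"

definition nondegenerate_quadratic_on :: "('a::field \<Rightarrow> 'b::ab_group_add \<Rightarrow> 'b) \<Rightarrow> 'b set \<Rightarrow> ('b \<Rightarrow> 'a) \<Rightarrow> bool"
  where "nondegenerate_quadratic_on s W q \<longleftrightarrow> quadratic_form_on s W q \<and>
    (\<forall>u\<in>W. (\<forall>v\<in>W. q (u + v) - q u - q v = 0) \<longrightarrow> u = 0)"


section \<open>Formal differentials\<close>

text \<open>
  Derivative at \<open>x\<close> along \<open>v\<close> of a rational function \<open>g\<close> regular at \<open>x\<close>: the restriction of \<open>g\<close>
  to the line \<open>x + t v\<close> is a quotient \<open>a / b\<close> of polynomials in \<open>t\<close> with \<open>b 0 \<noteq> 0\<close>, and the
  derivative is that of \<open>a / b\<close> at \<open>t = 0\<close>. Over an infinite field the value does not depend on the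
  choice of \<open>a\<close> and \<open>b\<close>. Values of \<open>g\<close> at zeros of \<open>b\<close> are ignored, since there a division by zero
  may have been totalised to zero.
\<close>

definition has_line_derivative ::
    "('a::field \<Rightarrow> 'v::ab_group_add \<Rightarrow> 'v) \<Rightarrow> ('v \<Rightarrow> 'a) \<Rightarrow> 'v \<Rightarrow> 'v \<Rightarrow> 'a \<Rightarrow> bool"
  where "has_line_derivative s g x v D \<longleftrightarrow>
    (\<exists>a b. poly b 0 \<noteq> 0 \<and> (\<forall>t. poly b t \<noteq> 0 \<longrightarrow> g (x + s t v) = poly a t / poly b t) \<and>
       D = (poly (pderiv a) 0 * poly b 0 - poly a 0 * poly (pderiv b) 0) / (poly b 0)\<^sup>2)"

definition differential ::
    "('a::field \<Rightarrow> 'v::ab_group_add \<Rightarrow> 'v) \<Rightarrow> ('v \<Rightarrow> 'a) \<Rightarrow> 'v \<Rightarrow> ('v \<Rightarrow> 'a)"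
  where "differential s g x = (\<lambda>v. THE D. has_line_derivative s g x v D)"


section \<open>The multiplicative Legendre transform\<close>

definition fun_scale :: "'a::times \<Rightarrow> ('i \<Rightarrow> 'a) \<Rightarrow> ('i \<Rightarrow> 'a)"
  where "fun_scale c g = (\<lambda>i. c * g i)"

definition dual_space :: "('a::field \<Rightarrow> 'v::ab_group_add \<Rightarrow> 'v) \<Rightarrow> ('v \<Rightarrow> 'a) set"
  where "dual_space s = {l. Vector_Spaces.linear s (*) l}"

text \<open>The map \<open>f' / f\<close> from \<open>V\<close> to its dual, meaningful where \<open>f x \<noteq> 0\<close>.\<close>

definition log_differential ::
    "('a::field \<Rightarrow> 'v::ab_group_add \<Rightarrow> 'v) \<Rightarrow> ('v \<Rightarrow> 'a) \<Rightarrow> 'v \<Rightarrow> ('v \<Rightarrow> 'a)"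
  where "log_differential s f x = (\<lambda>v. differential s f x v / f x)"

text \<open>
  The differential of \<open>f' / f\<close>: for each \<open>x\<close> a linear map from \<open>V\<close> to its dual, whose value at \<open>v\<close>
  is the functional that sends \<open>w\<close> to the derivative along \<open>v\<close> of the \<open>w\<close>-component of \<open>f' / f\<close>.
\<close>

definition log_hessian ::
    "('a::field \<Rightarrow> 'v::ab_group_add \<Rightarrow> 'v) \<Rightarrow> ('v \<Rightarrow> 'a) \<Rightarrow> 'v \<Rightarrow> 'v \<Rightarrow> ('v \<Rightarrow> 'a)"
  where "log_hessian s f x v = (\<lambda>w. differential s (\<lambda>y. log_differential s f y w) x v)"

text \<open>
  Determinant of a map from \<open>V\<close> to its dual with respect to a finite basis \<open>B\<close> and its dual basis.
  (\<open>det\<close> is only available for matrices indexed by a type.)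
\<close>

definition det_dual :: "'v set \<Rightarrow> ('v \<Rightarrow> 'v \<Rightarrow> 'a::comm_ring_1) \<Rightarrow> 'a"
  where "det_dual B M = (\<Sum>p | p permutes B. of_int (sign p) * (\<Prod>b\<in>B. M b (p b)))"

text \<open>
  The Legendre transform is a priori only a local inverse construction near a point where the
  determinant does not vanish. If it is a polynomial function \<open>g\<close>, the defining relation is an
  identity of rational functions on \<open>V\<close>, so it holds wherever \<open>f x \<noteq> 0\<close>, and it determines \<open>g\<close>
  because \<open>f' / f\<close> is dominant.
\<close>

definition is_mult_legendre_transform ::
    "('a::field \<Rightarrow> 'v::ab_group_add \<Rightarrow> 'v) \<Rightarrow> 'v set \<Rightarrow> ('v \<Rightarrow> 'a) \<Rightarrow> (('v \<Rightarrow> 'a) \<Rightarrow> 'a) \<Rightarrow> bool"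
  where "is_mult_legendre_transform s B f g \<longleftrightarrow>
    (\<exists>x. f x \<noteq> 0 \<and> det_dual B (log_hessian s f x) \<noteq> 0) \<and>
    (\<forall>x. f x \<noteq> 0 \<longrightarrow> g (log_differential s f x) = 1 / f x)"


section \<open>Isomorphism of spaces with a form, and the model spaces\<close>

definition isomorphic_to ::
    "('a::field \<Rightarrow> 'v::ab_group_add \<Rightarrow> 'v) \<Rightarrow> ('v \<Rightarrow> 'a) \<Rightarrow>
     ('a \<Rightarrow> 'w::ab_group_add \<Rightarrow> 'w) \<Rightarrow> 'w set \<Rightarrow> ('w \<Rightarrow> 'a) \<Rightarrow> bool"
  where "isomorphic_to s f s' W g \<longleftrightarrow>
    (\<exists>\<phi>. Vector_Spaces.linear s s' \<phi> \<and> bij_betw \<phi> UNIV W \<and> (\<forall>x. f x = g (\<phi> x)))"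

definition mat_scale :: "'a::times \<Rightarrow> 'a^'n^'m \<Rightarrow> 'a^'n^'m"
  where "mat_scale c A = (\<chi> i j. c * A $ i $ j)"

definition symmetric_matrices :: "('a^'n^'n) set"
  where "symmetric_matrices = {A. transpose A = A}"

definition skew_symmetric_matrices :: "('a::ab_group_add^'n^'n) set"
  where "skew_symmetric_matrices = {A. transpose A = - A}"

text \<open>Here \<open>48 = 2 ^ 3 * fact 3\<close>, and the elements of the index type are \<open>1, \<dots>, 6\<close> (with \<open>6 = 0\<close>).\<close>

definition pfaffian6 :: "'a::field_char_0^6^6 \<Rightarrow> 'a"
  where "pfaffian6 A =
    (\<Sum>p | p permutes (UNIV :: 6 set).
       of_int (sign p) * (A $ p 1 $ p 2) * (A $ p 3 $ p 4) * (A $ p 5 $ p 6)) / 48"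

text \<open>\<open>F ^ N\<close> with \<open>N\<close> a natural number, as sequences supported below \<open>N\<close>.\<close>

definition coord_space :: "nat \<Rightarrow> (nat \<Rightarrow> 'a::zero) set"
  where "coord_space N = {v. \<forall>i\<ge>N. v i = 0}"


section \<open>Representations of \<open>E\<^sub>6\<close>\<close>

text \<open>Bourbaki numbering: the chain 1 - 3 - 4 - 5 - 6, with 2 attached to 4.\<close>

definition e6_adjacent :: "nat \<Rightarrow> nat \<Rightarrow> bool"
  where "e6_adjacent i j \<longleftrightarrow>
    (i, j) \<in> {(1,3), (3,4), (4,5), (5,6), (2,4)} \<or> (j, i) \<in> {(1,3), (3,4), (4,5), (5,6), (2,4)}"

definition e6_cartan :: "nat \<Rightarrow> nat \<Rightarrow> int"
  where "e6_cartan i j = (if i = j then 2 else if e6_adjacent i j then -1 else 0)"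

definition commutator :: "('v \<Rightarrow> 'v) \<Rightarrow> ('v \<Rightarrow> 'v) \<Rightarrow> ('v \<Rightarrow> 'v::ab_group_add)"
  where "commutator X Y = (\<lambda>v. X (Y v) - Y (X v))"

text \<open>
  The simple Lie algebra of type \<open>E\<^sub>6\<close> is presented by its Chevalley generators and the Serre
  relations, so a representation of it amounts to operators satisfying these relations. In
  characteristic zero the finite dimensional representations of the simply connected group \<open>E\<^sub>6\<close>,
  their subrepresentations and their invariants are the same as those of the Lie algebra.
\<close>

locale e6_representation = vector_space s
  for s :: "'a::field_char_0 \<Rightarrow> 'v::ab_group_add \<Rightarrow> 'v" +
  fixes e f h :: "nat \<Rightarrow> 'v \<Rightarrow> 'v"
  assumes linear_e: "i \<in> {1..6} \<Longrightarrow> Vector_Spaces.linear s s (e i)"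
    and linear_f: "i \<in> {1..6} \<Longrightarrow> Vector_Spaces.linear s s (f i)"
    and linear_h: "i \<in> {1..6} \<Longrightarrow> Vector_Spaces.linear s s (h i)"
    and comm_hh: "i \<in> {1..6} \<Longrightarrow> j \<in> {1..6} \<Longrightarrow> commutator (h i) (h j) = (\<lambda>_. 0)"
    and comm_ef: "i \<in> {1..6} \<Longrightarrow> j \<in> {1..6} \<Longrightarrow>
      commutator (e i) (f j) = (if i = j then h i else (\<lambda>_. 0))"
    and comm_he: "i \<in> {1..6} \<Longrightarrow> j \<in> {1..6} \<Longrightarrow>
      commutator (h i) (e j) = (\<lambda>v. s (of_int (e6_cartan i j)) (e j v))"
    and comm_hf: "i \<in> {1..6} \<Longrightarrow> j \<in> {1..6} \<Longrightarrow>
      commutator (h i) (f j) = (\<lambda>v. s (of_int (- e6_cartan i j)) (f j v))"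
    and serre_e: "i \<in> {1..6} \<Longrightarrow> j \<in> {1..6} \<Longrightarrow> i \<noteq> j \<Longrightarrow>
      (commutator (e i) ^^ nat (1 - e6_cartan i j)) (e j) = (\<lambda>_. 0)"
    and serre_f: "i \<in> {1..6} \<Longrightarrow> j \<in> {1..6} \<Longrightarrow> i \<noteq> j \<Longrightarrow>
      (commutator (f i) ^^ nat (1 - e6_cartan i j)) (f j) = (\<lambda>_. 0)"
begin

definition generators :: "('v \<Rightarrow> 'v) set"
  where "generators = e ` {1..6} \<union> f ` {1..6} \<union> h ` {1..6}"

definition irreducible_rep :: bool
  where "irreducible_rep \<longleftrightarrow> (UNIV :: 'v set) \<noteq> {0} \<and>
    (\<forall>W. subspace W \<and> (\<forall>X\<in>generators. X ` W \<subseteq> W) \<longrightarrow> W = {0} \<or> W = UNIV)"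

definition invariant_form :: "('v \<Rightarrow> 'a) \<Rightarrow> bool"
  where "invariant_form g \<longleftrightarrow> (\<forall>X\<in>generators. \<forall>v. differential s g v (X v) = 0)"

end

text \<open>
  The two \<open>27\<close>-dimensional irreducible representations of \<open>E\<^sub>6\<close> are dual to each other and are
  exchanged by the diagram automorphism, and each has a one-dimensional space of invariant cubic
  forms. Over an algebraically closed field this determines \<open>(V, g)\<close> up to linear isomorphism.
\<close>

definition is_e6_cubic :: "('a::field_char_0 \<Rightarrow> 'v::ab_group_add \<Rightarrow> 'v) \<Rightarrow> ('v \<Rightarrow> 'a) \<Rightarrow> bool"
  where "is_e6_cubic s g \<longleftrightarrow> (\<exists>e f h. e6_representation s e f h \<and>
    e6_representation.irreducible_rep s e f h \<and>
    vector_space.dim s (UNIV :: 'v set) = 27 \<and>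
    cubic_form_on s UNIV g \<and> (\<exists>v. g v \<noteq> 0) \<and>
    e6_representation.invariant_form s e f h g)"

end

theory Submission
  imports Defs
begin

text \<open>
  Choose \<open>c\<close> with \<open>f c = 1\<close> and identify \<open>V\<close> with its dual by minus the logarithmic Hessian \<open>T\<close> of \<open>f\<close>
  at \<open>c\<close>. The differential of \<open>f\<close> becomes a quadratic map \<open>x \<mapsto> x#\<close>, and \<open>f\<^sub>* (f' / f) = 1 / f\<close> with \<open>f\<^sub>*\<close>
  cubic becomes the adjoint identity \<open>x## = f x \<cdot> x\<close>: \<open>(V, f, c)\<close> is a nondegenerate cubic norm
  structure (a semisimple cubic Jordan algebra). If there is no primitive idempotent (\<open>e# = 0\<close>,
  \<open>T c e = 1\<close>), then \<open>V\<close> is a line. If some primitive \<open>e\<close> has a trivial Peirce half space, then \<open>f\<close> is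
  a coordinate times a quadratic form; this includes the product of three coordinates. Otherwise
  \<open>e\<close> extends to a frame whose three off-diagonal Peirce spaces are nonzero, and \<open>\<times>\<close> turns one of
  them into a composition algebra. By Cayley--Dickson doubling it has dimension \<open>1\<close>, \<open>2\<close>, \<open>4\<close> or \<open>8\<close>
  and split coordinates, in which \<open>f\<close> is the norm of the hermitian \<open>3 \<times> 3\<close> matrices. The first three
  are matched with the determinants and the Pfaffian. In dimension \<open>8\<close> the \<open>27\<close> coordinates are
  weight vectors for \<open>E\<^sub>6\<close>, whose Chevalley generators are sparse integer matrices; their relations
  and the invariance of \<open>f\<close> are finite computations with integers.
\<close>

section \<open>Determinants of maps to the dual\<close>

text \<open>The obstacle is that the hypothesis is scalar: it ties \<open>f\<close> to an a priori
  unrelated cubic \<open>f_star\<close> by an identity between numbers, while the structure theory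
  needs the vector identity \<open>x## = f x \<cdot> x\<close>. Once that is known, the working
  identities are its coefficients on lines \<open>x + t y\<close>, compared as polynomials in
  \<open>t\<close> over an infinite field. The coefficient of \<open>t^2\<close> already contains
  the law \<open>n (x \<times> y) = n x * n y\<close> for \<open>n x = T x x / 2\<close> on Peirce
  spaces; this is why composition algebras, and with them the dimensions 1, 2, 4, 8, appear. The
  cross product of two Peirce spaces lands in the third, so it is not yet an algebra product. Unit
  vectors \<open>u\<close> and \<open>v\<close> in two of the spaces identify all three, and
  \<open>(v \<times> x) \<times> (u \<times> y)\<close> is a product on a single space with unit
  \<open>u \<times> v\<close> (Kaplansky's device). Algebraic closure is spent on a cube root for
  \<open>f c = 1\<close>, a root of a cubic that detects primitive idempotents, square roots that
  normalise vectors, and a square root of -1 that splits the algebras.\<close>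

lemma det_dual_equal_rows:
  fixes M :: "'v \<Rightarrow> 'v \<Rightarrow> 'a::field_char_0"
  assumes B: "finite B" and ab: "a \<in> B" "b \<in> B" "a \<noteq> b"
    and rows: "\<And>d. d \<in> B \<Longrightarrow> M a d = M b d"
  shows "det_dual B M = 0"
proof -
  let ?t = "Transposition.transpose a b"
  let ?g = "\<lambda>p. of_int (sign p) * (\<Prod>i\<in>B. M i (p i))"
  have t: "?t permutes B" using ab by (intro permutes_swap_id)
  have g: "?g (p \<circ> ?t) = - ?g p" if p: "p permutes B" for p
  proof -
    have "sign (p \<circ> ?t) = - sign p"
      using p t B ab by (subst sign_compose) (auto simp: permutation_permutes sign_swap_id)
    moreover have "(\<Prod>i\<in>B. M i ((p \<circ> ?t) i)) = (\<Prod>i\<in>B. M (?t i) (p (?t i)))"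
    proof (intro prod.cong refl)
      fix i assume "i \<in> B"
      then have "p (?t i) \<in> B" using p t by (simp add: permutes_in_image)
      then show "M i ((p \<circ> ?t) i) = M (?t i) (p (?t i))"
        using rows by (auto simp: Transposition.transpose_def)
    qed
    moreover have "(\<Prod>i\<in>B. M (?t i) (p (?t i))) = (\<Prod>i\<in>B. M i (p i))"
      using prod.permute[OF t, of "\<lambda>i. M i (p i)"] by (simp add: o_def)
    ultimately show ?thesis by simp
  qed
  have "det_dual B M = (\<Sum>p | p permutes B. ?g (p \<circ> ?t))"
    unfolding det_dual_def by (rule sum_permutations_compose_right[OF t])
  also have "\<dots> = (\<Sum>p | p permutes B. - ?g p)"
    by (intro sum.cong refl g) simp
  also have "\<dots> = - det_dual B M"
    unfolding det_dual_def by (rule sum_negf)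
  finally show ?thesis by simp
qed

text \<open>Expanding row \<open>a\<close> linearly leaves determinants in which row
  \<open>a\<close> repeats another row.\<close>

lemma det_dual_dependent_rows:
  fixes M :: "'v \<Rightarrow> 'v \<Rightarrow> 'a::field_char_0"
  assumes B: "finite B" and a: "a \<in> B"
    and dep: "\<And>d. d \<in> B \<Longrightarrow> M a d = (\<Sum>b\<in>B-{a}. c b * M b d)"
  shows "det_dual B M = 0"
proof -
  let ?N = "\<lambda>b. M(a := M b)"
  have *: "(\<Prod>i\<in>B. M i (p i)) = (\<Sum>b\<in>B-{a}. c b * (\<Prod>i\<in>B. ?N b i (p i)))"
    if p: "p permutes B" for p
  proof -
    have "(\<Prod>i\<in>B. M i (p i)) = M a (p a) * (\<Prod>i\<in>B-{a}. M i (p i))"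
      by (rule prod.remove[OF B a])
    also have "M a (p a) = (\<Sum>b\<in>B-{a}. c b * M b (p a))"
      using dep p a by (simp add: permutes_in_image)
    also have "\<dots> * (\<Prod>i\<in>B-{a}. M i (p i)) = (\<Sum>b\<in>B-{a}. c b * (M b (p a) * (\<Prod>i\<in>B-{a}. M i (p i))))"
      by (simp add: sum_distrib_right mult.assoc)
    also have "\<dots> = (\<Sum>b\<in>B-{a}. c b * (\<Prod>i\<in>B. ?N b i (p i)))"
      by (intro sum.cong refl) (simp add: prod.remove[OF B a])
    finally show ?thesis .
  qed
  have "det_dual B M = (\<Sum>p | p permutes B. \<Sum>b\<in>B-{a}. c b * (of_int (sign p) * (\<Prod>i\<in>B. ?N b i (p i))))"
    unfolding det_dual_def using * by (simp add: sum_distrib_left algebra_simps del: fun_upd_apply)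
  also have "\<dots> = (\<Sum>b\<in>B-{a}. c b * det_dual B (?N b))"
    unfolding det_dual_def by (subst sum.swap) (simp add: sum_distrib_left)
  also have "\<dots> = 0"
    using a by (intro sum.neutral ballI) (auto simp: det_dual_equal_rows[OF B, of a])
  finally show ?thesis .
qed

text \<open>Puts the determinant condition of the Legendre hypothesis into the form used later: a
  nonzero vector of the kernel, written in the basis, would be a linear relation between the
  rows.\<close>

lemma det_dual_nondegenerate:
  fixes s :: "'a::field_char_0 \<Rightarrow> 'v::ab_group_add \<Rightarrow> 'v"
  assumes "finite_dimensional_vector_space s B"
    and add: "\<And>x y w. M (x + y) w = M x w + M y w"
    and scale: "\<And>c x w. M (s c x) w = c * M x w"
    and det: "det_dual B M \<noteq> 0" and zero: "\<And>w. M v w = 0"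
  shows "v = 0"
proof (rule ccontr)
  interpret finite_dimensional_vector_space s B by fact
  assume "v \<noteq> 0"
  let ?c = "representation B v"
  have v: "(\<Sum>b\<in>B. s (?c b) b) = v"
    by (rule sum_representation_eq) (auto simp: independent_Basis span_Basis finite_Basis)
  with \<open>v \<noteq> 0\<close> obtain a where a: "a \<in> B" "?c a \<noteq> 0"
    by (metis (no_types, lifting) scale_zero_left sum.neutral)
  have M0: "M 0 w = 0" for w using add[of 0 0 w] by simp
  have Msum: "M (\<Sum>b\<in>S. s (?c b) b) w = (\<Sum>b\<in>S. ?c b * M b w)" for S w
    by (induction S rule: infinite_finite_induct) (auto simp: M0 add scale)
  have "M a d = (\<Sum>b\<in>B-{a}. - (?c b / ?c a) * M b d)" for d
  proof -
    have "0 = ?c a * M a d + (\<Sum>b\<in>B-{a}. ?c b * M b d)"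
      using Msum[of B d] v zero[of d] by (simp add: sum.remove[OF finite_Basis a(1)])
    then have "M a d = - (\<Sum>b\<in>B-{a}. ?c b * M b d) / ?c a"
      using a(2) by (simp add: field_simps eq_neg_iff_add_eq_0)
    then show ?thesis by (simp add: sum_negf sum_divide_distrib)
  qed
  then have "det_dual B M = 0"
    by (intro det_dual_dependent_rows[OF finite_Basis a(1)])
  with det show False by simp
qed


section \<open>Cubic forms and their polarizations\<close>

lemma form_on_compose:
  assumes "form_on s' W d p" and "\<And>x y. \<phi> (x + y) = \<phi> x + \<phi> y"
    and "\<And>c x. \<phi> (s c x) = s' c (\<phi> x)" and "\<And>x. x \<in> U \<Longrightarrow> \<phi> x \<in> W"
  shows "form_on s U d (\<lambda>x. p (\<phi> x))"
  using assms(1)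
proof induction
  case (linear l)
  then show ?case
    by (intro form_on.linear) (simp add: linear_functional_on_def assms(2-4))
next
  case (cong d p q)
  then show ?case using assms(4) by (auto intro: form_on.cong)
qed (auto intro: form_on.intros)

locale symmetric_trilinear = vector_space s
  for s :: "'a::field_char_0 \<Rightarrow> 'v::ab_group_add \<Rightarrow> 'v" (infixr "\<cdot>" 75) +
  fixes M :: "'v \<Rightarrow> 'v \<Rightarrow> 'v \<Rightarrow> 'a"
  assumes swap12: "M x y z = M y x z"
    and swap23: "M x y z = M x z y"
    and add1: "M (x + x') y z = M x y z + M x' y z"
    and scale1: "M (a \<cdot> x) y z = a * M x y z"
begin

lemma add2: "M y (x + x') z = M y x z + M y x' z"
  by (metis swap12 add1)

lemma add3: "M y z (x + x') = M y z x + M y z x'"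
  by (metis swap23 add2)

lemma scale2: "M y (a \<cdot> x) z = a * M y x z"
  by (metis swap12 scale1)

lemma scale3: "M y z (a \<cdot> x) = a * M y z x"
  by (metis swap23 scale2)

lemma zero1 [simp]: "M 0 y z = 0"
  using scale1[of 0 0 y z] by simp

lemma zero2 [simp]: "M y 0 z = 0"
  using scale2[of y 0 0 z] by simp

lemma zero3 [simp]: "M y z 0 = 0"
  using scale3[of y z 0 0] by simp

lemmas expand = add1 add2 add3 scale1 scale2 scale3

lemma line:
  "M (x + t \<cdot> v) (x + t \<cdot> v) (x + t \<cdot> v) =
     poly [:M x x x, 3 * M x x v, 3 * M x v v, M v v v:] t"
  using swap12 swap23 by (simp add: expand algebra_simps)

end

text \<open>A normal form is needed because polarization cannot be obtained by a direct induction in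
  degree 3: the rule \<open>mult\<close> passes through forms of other degrees.\<close>

lemma form_on_monomials:
  assumes "form_on s UNIV d p"
  shows "\<exists>L. (\<forall>(c, ls)\<in>set L. length ls = d \<and> (\<forall>l\<in>set ls. linear_functional_on s UNIV l)) \<and>
    (\<forall>x. p x = (\<Sum>(c, ls)\<leftarrow>L. c * prod_list (map (\<lambda>l. l x) ls)))"
  using assms
proof induction
  case (const c)
  show ?case by (rule exI[of _ "[(c, [])]"]) simp
next
  case (linear l)
  then show ?case by (intro exI[of _ "[(1, [l])]"]) simp
next
  case (add d p q)
  then obtain L L' where "\<forall>(c, ls)\<in>set L. length ls = d \<and> (\<forall>l\<in>set ls. linear_functional_on s UNIV l)"
    "\<forall>x. p x = (\<Sum>(c, ls)\<leftarrow>L. c * prod_list (map (\<lambda>l. l x) ls))"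
    "\<forall>(c, ls)\<in>set L'. length ls = d \<and> (\<forall>l\<in>set ls. linear_functional_on s UNIV l)"
    "\<forall>x. q x = (\<Sum>(c, ls)\<leftarrow>L'. c * prod_list (map (\<lambda>l. l x) ls))" by blast
  then show ?case by (intro exI[of _ "L @ L'"]) auto
next
  case (mult d p e q)
  then obtain L L' where L: "\<forall>(c, ls)\<in>set L. length ls = d \<and> (\<forall>l\<in>set ls. linear_functional_on s UNIV l)"
    "\<forall>x. p x = (\<Sum>(c, ls)\<leftarrow>L. c * prod_list (map (\<lambda>l. l x) ls))"
    "\<forall>(c, ls)\<in>set L'. length ls = e \<and> (\<forall>l\<in>set ls. linear_functional_on s UNIV l)"
    "\<forall>x. q x = (\<Sum>(c, ls)\<leftarrow>L'. c * prod_list (map (\<lambda>l. l x) ls))" by blast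
  have inner: "(\<Sum>(c', ls')\<leftarrow>map (\<lambda>(c', ls'). (c * c', ls @ ls')) B. c' * prod_list (map (\<lambda>l. l x) ls')) =
      c * prod_list (map (\<lambda>l. l x) ls) * (\<Sum>(c, ls)\<leftarrow>B. c * prod_list (map (\<lambda>l. l x) ls))"
    for B :: "('a \<times> ('b \<Rightarrow> 'a) list) list" and c ls x
    by (induction B) (auto simp: algebra_simps)
  have product: "(\<Sum>(c, ls)\<leftarrow>concat (map (\<lambda>(c, ls). map (\<lambda>(c', ls'). (c * c', ls @ ls')) B) A). c * prod_list (map (\<lambda>l. l x) ls))
      = (\<Sum>(c, ls)\<leftarrow>A. c * prod_list (map (\<lambda>l. l x) ls)) * (\<Sum>(c, ls)\<leftarrow>B. c * prod_list (map (\<lambda>l. l x) ls))"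
    for A B :: "('a \<times> ('b \<Rightarrow> 'a) list) list" and x
    by (induction A) (auto simp: inner distrib_right simp del: map_map)
  show ?case
  proof (intro exI[of _ "concat (map (\<lambda>(c, ls). map (\<lambda>(c', ls'). (c * c', ls @ ls')) L') L)"] conjI)
    show "\<forall>(c, ls)\<in>set (concat (map (\<lambda>(c, ls). map (\<lambda>(c', ls'). (c * c', ls @ ls')) L') L)).
        length ls = d + e \<and> (\<forall>l\<in>set ls. linear_functional_on s UNIV l)"
      using L(1,3) by fastforce
  qed (simp only: product L(2,4), simp)
next
  case (cong d p q)
  then show ?case by simp
qed

text \<open>Each monomial is a product of three functionals and is averaged over the six orders of
  its arguments.\<close>

lemma cubic_form_polarization:
  fixes s :: "'a::field_char_0 \<Rightarrow> 'v::ab_group_add \<Rightarrow> 'v"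
  assumes "vector_space s" and "cubic_form_on s UNIV p"
  obtains M where "symmetric_trilinear s M" and "\<And>x. p x = M x x x"
proof -
  interpret vector_space s by fact
  obtain L where L: "\<forall>(c, ls)\<in>set L. length ls = 3 \<and> (\<forall>l\<in>set ls. linear_functional_on s UNIV l)"
    and p: "\<forall>x. p x = (\<Sum>(c, ls)\<leftarrow>L. c * prod_list (map (\<lambda>l. l x) ls))"
    using form_on_monomials[OF assms(2)] by blast
  define m where "m ls x y z = (ls ! 0) x * (ls ! 1) y * (ls ! 2) z" for ls :: "('v \<Rightarrow> 'a) list" and x y z
  define M where "M K x y z = (\<Sum>(c, ls)\<leftarrow>K. c * (m ls x y z + m ls x z y + m ls y x z + m ls y z x +
    m ls z x y + m ls z y x) / 6)" for K x y z
  have polar: "symmetric_trilinear s (M K) \<and> (\<forall>x. M K x x x = (\<Sum>(c, ls)\<leftarrow>K. c * prod_list (map (\<lambda>l. l x) ls)))"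
    if "\<forall>(c, ls)\<in>set K. length ls = 3 \<and> (\<forall>l\<in>set ls. linear_functional_on s UNIV l)" for K
    using that
  proof (induction K)
    case Nil
    show ?case by (auto simp: M_def intro!: symmetric_trilinear.intro vector_space_axioms symmetric_trilinear_axioms.intro)
  next
    case (Cons a K)
    obtain c l1 l2 l3 where a: "a = (c, [l1, l2, l3])"
      and l: "\<And>l. l \<in> {l1, l2, l3} \<Longrightarrow> linear_functional_on s UNIV l"
      using Cons.prems by (cases a) (auto simp: numeral_3_eq_3 length_Suc_conv)
    have lin: "l (x + y) = l x + l y" "l (s k x) = k * l x" if "l \<in> {l1, l2, l3}" for l x y k
      using l[OF that] by (auto simp: linear_functional_on_def)
    interpret K: symmetric_trilinear s "M K" using Cons by simp
    have M: "M (a # K) x y z = c * (l1 x * l2 y * l3 z + l1 x * l2 z * l3 y + l1 y * l2 x * l3 z +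
        l1 y * l2 z * l3 x + l1 z * l2 x * l3 y + l1 z * l2 y * l3 x) / 6 + M K x y z" for x y z
      by (simp add: M_def a m_def)
    have "symmetric_trilinear s (M (a # K))"
    proof unfold_locales
      fix x x' y z k
      show "M (a # K) x y z = M (a # K) y x z"
        using K.swap12[of x y z] by (simp add: M algebra_simps)
      show "M (a # K) x y z = M (a # K) x z y"
        using K.swap23[of x y z] by (simp add: M algebra_simps)
      show "M (a # K) (x + x') y z = M (a # K) x y z + M (a # K) x' y z"
        "M (a # K) (s k x) y z = k * M (a # K) x y z"
        by (simp_all add: M K.add1 K.scale1 lin field_simps)
    qed
    moreover have "M (a # K) x x x = (\<Sum>(c, ls)\<leftarrow>a # K. c * prod_list (map (\<lambda>l. l x) ls))" for x
      using Cons by (simp add: M) (simp add: a)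
    ultimately show ?case by blast
  qed
  show thesis using polar[OF L] p by (intro that[of "M L"]) simp_all
qed

section \<open>Line derivatives\<close>

text \<open>Two representing quotients agree off the zeros of their denominators, so after
  multiplication by both denominators the difference vanishes everywhere and is the zero polynomial.
  The cross-multiplied identity and its derivative at 0 then determine the value.\<close>

lemma has_line_derivative_unique:
  fixes s :: "'a::field_char_0 \<Rightarrow> 'v::ab_group_add \<Rightarrow> 'v"
  assumes "has_line_derivative s g x v D" "has_line_derivative s g x v E"
  shows "D = E"
proof -
  from assms(1) obtain a b where b: "poly b 0 \<noteq> 0"
    and ab: "\<And>t. poly b t \<noteq> 0 \<Longrightarrow> g (x + s t v) = poly a t / poly b t"
    and D: "D = (poly (pderiv a) 0 * poly b 0 - poly a 0 * poly (pderiv b) 0) / (poly b 0)\<^sup>2"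
    unfolding has_line_derivative_def by blast
  from assms(2) obtain a' b' where b': "poly b' 0 \<noteq> 0"
    and ab': "\<And>t. poly b' t \<noteq> 0 \<Longrightarrow> g (x + s t v) = poly a' t / poly b' t"
    and E: "E = (poly (pderiv a') 0 * poly b' 0 - poly a' 0 * poly (pderiv b') 0) / (poly b' 0)\<^sup>2"
    unfolding has_line_derivative_def by blast
  have "poly (b * b' * (a * b' - a' * b)) t = 0" for t
  proof (cases "poly b t = 0 \<or> poly b' t = 0")
    case False
    then have "poly a t / poly b t = poly a' t / poly b' t" using ab[of t] ab'[of t] by simp
    then show ?thesis using False by (simp add: field_simps)
  qed auto
  then have "b * b' * (a * b' - a' * b) = 0"
    by (metis poly_all_0_iff_0)
  with b b' have eq: "a * b' = a' * b" by auto
  have eq0: "poly a 0 * poly b' 0 = poly a' 0 * poly b 0"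
    using arg_cong[OF eq, of "\<lambda>p. poly p 0"] by simp
  have eq1: "poly (pderiv a) 0 * poly b' 0 + poly a 0 * poly (pderiv b') 0 =
      poly (pderiv a') 0 * poly b 0 + poly a' 0 * poly (pderiv b) 0"
    using arg_cong[OF eq, of "\<lambda>p. poly (pderiv p) 0"] by (simp add: pderiv_mult algebra_simps)
  have "(poly (pderiv a) 0 * poly b 0 - poly a 0 * poly (pderiv b) 0) * (poly b' 0)\<^sup>2 =
     (poly (pderiv a') 0 * poly b' 0 - poly a' 0 * poly (pderiv b') 0) * (poly b 0)\<^sup>2"
    using eq0 eq1 by algebra
  then show ?thesis using b b' unfolding D E by (simp add: divide_simps)
qed

lemma differential_eq:
  fixes s :: "'a::field_char_0 \<Rightarrow> 'v::ab_group_add \<Rightarrow> 'v"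
  assumes "has_line_derivative s g x v D"
  shows "differential s g x v = D"
  unfolding differential_def using assms has_line_derivative_unique by (intro the_equality) auto

context symmetric_trilinear
begin

lemma differential_cubic: "differential s (\<lambda>x. M x x x) x v = 3 * M x x v"
proof (rule differential_eq)
  let ?a = "[:M x x x, 3 * M x x v, 3 * M x v v, M v v v:]"
  show "has_line_derivative s (\<lambda>x. M x x x) x v (3 * M x x v)"
    unfolding has_line_derivative_def line
    by (rule exI[of _ ?a], rule exI[of _ 1]) (simp add: pderiv_pCons)
qed

lemma log_differential_cubic: "log_differential s (\<lambda>x. M x x x) x v = 3 * M x x v / M x x x"
  by (simp add: log_differential_def differential_cubic)

lemma log_hessian_cubic:
  assumes "M x x x \<noteq> 0"
  shows "log_hessian s (\<lambda>x. M x x x) x v w =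
    6 * M x v w / M x x x - 9 * M x x v * M x x w / (M x x x)\<^sup>2"
proof -
  let ?a = "[:3 * M x x w, 6 * M x v w, 3 * M v v w:]"
  let ?b = "[:M x x x, 3 * M x x v, 3 * M x v v, M v v v:]"
  have a: "3 * M (x + t \<cdot> v) (x + t \<cdot> v) w = poly ?a t" for t
    using swap12 by (simp add: expand algebra_simps)
  have "has_line_derivative s (\<lambda>y. log_differential s (\<lambda>x. M x x x) y w) x v
     ((poly (pderiv ?a) 0 * poly ?b 0 - poly ?a 0 * poly (pderiv ?b) 0) / (poly ?b 0)\<^sup>2)"
    unfolding has_line_derivative_def log_differential_cubic line a
    by (rule exI[of _ ?a], rule exI[of _ ?b]) (use assms in simp)
  from differential_eq[OF this] show ?thesis
    using assms unfolding log_hessian_def by (simp add: pderiv_pCons field_simps power2_eq_square)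
qed

end


section \<open>Cubic norm structures\<close>

text \<open>
  A cubic form is stored as the symmetric product \<open>X\<close> with \<open>T (X x y) z\<close> its polarization, \<open>T\<close> a
  nondegenerate symmetric bilinear form. Vector identities are proved by pairing both sides
  with an arbitrary vector under \<open>T\<close>.
\<close>

locale trace_product = finite_dimensional_vector_space s B
  for s :: "'a::field_char_0 \<Rightarrow> 'v::ab_group_add \<Rightarrow> 'v" (infixr "\<cdot>" 75) and B +
  fixes T :: "'v \<Rightarrow> 'v \<Rightarrow> 'a" and X :: "'v \<Rightarrow> 'v \<Rightarrow> 'v"
  assumes T_add_left: "T (x + y) z = T x z + T y z"
    and T_scale_left: "T (a \<cdot> x) z = a * T x z"
    and T_commute: "T x y = T y x"
    and T_nondegenerate: "(\<And>z. T x z = 0) \<Longrightarrow> x = 0"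
    and X_add_left: "X (x + y) z = X x z + X y z"
    and X_scale_left: "X (a \<cdot> x) z = a \<cdot> X x z"
    and X_commute: "X x y = X y x"
    and T_X: "T (X x y) z = T x (X y z)"
begin

lemma T_add_right: "T z (x + y) = T z x + T z y"
  by (metis T_add_left T_commute)

lemma T_scale_right: "T z (a \<cdot> x) = a * T z x"
  by (metis T_scale_left T_commute)

lemma T_zero_left [simp]: "T 0 z = 0"
  using T_scale_left[of 0 0 z] by simp

lemma T_zero_right [simp]: "T z 0 = 0"
  by (metis T_zero_left T_commute)

lemma T_minus_left: "T (- x) z = - T x z"
  using T_scale_left[of "-1" x z] by simp

lemma T_minus_right: "T z (- x) = - T z x"
  by (metis T_minus_left T_commute)

lemma T_diff_left: "T (x - y) z = T x z - T y z"
  using T_add_left[of x "- y"] by (simp add: T_minus_left)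

lemma T_diff_right: "T z (x - y) = T z x - T z y"
  by (metis T_diff_left T_commute)

lemmas T_linear = T_add_left T_add_right T_scale_left T_scale_right
  T_minus_left T_minus_right T_diff_left T_diff_right

lemma T_eqI: "(\<And>z. T x z = T y z) \<Longrightarrow> x = y"
  using T_nondegenerate[of "x - y"] by (simp add: T_diff_left)

lemma X_add_right: "X z (x + y) = X z x + X z y"
  by (metis X_add_left X_commute)

lemma X_scale_right: "X z (a \<cdot> x) = a \<cdot> X z x"
  by (metis X_scale_left X_commute)

lemma X_zero_left [simp]: "X 0 z = 0"
  using X_scale_left[of 0 0 z] by simp

lemma X_zero_right [simp]: "X z 0 = 0"
  by (metis X_zero_left X_commute)

lemma X_minus_left: "X (- x) z = - X x z"
  using X_scale_left[of "-1" x z] by simp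

lemma X_minus_right: "X z (- x) = - X z x"
  by (metis X_minus_left X_commute)

lemma X_diff_left: "X (x - y) z = X x z - X y z"
  using X_add_left[of x "- y"] by (simp add: X_minus_left)

lemma X_diff_right: "X z (x - y) = X z x - X z y"
  by (metis X_diff_left X_commute)

lemmas X_linear = X_add_left X_add_right X_scale_left X_scale_right
  X_minus_left X_minus_right X_diff_left X_diff_right

lemma T_X_swap: "T (X x y) z = T (X x z) y"
  by (metis T_X T_commute X_commute)

definition sharp :: "'v \<Rightarrow> 'v"
  where "sharp x = (1/2) \<cdot> X x x"

definition N :: "'v \<Rightarrow> 'a"
  where "N x = T (X x x) x / 6"

lemma X_self: "X x x = 2 \<cdot> sharp x"
  by (simp add: sharp_def)

lemma sharp_scale: "sharp (a \<cdot> x) = a\<^sup>2 \<cdot> sharp x"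
  by (simp add: sharp_def X_linear power2_eq_square mult_ac)

lemma sharp_zero [simp]: "sharp 0 = 0"
  by (simp add: sharp_def)

lemma sharp_add: "sharp (x + y) = sharp x + X x y + sharp y"
  by (rule T_eqI) (simp add: sharp_def X_linear T_linear X_commute[of y x] field_simps)

lemma N_sharp_self: "N x = T (sharp x) x / 3"
  by (simp add: N_def sharp_def T_linear)

lemma N_scale: "N (a \<cdot> x) = a ^ 3 * N x"
  by (simp add: N_def X_linear T_linear power3_eq_cube mult_ac)

lemma N_add: "N (x + y) = N x + T (sharp x) y + T (sharp y) x + N y"
proof -
  have "T (X x y) x = T (X x x) y" "T (X x y) y = T (X y y) x"
    by (metis T_X_swap X_commute)+
  then show ?thesis
    by (simp add: N_def sharp_def X_linear T_linear X_commute[of y x] field_simps)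
qed

lemma N_line: "N (x + t \<cdot> v) = poly [:N x, T (sharp x) v, T (sharp v) x, N v:] t"
  by (simp add: N_add N_scale sharp_scale T_linear power2_eq_square power3_eq_cube algebra_simps)

text \<open>\<open>sharp\<close> turns a line into a curve of this shape, so this evaluates a second
  cubic form along the adjoint of a line.\<close>

lemma N_conic: "N (x + t \<cdot> v + t\<^sup>2 \<cdot> w) =
  poly [:N x, T (sharp x) v, T (sharp x) w + T (sharp v) x, T (X x v) w + N v,
     T (sharp w) x + T (sharp v) w, T (sharp w) v, N w:] t"
  by (simp add: N_add N_scale sharp_scale sharp_add X_linear T_linear power2_eq_square
      power3_eq_cube T_X_swap[of v w x] X_commute[of v x] algebra_simps)

end

text \<open>Recording the values \<open>T y b\<close> on the basis is injective in \<open>y\<close>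
  by nondegeneracy, hence surjective in finite dimension.\<close>

lemma (in finite_dimensional_vector_space) nondegenerate_representing:
  assumes T_add: "\<And>x y z. T (x + y) z = T x z + T y z" "\<And>x y z. T z (x + y) = T z x + T z y"
    and T_scale: "\<And>a x z. T (scale a x) z = a * T x z" "\<And>a x z. T z (scale a x) = a * T z x"
    and nondeg: "\<And>x. (\<And>z. T x z = 0) \<Longrightarrow> x = 0"
    and l: "\<And>x y. l (x + y) = l x + l y" "\<And>a x. l (scale a x) = a * l x"
  shows "\<exists>y. \<forall>z. T y z = l z"
proof -
  define \<tau> where "\<tau> y = (\<Sum>b\<in>Basis. scale (T y b) b)" for y
  have ext: "g z = 0" if "\<And>b. b \<in> Basis \<Longrightarrow> g b = 0" "\<And>x y. g (x + y) = g x + g y"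
    "\<And>a x. g (scale a x) = a * g x" for g :: "'b \<Rightarrow> 'a" and z
  proof -
    have "z \<in> span Basis" by (simp add: span_Basis)
    then show ?thesis
      by (induction rule: span_induct_alt) (use that that(3)[of 0 0] in auto)
  qed
  have lin: "Vector_Spaces.linear scale scale \<tau>"
    by unfold_locales (simp_all add: \<tau>_def T_add T_scale scale_left_distrib sum.distrib
        scale_sum_right vector_space_assms)
  have coord: "u b = v b" if "(\<Sum>b\<in>Basis. scale (u b) b) = (\<Sum>b\<in>Basis. scale (v b) b)" "b \<in> Basis" for u v b
  proof -
    have "(\<Sum>b\<in>Basis. scale (u b - v b) b) = 0"
      using that(1) by (simp add: scale_left_diff_distrib sum_subtractf)
    then have "u b - v b = 0"
      using independentD[OF independent_Basis finite_Basis subset_refl _ that(2), of "\<lambda>b. u b - v b"] by simp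
    then show ?thesis by simp
  qed
  have "inj \<tau>"
  proof (rule injI)
    fix x y assume "\<tau> x = \<tau> y"
    then have "T x b = T y b" if "b \<in> Basis" for b
      using coord[of "T x" "T y" b] that by (simp add: \<tau>_def)
    then have *: "T x z - T y z = 0" for z
      using ext[of "\<lambda>z. T x z - T y z" z] by (simp add: T_add T_scale algebra_simps)
    have "x - y = 0"
    proof (rule nondeg)
      show "T (x - y) z = 0" for z using *[of z] T_add(1)[of "x - y" y z] by simp
    qed
    then show "x = y" by simp
  qed
  then have "surj \<tau>" by (rule linear_inj_imp_surj[OF lin])
  then obtain y where "\<tau> y = (\<Sum>b\<in>Basis. scale (l b) b)" by (metis surjD)
  then have "T y b = l b" if "b \<in> Basis" for b
    using coord[of "T y" l b] that by (simp add: \<tau>_def)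
  then have "T y z - l z = 0" for z
    using ext[of "\<lambda>z. T y z - l z" z] by (simp add: T_add T_scale l algebra_simps)
  then show ?thesis by auto
qed

text \<open>The factor 6 gives \<open>T (sharp x) v = 3 * M x x v\<close>, the derivative of the
  cubic form along \<open>v\<close>, and \<open>N x = M x x x\<close>.\<close>

lemma (in symmetric_trilinear) obtain_trace_product:
  assumes "finite_dimensional_vector_space s B"
    and T_add: "\<And>x y z. T (x + y) z = T x z + T y z"
    and T_scale: "\<And>a x z. T (a \<cdot> x) z = a * T x z"
    and T_comm: "\<And>x y. T x y = T y x"
    and nondeg: "\<And>x. (\<And>z. T x z = 0) \<Longrightarrow> x = 0"
  obtains X where "trace_product s B T X" "\<And>x y z. T (X x y) z = 6 * M x y z"
proof -
  interpret finite_dimensional_vector_space s B by fact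
  have T_add': "T z (x + y) = T z x + T z y" for x y z by (metis T_add T_comm)
  have T_scale': "T z (a \<cdot> x) = a * T z x" for a x z by (metis T_scale T_comm)
  have "\<forall>x y. \<exists>u. \<forall>z. T u z = 6 * M x y z"
    by (intro allI nondegenerate_representing[where T = T])
       (use nondeg in \<open>auto simp: T_add T_add' T_scale T_scale' expand algebra_simps\<close>)
  then obtain X where X: "T (X x y) z = 6 * M x y z" for x y z by metis
  have T_diff: "T (x - y) z = T x z - T y z" for x y z
    using T_add[of "x - y" y z] by simp
  have eqI: "x = y" if "\<And>z. T x z = T y z" for x y
    using nondeg[of "x - y"] that by (simp add: T_diff)
  have "trace_product s B T X"
  proof
    show "T (X x y) z = T x (X y z)" for x y z
      by (metis T_comm X swap12 swap23)
    show "X x y = X y x" for x y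
      by (rule eqI) (metis X swap12)
    show "X (x + y) z = X x z + X y z" for x y z
      by (rule eqI) (simp add: X T_add expand algebra_simps)
    show "X (a \<cdot> x) z = a \<cdot> X x z" for a x z
      by (rule eqI) (simp add: X T_scale expand)
  qed (use T_add T_scale T_comm nondeg in auto)
  then show ?thesis using that X by blast
qed

text \<open>Together \<open>X_unit\<close> and \<open>T_unit\<close> yield
  \<open>sharp c = c\<close> and \<open>N c = 1\<close>, the usual base point conditions;
  \<open>T c x\<close> is the generic trace of the associated Jordan algebra.\<close>

locale cubic_norm_structure = trace_product s B T X
  for s :: "'a::field_char_0 \<Rightarrow> 'v::ab_group_add \<Rightarrow> 'v" (infixr "\<cdot>" 75) and B T X +
  fixes c :: 'v
  assumes sharp_sharp: "sharp (sharp x) = N x \<cdot> x"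
    and X_unit: "X c x = T c x \<cdot> c - x"
    and T_unit: "T c c = 3"


section \<open>From the Legendre transform to a cubic norm structure\<close>

lemma poly_eq_on_nonzero:
  fixes p q r :: "'a::field_char_0 poly"
  assumes "\<And>t. poly r t \<noteq> 0 \<Longrightarrow> poly p t = poly q t" and "r \<noteq> 0"
  shows "p = q"
proof -
  have "poly (r * (p - q)) t = 0" for t using assms(1)[of t] by auto
  then have "r * (p - q) = 0" by (metis poly_all_0_iff_0)
  with assms(2) show ?thesis by simp
qed

text \<open>
  \<open>Y\<close> stores the transform as \<open>X\<close> stores the form. Differentiating \<open>N\<^sub>Y (x#) = (N x)\<^sup>2\<close>
  gives \<open>x \<times> r x = 0\<close> for the defect \<open>r x\<close> of the adjoint identity; expanding at \<open>c + t v\<close>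
  in powers of \<open>t\<close> then kills \<open>r\<close>, since \<open>c \<times> y = 0\<close> only for \<open>y = 0\<close>. The lower coefficients
  force \<open>Y = X\<close> on the diagonal.
\<close>

lemma dual_products_cubic_norm_structure:
  assumes "trace_product s B T X" and "trace_product s B T Y"
    and X_unit: "\<And>x. X c x = s (T c x) c - x" and T_unit: "T c c = 3"
    and dual: "\<And>x. trace_product.N T X x \<noteq> 0 \<Longrightarrow>
      trace_product.N T Y (trace_product.sharp s X x) = (trace_product.N T X x)\<^sup>2"
  shows "cubic_norm_structure s B T X c"
proof -
  interpret X: trace_product s B T X by fact
  interpret Y: trace_product s B T Y by fact
  note lin = X.T_linear X.X_linear Y.X_linear
  have sharp_c: "X.sharp c = c"
    by (rule X.T_eqI) (simp add: X.sharp_def X_unit T_unit lin)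
  have N_c: "X.N c = 1"
    by (simp add: X.N_sharp_self sharp_c T_unit)
  have sharp_line: "X.sharp (x + s t v) = X.sharp x + s t (X x v) + s (t\<^sup>2) (X.sharp v)" for x t v
    by (simp add: X.sharp_add X.sharp_scale lin)
  define p where "p x v = [:X.N x, T (X.sharp x) v, T (X.sharp v) x, X.N v:]" for x v
  define q where "q x v = [:Y.N (X.sharp x), T (Y.sharp (X.sharp x)) (X x v),
       T (Y.sharp (X.sharp x)) (X.sharp v) + T (Y.sharp (X x v)) (X.sharp x),
       T (Y (X.sharp x) (X x v)) (X.sharp v) + Y.N (X x v),
       T (Y.sharp (X.sharp v)) (X.sharp x) + T (Y.sharp (X x v)) (X.sharp v),
       T (Y.sharp (X.sharp v)) (X x v), Y.N (X.sharp v):]" for x v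
  have p: "X.N (x + s t v) = poly (p x v) t" for x v t
    unfolding p_def by (rule X.N_line)
  have q: "Y.N (X.sharp (x + s t v)) = poly (q x v) t" for x v t
    unfolding q_def sharp_line by (rule Y.N_conic)
  \<comment> \<open>The relation is given only where \<open>N x \<noteq> 0\<close>. On the line from
    \<open>c\<close> to \<open>x\<close> the polynomial of \<open>N\<close> has value 1 at
    \<open>t = 0\<close>, so it is not zero; the identity extends to the whole line and is read off
    at \<open>t = 1\<close>.\<close>
  have dual': "Y.N (X.sharp x) = (X.N x)\<^sup>2" for x
  proof -
    have "q c (x - c) = p c (x - c) * p c (x - c)"
    proof (rule poly_eq_on_nonzero)
      show "p c (x - c) \<noteq> 0" by (simp add: p_def N_c)
      show "poly (q c (x - c)) t = poly (p c (x - c) * p c (x - c)) t" if "poly (p c (x - c)) t \<noteq> 0" for t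
        using dual[of "c + s t (x - c)"] that unfolding p q poly_mult by (simp add: power2_eq_square)
    qed
    then have "poly (q c (x - c)) 1 = poly (p c (x - c)) 1 * poly (p c (x - c)) 1" by (metis poly_mult)
    then show ?thesis
      unfolding p[symmetric] q[symmetric] by (simp add: power2_eq_square)
  qed
  define r where "r x = Y.sharp (X.sharp x) - s (X.N x) x" for x
  have Xr: "X x (r x) = 0" for x
  proof (rule X.T_nondegenerate)
    fix v
    have "poly (q x v) t = poly (p x v * p x v) t" for t
      using dual'[of "x + s t v"] unfolding p q poly_mult by (simp add: power2_eq_square)
    then have "q x v = p x v * p x v" using poly_eq_poly_eq_iff by blast
    then have "coeff (q x v) 1 = coeff (p x v * p x v) 1" by simp
    then have "T (Y.sharp (X.sharp x)) (X x v) = 2 * X.N x * T (X.sharp x) v"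
      by (simp add: p_def q_def coeff_mult atMost_Suc)
    moreover have "T (X x (Y.sharp (X.sharp x))) v = T (Y.sharp (X.sharp x)) (X x v)"
      by (metis X.T_X X.X_commute)
    ultimately show "T (X x (r x)) v = 0"
      by (simp add: r_def lin X.X_self)
  qed
  have c_inj: "y = 0" if "X c y = 0" for y
  proof -
    have "2 * T c y = T c (X c y)" unfolding X_unit by (simp add: X.T_linear T_unit)
    then have "T c y = 0" using that by simp
    then show ?thesis using that X_unit[of y] by simp
  qed
  define \<tau> where "\<tau> v = T c v" for v
  define \<sigma> where "\<sigma> v = T (X.sharp v) c" for v
  \<comment> \<open>\<open>r0\<close>, \<open>r1 v\<close>, \<open>r2 v\<close>, \<open>r3 v\<close>
    are the coefficients of \<open>r (c + t v)\<close> up to \<open>t^3\<close>. The coefficient of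
    \<open>t^4\<close> is \<open>r v\<close> itself, so the last step of the recursion reaches an
    arbitrary \<open>v\<close>.\<close>
  define r0 where "r0 = Y.sharp c - c"
  define r1 where "r1 v = Y c (X c v) - s (\<tau> v) c - v" for v
  define r2 where "r2 v = Y c (X.sharp v) + Y.sharp (X c v) - s (\<sigma> v) c - s (\<tau> v) v" for v
  define r3 where "r3 v = Y (X c v) (X.sharp v) - s (X.N v) c - s (\<sigma> v) v" for v
  have r_line: "r (c + s t v) = r0 + s t (r1 v) + s (t\<^sup>2) (r2 v) + s (t^3) (r3 v) + s (t^4) (r v)" for t v
    unfolding r_def sharp_line X.N_line r0_def r1_def r2_def r3_def
    by (rule X.T_eqI)
       (simp add: lin sharp_c N_c \<tau>_def \<sigma>_def Y.sharp_add Y.sharp_scale algebra_simps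
         power2_eq_square power3_eq_cube power4_eq_xxxx)
  have recursion: "X c r0 = 0" "X c (r1 v) + X v r0 = 0" "X c (r2 v) + X v (r1 v) = 0"
     "X c (r3 v) + X v (r2 v) = 0" "X c (r v) + X v (r3 v) = 0" for v
  proof -
    have "[: T (X c r0) z, T (X c (r1 v) + X v r0) z, T (X c (r2 v) + X v (r1 v)) z,
       T (X c (r3 v) + X v (r2 v)) z, T (X c (r v) + X v (r3 v)) z, T (X v (r v)) z :] = 0"
      (is "?p = 0") for z
    proof -
      have "poly ?p t = T (X (c + s t v) (r (c + s t v))) z" for t
        unfolding r_line
        by (simp add: lin algebra_simps power2_eq_square power3_eq_cube power4_eq_xxxx)
      then have "poly ?p t = 0" for t by (simp add: Xr)
      then show ?thesis by (metis poly_all_0_iff_0)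
    qed
    then show "X c r0 = 0" "X c (r1 v) + X v r0 = 0" "X c (r2 v) + X v (r1 v) = 0"
     "X c (r3 v) + X v (r2 v) = 0" "X c (r v) + X v (r3 v) = 0"
      by (auto intro!: X.T_nondegenerate)
  qed
  have r0: "r0 = 0" using recursion(1) by (rule c_inj)
  have r1: "r1 v = 0" for v using recursion(2)[of v] r0 by (auto intro: c_inj)
  have r2: "r2 v = 0" for v using recursion(3)[of v] r1 by (auto intro: c_inj)
  have r3: "r3 v = 0" for v using recursion(4)[of v] r2 by (auto intro: c_inj)
  have r: "r v = 0" for v using recursion(5)[of v] r3 by (auto intro: c_inj)
  have Ycc: "Y c c = s 2 c" using r0 by (simp add: r0_def Y.X_self)
  have Yc: "Y c v = s (\<tau> v) c - v" for v
  proof (rule X.T_eqI)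
    fix z
    have "\<tau> v * T c z - T (Y c v) z = T v z"
      using arg_cong[OF r1[of v], of "\<lambda>x. T x z"]
      by (simp add: r1_def X_unit Ycc lin \<tau>_def)
    then show "T (Y c v) z = T (s (\<tau> v) c - v) z"
      unfolding X.T_linear by (simp add: eq_diff_eq diff_eq_eq add.commute)
  qed
  \<comment> \<open>With \<open>Y c\<close> known, \<open>r2 v = 0\<close> is an equation whose only
    unknown is \<open>Y.sharp v\<close>.\<close>
  have YX: "Y.sharp v = X.sharp v" for v
  proof (rule X.T_eqI)
    fix z
    have "Y.sharp (X c v) = s ((\<tau> v)\<^sup>2) (Y.sharp c) - s (\<tau> v) (Y c v) + Y.sharp v"
      unfolding X_unit
      by (rule X.T_eqI) (simp add: Y.sharp_def lin \<tau>_def power2_eq_square Y.X_commute[of v c] field_simps)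
    then have Y: "T (Y.sharp (X c v)) z = \<tau> v * T v z + T (Y.sharp v) z"
      using r0 by (simp add: r0_def Yc lin power2_eq_square right_diff_distrib)
    have "\<tau> (X.sharp v) = \<sigma> v" by (simp add: \<tau>_def \<sigma>_def X.T_commute)
    then have "\<sigma> v * T c z - T (X.sharp v) z + T (Y.sharp (X c v)) z - \<sigma> v * T c z - \<tau> v * T v z = 0"
      using arg_cong[OF r2[of v], of "\<lambda>x. T x z"]
      by (simp add: r2_def Yc lin)
    with Y show "T (Y.sharp v) z = T (X.sharp v) z" by algebra
  qed
  show ?thesis
  proof
    show "X.sharp (X.sharp x) = s (X.N x) x" for x
      using r[of x] by (simp add: r_def YX)
  qed (fact X_unit T_unit)+
qed

theorem legendre_cubic_norm_structure:
  fixes s :: "'a::{alg_closed_field, field_char_0} \<Rightarrow> 'v::ab_group_add \<Rightarrow> 'v"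
  assumes V: "finite_dimensional_vector_space s B"
    and f: "cubic_form_on s UNIV f"
    and leg: "is_mult_legendre_transform s B f f_star"
    and f_star: "cubic_form_on fun_scale (dual_space s) f_star"
  obtains T X c where "cubic_norm_structure s B T X c" "f = trace_product.N T X"
proof -
  interpret finite_dimensional_vector_space s B by fact
  obtain M where "symmetric_trilinear s M" and fM: "\<And>x. f x = M x x x"
    using cubic_form_polarization[OF vector_space_axioms f] by blast
  then have f_eq: "f = (\<lambda>x. M x x x)" by auto
  interpret symmetric_trilinear s M by fact
  from leg obtain b where b: "M b b b \<noteq> 0" "det_dual B (log_hessian s f b) \<noteq> 0"
    and leg: "\<And>x. f x \<noteq> 0 \<Longrightarrow> f_star (log_differential s f x) = 1 / f x"
    unfolding is_mult_legendre_transform_def fM by blast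
  obtain u where u: "u ^ 3 = 1 / M b b b" using nth_root_exists[of 3 "1 / M b b b"] by auto
  with b have u0: "u \<noteq> 0" by (auto simp: power_0_left)
  define c where "c = s u b"
  have Mc: "M c c c = 1" using b u by (simp add: c_def expand power3_eq_cube field_simps)
  define T where "T v w = 9 * M c c v * M c c w - 6 * M c v w" for v w
  have T_add: "T (x + y) z = T x z + T y z" for x y z by (simp add: T_def expand algebra_simps)
  have T_scale: "T (s a x) z = a * T x z" for a x z by (simp add: T_def expand algebra_simps)
  have T_comm: "T x y = T y x" for x y using swap23[of c x y] by (simp add: T_def)
  \<comment> \<open>The determinant hypothesis concerns \<open>b\<close>. As \<open>c\<close> is a
    multiple of \<open>b\<close> and the logarithmic Hessian is homogeneous of degree -2,
    \<open>T\<close> is a nonzero multiple of the Hessian at \<open>b\<close>.\<close>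
  have nondeg: "x = 0" if x: "\<And>z. T x z = 0" for x
  proof (rule det_dual_nondegenerate[OF V _ _ b(2)])
    show "log_hessian s f b x w = 0" for w
    proof -
      have "u * (9 * u ^ 3 * M b b x * M b b w - 6 * M b x w) = 0"
        using x[of w] by (simp add: T_def c_def expand power3_eq_cube algebra_simps)
      with u0 have "9 * u ^ 3 * M b b x * M b b w = 6 * M b x w" by simp
      then have "9 * M b b x * M b b w / M b b b = 6 * M b x w" unfolding u by simp
      then show ?thesis
        using b unfolding f_eq log_hessian_cubic[OF b(1)] by (simp add: power2_eq_square field_simps)
    qed
  qed (use b in \<open>simp_all add: f_eq log_hessian_cubic expand field_simps power2_eq_square\<close>)
  obtain X where X: "trace_product s B T X" "\<And>x y z. T (X x y) z = 6 * M x y z"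
    using obtain_trace_product[OF V T_add T_scale T_comm nondeg] by blast
  interpret X: trace_product s B T X by fact
  \<comment> \<open>Pulling \<open>f_star\<close> back along \<open>x \<mapsto> T x\<close> moves it
    from the dual to \<open>V\<close>, where it can be compared with \<open>f\<close>.\<close>
  have "cubic_form_on s UNIV (\<lambda>y. f_star (T y))"
  proof (rule form_on_compose[OF f_star])
    show "T (x + y) = T x + T y" for x y by (simp add: fun_eq_iff T_add)
    show "T (s a x) = fun_scale a (T x)" for a x by (simp add: fun_eq_iff fun_scale_def T_scale)
    show "T x \<in> dual_space s" for x
      unfolding dual_space_def
      by (auto intro!: Vector_Spaces.linear.intro module_hom.intro module_hom_axioms.intro
            vector_space_axioms module_axioms simp: X.T_linear)
         (unfold_locales, auto simp: algebra_simps)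
  qed
  then obtain R where "symmetric_trilinear s R" and R: "\<And>x. f_star (T x) = R x x x"
    using cubic_form_polarization[OF vector_space_axioms] by blast
  then obtain Y where Y: "trace_product s B T Y" "\<And>x y z. T (Y x y) z = 6 * R x y z"
    using symmetric_trilinear.obtain_trace_product[OF _ V T_add T_scale T_comm nondeg] by blast
  interpret Y: trace_product s B T Y by fact
  have XN: "X.N x = f x" for x by (simp add: X.N_def X(2) fM)
  have YN: "Y.N x = f_star (T x)" for x by (simp add: Y.N_def Y(2) R)
  have "cubic_norm_structure s B T X c"
  proof (rule dual_products_cubic_norm_structure[OF X(1) Y(1)])
    have Tc: "T c x = 3 * M c c x" for x by (simp add: T_def Mc)
    show "X c x = s (T c x) c - x" for x
      by (rule X.T_eqI) (simp add: X.T_linear X(2) Tc, simp add: T_def)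
    show "T c c = 3" by (simp add: Tc Mc)
    show "Y.N (X.sharp x) = (X.N x)\<^sup>2" if "X.N x \<noteq> 0" for x
    proof -
      \<comment> \<open>Under the identification by \<open>T\<close>, \<open>f' / f\<close> at
        \<open>x\<close> is \<open>x# / f x\<close>; homogeneity of degree 3 then clears the
        denominator in the Legendre relation.\<close>
      have "log_differential s f x = T (s (1 / f x) (X.sharp x))"
        by (simp add: fun_eq_iff X.T_linear X.sharp_def X(2) f_eq log_differential_cubic)
      then have "Y.N (s (1 / f x) (X.sharp x)) = 1 / f x"
        using leg[of x] that by (simp add: XN YN)
      then show ?thesis using that
        by (simp add: Y.N_scale XN field_simps power2_eq_square power3_eq_cube)
    qed
  qed
  moreover have "f = X.N" by (simp add: fun_eq_iff XN)
  ultimately show ?thesis using that by blast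
qed


section \<open>Primitive idempotents\<close>

context cubic_norm_structure
begin

lemmas linear_simps = T_linear X_linear sharp_add sharp_scale

lemma sharp_unit: "sharp c = c"
  by (rule T_eqI) (simp add: sharp_def X_unit T_unit T_linear X_linear)

lemma N_unit: "N c = 1"
  by (simp add: N_sharp_self sharp_unit T_unit)

text \<open>This is the coefficient of \<open>t^2\<close> in the adjoint identity at
  \<open>x + t \<cdot> y\<close>, paired with an arbitrary vector.\<close>

lemma sharp_X: "sharp (X x y) + X (sharp x) (sharp y) = T (sharp x) y \<cdot> y + T (sharp y) x \<cdot> x"
proof -
  have "T (sharp (X x y) + X (sharp x) (sharp y)) z = T (T (sharp x) y \<cdot> y + T (sharp y) x \<cdot> x) z" for z
  proof -
    let ?p = "[:T (sharp (sharp x)) z, T (X (sharp x) (X x y)) z,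
      T (X (sharp x) (sharp y) + sharp (X x y)) z, T (X (X x y) (sharp y)) z, T (sharp (sharp y)) z:]"
    let ?q = "[:N x, T (sharp x) y, T (sharp y) x, N y:] * [:T x z, T y z:]"
    have "poly ?p t = T (sharp (sharp (x + t \<cdot> y))) z" for t
      by (simp add: linear_simps algebra_simps power2_eq_square power4_eq_xxxx)
    moreover have "poly ?q t = T (N (x + t \<cdot> y) \<cdot> (x + t \<cdot> y)) z" for t
      unfolding poly_mult N_line by (simp add: linear_simps algebra_simps)
    ultimately have "poly ?p t = poly ?q t" for t by (simp add: sharp_sharp)
    then have "?p = ?q" using poly_eq_poly_eq_iff by blast
    then have "coeff ?p 2 = coeff ?q 2" by simp
    then show ?thesis
      by (simp add: coeff_mult atMost_Suc numeral_2_eq_2 T_linear algebra_simps)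
  qed
  then show ?thesis by (rule T_eqI)
qed

text \<open>Linearization of \<open>sharp_X\<close> in \<open>y\<close>. A further linearization in
  \<open>x\<close> gives \<open>X_X_X_X\<close>; the two supply the Peirce multiplication
  rules.\<close>

lemma X_X_X: "X (X x y) (X x z) + X (sharp x) (X y z) =
    T (sharp x) y \<cdot> z + T (sharp x) z \<cdot> y + T (X y z) x \<cdot> x"
proof (rule T_eqI)
  fix u
  show "T (X (X x y) (X x z) + X (sharp x) (X y z)) u =
    T (T (sharp x) y \<cdot> z + T (sharp x) z \<cdot> y + T (X y z) x \<cdot> x) u"
    using arg_cong[OF sharp_X[of x "y + z"], of "\<lambda>a. T a u"]
      arg_cong[OF sharp_X[of x y], of "\<lambda>a. T a u"] arg_cong[OF sharp_X[of x z], of "\<lambda>a. T a u"]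
    unfolding linear_simps by algebra
qed

lemma X_X_X_X: "X (X x y) (X w z) + X (X w y) (X x z) + X (X x w) (X y z) =
    T (X x w) y \<cdot> z + T (X x w) z \<cdot> y + T (X y z) x \<cdot> w + T (X y z) w \<cdot> x"
proof (rule T_eqI)
  fix u
  show "T (X (X x y) (X w z) + X (X w y) (X x z) + X (X x w) (X y z)) u =
    T (T (X x w) y \<cdot> z + T (X x w) z \<cdot> y + T (X y z) x \<cdot> w + T (X y z) w \<cdot> x) u"
    using arg_cong[OF X_X_X[of "x + w" y z], of "\<lambda>a. T a u"]
      arg_cong[OF X_X_X[of x y z], of "\<lambda>a. T a u"] arg_cong[OF X_X_X[of w y z], of "\<lambda>a. T a u"]
    unfolding linear_simps by algebra
qed

lemma T_unit_X: "T c (X x y) = T c x * T c y - T x y"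
proof -
  have "T c (X x y) = T (X c x) y" by (simp add: T_X)
  then show ?thesis by (simp add: X_unit T_linear)
qed

definition primitive :: "'v \<Rightarrow> bool" where
  "primitive e \<longleftrightarrow> sharp e = 0 \<and> T c e = 1"

text \<open>The Peirce 1/2-space of the idempotent \<open>e\<close>. The 1-space is the line of
  \<open>e\<close>, and the 0-space appears below as the range of \<open>X e\<close>.\<close>

definition half :: "'v \<Rightarrow> 'v set" where
  "half e = {x. X e x = 0 \<and> T e x = 0}"

lemma half_trace: "primitive e \<Longrightarrow> x \<in> half e \<Longrightarrow> T c x = 0"
  using T_unit_X[of e x] by (simp add: primitive_def half_def)

lemma primitive_X:
  assumes "primitive e"
  shows "X e e = 0" "X e c = c - e" "X c e = c - e" "X e (c - e) = c - e" "T e e = 1"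
    "sharp (c - e) = e"
proof -
  have ce: "T c e = 1" using assms by (simp add: primitive_def)
  show ee: "X e e = 0" using assms by (simp add: primitive_def X_self)
  show 1: "X c e = c - e" by (simp add: X_unit ce)
  then show "X e c = c - e" by (simp add: X_commute)
  then show "X e (c - e) = c - e" by (simp add: X_linear ee)
  show "T e e = 1" using T_unit_X[of e e] ee ce by simp
  have "sharp (c + (-1) \<cdot> e) = e"
    using assms unfolding sharp_add sharp_scale
    by (simp add: sharp_unit X_linear primitive_def 1)
  then show "sharp (c - e) = e" by simp
qed

text \<open>Comes from \<open>X_X_X\<close> at \<open>e\<close>, \<open>y\<close>, \<open>c\<close>:
  \<open>sharp e = 0\<close> removes one term and the unit law evaluates the others. It makes
  \<open>X e\<close> the involution \<open>y \<mapsto> T c y \<cdot> (c - e) - y\<close> on its own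
  range.\<close>

lemma primitive_X_X:
  assumes "primitive e"
  shows "X e (X e y) = (T c y - T e y) \<cdot> (c - e) - X e y"
proof -
  have e: "sharp e = 0" using assms by (simp add: primitive_def)
  have "X (X e y) (X e c) = T (X y c) e \<cdot> e" using X_X_X[of e y c] by (simp add: e)
  moreover have "T (X y c) e = T c y - T e y"
    using T_X[of y c e] primitive_X[OF assms] by (simp add: T_linear T_commute)
  moreover have "X (X e y) (X e c) = X c (X e y) - X e (X e y)"
    using primitive_X[OF assms] by (simp add: X_linear X_commute)
  moreover have "X c (X e y) = (T c y - T e y) \<cdot> c - X e y"
    using assms by (simp add: X_unit T_unit_X primitive_def)
  ultimately show ?thesis by (simp add: algebra_simps)
qed

lemma T_primitive_X: "primitive e \<Longrightarrow> T e (X e y) = 0"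
  using T_X[of e e y] primitive_X(1) by simp

lemma sharp_primitive_X: "primitive e \<Longrightarrow> sharp (X e y) = T (sharp y) e \<cdot> e"
  using sharp_X[of e y] by (simp add: primitive_def)

lemma half_part:
  assumes "primitive e"
  shows "v - T e v \<cdot> e - X e (X e v) \<in> half e"
  using primitive_X_X[OF assms, of v] primitive_X_X[OF assms, of "X e v"] assms primitive_X[OF assms]
  by (simp add: half_def linear_simps T_primitive_X T_unit_X primitive_def T_commute[of e c])

text \<open>The right side is \<open>X e (X e (sharp h))\<close>, so the adjoint of a half-space
  vector lies in the Peirce 0-space.\<close>

lemma sharp_half:
  assumes e: "primitive e" and h: "h \<in> half e"
  shows "sharp h = T c (sharp h) \<cdot> (c - e) - X e (sharp h)"
proof -
  have eh: "X e h = 0" "T e h = 0" "T c h = 0" using h half_trace[OF e h] by (auto simp: half_def)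
  have "T (sharp h) e = 0"
    using eh T_X[of h h e] by (simp add: sharp_def T_linear X_commute)
  moreover have "X h e = 0" using eh by (simp add: X_commute)
  ultimately have "X (sharp h) (c - e) = T (sharp h) c \<cdot> e"
    using X_X_X[of h e c] primitive_X[OF e] eh by (simp add: T_linear T_commute)
  then have "T c (sharp h) \<cdot> c - sharp h - X e (sharp h) = T c (sharp h) \<cdot> e"
    by (simp add: X_diff_right X_commute[of "sharp h"] X_unit T_commute)
  then show ?thesis by (simp add: algebra_simps)
qed

text \<open>The model is the triple of diagonal matrix units of 3 by 3 matrices, where the cross
  product of two of them is the remaining one.\<close>

definition frame :: "'v \<Rightarrow> 'v \<Rightarrow> 'v \<Rightarrow> bool" where
  "frame a b d \<longleftrightarrow> primitive a \<and> primitive b \<and> primitive d \<and>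
     X a b = d \<and> X b d = a \<and> X d a = b \<and> a + b + d = c"

lemma frame_rotate: "frame a b d \<Longrightarrow> frame b d a"
  by (auto simp: frame_def add_ac)

lemma frame_swap: "frame a b d \<Longrightarrow> frame b a d"
  by (auto simp: frame_def add_ac X_commute)

end

locale cubic_norm_structure_alg_closed = cubic_norm_structure s B T X c
  for s :: "'a::{alg_closed_field, field_char_0} \<Rightarrow> 'v::ab_group_add \<Rightarrow> 'v" (infixr "\<cdot>" 75)
    and B T X c
begin

lemma square_root: "\<exists>y::'a. y\<^sup>2 = x"
  by (rule nth_root_exists) simp

text \<open>If \<open>N y = 0\<close>, then \<open>sharp (sharp y) = 0\<close>, so
  \<open>sharp y\<close> can be rescaled to a primitive element unless its trace is zero. When this
  never succeeds, \<open>T\<close> vanishes on vectors of trace zero, and nondegeneracy leaves only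
  the line of \<open>c\<close>.\<close>

lemma unit_spans_or_primitive:
  assumes "\<nexists>e. primitive e"
  shows "x = (T c x / 3) \<cdot> c"
proof -
  have S: "T c (sharp y) = 0" if "N y = 0" for y
  proof (rule ccontr)
    assume *: "T c (sharp y) \<noteq> 0"
    have "primitive ((1 / T c (sharp y)) \<cdot> sharp y)"
      using * that by (simp add: primitive_def sharp_scale sharp_sharp T_linear)
    with assms show False by blast
  qed
  have T0: "T x x = 0" if x: "T c x = 0" for x
  proof -
    let ?S = "T c (sharp x)"
    have N: "N (x + l \<cdot> c) = N x + ?S * l + l ^ 3" for l
      using x by (simp add: N_line sharp_unit N_unit T_commute[of x c] T_commute[of "sharp x" c] algebra_simps power3_eq_cube)
    have S': "T c (sharp (x + l \<cdot> c)) = ?S + 3 * l\<^sup>2" for l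
      using x by (simp add: linear_simps sharp_unit T_unit T_unit_X T_commute[of x c] power2_eq_square)
    \<comment> \<open>The vanishing of \<open>T c (sharp (x + l \<cdot> c))\<close> says that
      \<open>l\<close> is a double root of the cubic \<open>N (x + l \<cdot> c)\<close>. The roots
      sum to zero, so \<open>- 2 * l\<close> is a root as well and must again be double; this forces
      \<open>l = 0\<close>.\<close>
    have "\<exists>l. poly [:N x, ?S, 0, 1:] l = 0" by (rule alg_closed_imp_poly_has_root) simp
    then obtain l where l: "N (x + l \<cdot> c) = 0"
      unfolding N by (auto simp: algebra_simps power3_eq_cube)
    then have 1: "?S + 3 * l\<^sup>2 = 0" using S' S by metis
    then have "N (x + (- 2 * l) \<cdot> c) = 0"
      using l unfolding N by algebra
    then have "?S + 3 * (- 2 * l)\<^sup>2 = 0" using S' S by metis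
    with 1 have "9 * l\<^sup>2 = 0" by algebra
    with 1 have "?S = 0" by simp
    then have "T c (X x x) = 0" by (simp add: X_self T_linear)
    with x show ?thesis by (simp add: T_unit_X)
  qed
  have T0': "T x y = 0" if "T c x = 0" "T c y = 0" for x y
  proof -
    have "T (x + y) (x + y) = 0" by (rule T0) (simp add: T_linear that)
    then have "2 * T x y = 0"
      using T0[OF that(1)] T0[OF that(2)] by (simp add: T_linear T_commute[of y x])
    then show ?thesis by simp
  qed
  have "x - (T c x / 3) \<cdot> c = 0" (is "?x0 = 0")
  proof (rule T_nondegenerate)
    fix z
    have "T (x - (T c x / 3) \<cdot> c) (z - (T c z / 3) \<cdot> c) = 0"
      by (rule T0') (simp_all add: T_linear T_unit)
    then show "T (x - (T c x / 3) \<cdot> c) z = 0"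
      by (simp add: T_linear T_unit T_commute[of x c] algebra_simps)
  qed
  then show ?thesis by simp
qed

text \<open>On the 0-space \<open>range (X e)\<close> the adjoint of \<open>y\<close> is
  \<open>q y \<cdot> e\<close> with \<open>q y = T (sharp y) e\<close>, so splitting
  \<open>c - e\<close> into two primitive elements is a quadratic equation. The hypothesis on
  \<open>half e\<close> excludes a 0-space that is only the line of \<open>c - e\<close>.\<close>

lemma frame_extends_primitive:
  assumes e: "primitive e" and h0: "half e \<noteq> {0}"
  obtains b d where "frame e b d"
proof -
  let ?e' = "c - e"
  have eP: "X e (X e y) = (T c (X e y)) \<cdot> ?e' - X e y" for y
    using primitive_X_X[OF e] e by (simp add: T_unit_X primitive_def)
  have eV0: "X e y = T c y \<cdot> ?e' - y" if "y \<in> range (X e)" for y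
    using that eP by auto
  have Te: "T e y = 0" if "y \<in> range (X e)" for y
    using that T_primitive_X[OF e] by auto
  have closed: "x + a \<cdot> y \<in> range (X e)" if "x \<in> range (X e)" "y \<in> range (X e)" for x a y
    using that by (auto simp flip: X_scale_right X_add_right)
  have e': "?e' \<in> range (X e)" using primitive_X(2)[OF e] by (metis rangeI)
  have Tce': "T c ?e' = 2" "T e ?e' = 0"
    using e primitive_X[OF e] by (simp_all add: T_linear T_unit primitive_def T_commute[of e c])
  have sharpV0: "sharp y = T (sharp y) e \<cdot> e" if "y \<in> range (X e)" for y
    using that sharp_primitive_X[OF e] primitive_X(5)[OF e] by (auto simp: T_linear)
  have T_range: "T (X e p) h = T p (X e h)" for p h by (metis T_X X_commute)
  have decomp: "T y z = 0" if "T y e = 0" "\<And>h. h \<in> half e \<Longrightarrow> T y h = 0"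
      "\<And>w. w \<in> range (X e) \<Longrightarrow> T y w = 0" for y z
  proof -
    have "T y (z - T e z \<cdot> e - X e (X e z)) = 0" using half_part[OF e] that(2) by blast
    then show ?thesis using that(1,3) by (simp add: T_linear)
  qed
  have "\<exists>y \<in> range (X e). T c y = 0 \<and> T (sharp y) e \<noteq> 0"
  proof (rule ccontr)
    assume "\<not> ?thesis"
    then have q0: "T (sharp y) e = 0" if "y \<in> range (X e)" "T c y = 0" for y using that by blast
    have T0: "T y z = 0" if "y \<in> range (X e)" "T c y = 0" "z \<in> range (X e)" "T c z = 0" for y z
    proof -
      have "y + z \<in> range (X e)" using closed[OF that(1,3), of 1] by simp
      then have "T (sharp (y + z)) e = 0" using that by (intro q0) (simp_all add: T_linear)
      then have "T (X y z) e = 0" using q0 that by (simp add: linear_simps)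
      then have "T y (X e z) = 0" by (simp add: T_X X_commute)
      then show ?thesis using eV0[OF that(3)] that by (simp add: T_linear)
    qed
    have y0: "y = 0" if y: "y \<in> range (X e)" "T c y = 0" for y
    proof (rule T_nondegenerate, rule decomp)
      show "T y e = 0" using Te[OF y(1)] by (simp add: T_commute)
      show "T y h = 0" if "h \<in> half e" for h
        using y(1) that by (auto simp: half_def T_range)
      show "T y w = 0" if w: "w \<in> range (X e)" for w
      proof -
        have "T c (w + (- T c w / 2) \<cdot> ?e') = 0"
          unfolding T_add_right T_scale_right Tce'(1) by simp
        with T0 y closed[OF w e'] have "T y (w + (- T c w / 2) \<cdot> ?e') = 0" by blast
        moreover have "T y ?e' = 0" using y(2) Te[OF y(1)] by (simp add: T_linear T_commute)
        ultimately show ?thesis by (simp only: T_linear) simp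
      qed
    qed
    have line: "y = (T c y / 2) \<cdot> ?e'" if y: "y \<in> range (X e)" for y
    proof -
      have "y + (- T c y / 2) \<cdot> ?e' = 0"
        by (intro y0 closed[OF y e']) (simp only: T_add_right T_scale_right Tce'(1), simp)
      then show ?thesis by simp
    qed
    \<comment> \<open>The adjoint of \<open>h\<close> is now a multiple
      \<open>m \<cdot> (c - e)\<close>, whose own adjoint \<open>m^2 \<cdot> e\<close> must be a
      multiple of \<open>h\<close>. Since \<open>T e h = 0\<close>, this gives
      \<open>m = 0\<close>.\<close>
    have sharp0: "sharp h = 0" if h: "h \<in> half e" for h
    proof -
      obtain m where m: "sharp h = m \<cdot> ?e'"
      proof
        show "sharp h = (T c (sharp h) - T c (X e (sharp h)) / 2) \<cdot> ?e'"
          using sharp_half[OF e h] line[of "X e (sharp h)"] by (simp add: scale_left_diff_distrib)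
      qed
      then have "m\<^sup>2 \<cdot> e = N h \<cdot> h"
        using sharp_sharp[of h] primitive_X(6)[OF e] by (simp add: sharp_scale)
      then have "T e (m\<^sup>2 \<cdot> e) = T e (N h \<cdot> h)" by simp
      then have "m\<^sup>2 = 0" using h primitive_X(5)[OF e] by (simp add: T_linear half_def)
      with m show ?thesis by simp
    qed
    have "h = 0" if h: "h \<in> half e" for h
    proof (rule T_nondegenerate, rule decomp)
      show "T h e = 0" using h by (simp add: half_def T_commute)
      show "T h w = 0" if "w \<in> range (X e)" for w
        using h that by (auto simp: half_def T_commute[of h] T_range)
      show "T h k = 0" if k: "k \<in> half e" for k
      proof -
        have "h + k \<in> half e" using h k by (simp add: half_def X_linear T_linear)
        then have "X h k = 0" using sharp_add[of h k] sharp0 h k by simp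
        then show ?thesis using T_unit_X[of h k] half_trace[OF e] h k by simp
      qed
    qed
    moreover have "0 \<in> half e" by (simp add: half_def)
    ultimately show False using h0 by blast
  qed
  then obtain y where y: "y \<in> range (X e)" "T c y = 0" "T (sharp y) e \<noteq> 0" by blast
  \<comment> \<open>Chosen so that \<open>b\<close> below satisfies
    \<open>q b = 1/4 + k^2 * q y = 0\<close>; the cross term vanishes because \<open>y\<close> has
    trace zero.\<close>
  obtain k where k: "k\<^sup>2 = - 1 / (4 * T (sharp y) e)" using square_root by blast
  define b where "b = (1/2) \<cdot> ?e' + k \<cdot> y"
  define d where "d = X e b"
  have bV0: "b \<in> range (X e)"
    using closed[OF closed[of 0 ?e' "1/2"] y(1), of k] e' closed[OF e' e', of "-1"] by (simp add: b_def)
  have Tcb: "T c b = 1" using Tce'(1) y(2) by (simp add: b_def T_add_right T_scale_right)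
  have "T (X ?e' y) e = T y (X e ?e')" by (metis T_X T_commute X_commute)
  also have "\<dots> = 0"
    using y(2) Te[OF y(1)] primitive_X(4)[OF e] by (simp add: T_linear T_commute)
  finally have "T (sharp b) e = 1 / 4 + k\<^sup>2 * T (sharp y) e"
    using primitive_X[OF e] by (simp add: b_def sharp_add sharp_scale X_scale_left X_scale_right
        T_add_left T_scale_left power2_eq_square)
  then have qb: "T (sharp b) e = 0" using k y(3) by (simp add: field_simps)
  then have b: "primitive b" using sharpV0[OF bV0] Tcb by (simp add: primitive_def)
  have d_eq: "d = ?e' - b" using eV0[OF bV0] Tcb by (simp add: d_def)
  have d: "primitive d"
    using sharp_primitive_X[OF e, of b] qb Tce' Tcb by (simp add: primitive_def d_def[symmetric] d_eq T_diff_right)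
  have "X b d = X b c - X b e - X b b" by (simp add: d_eq X_diff_right)
  also have "X b e = d" by (simp add: d_def X_commute)
  finally have bd: "X b d = e" using primitive_X(1,2)[OF b] by (simp add: d_eq)
  have "X d e = X e ?e' - X e b" unfolding d_eq by (metis X_commute X_diff_right)
  then have "X d e = ?e' - d" unfolding primitive_X(4)[OF e] d_def .
  then have de: "X d e = b" unfolding d_eq by simp
  have "e + b + d = c" by (simp add: d_eq)
  then have "frame e b d"
    unfolding frame_def by (intro conjI e b d bd de d_def[symmetric])
  then show ?thesis by (rule that)
qed

end


section \<open>Peirce decomposition of a frame\<close>

context cubic_norm_structure
begin

text \<open>The intersection of the half spaces of \<open>a\<close> and \<open>b\<close>; for a
  frame this is the off-diagonal Peirce space between them.\<close>

definition peirce :: "'v \<Rightarrow> 'v \<Rightarrow> 'v set" where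
  "peirce a b = {x. X a x = 0 \<and> X b x = 0 \<and> T a x = 0 \<and> T b x = 0}"

lemma peirce_commute: "peirce a b = peirce b a"
  by (auto simp: peirce_def)

lemma peirce_linear:
  "x \<in> peirce a b \<Longrightarrow> y \<in> peirce a b \<Longrightarrow> x + y \<in> peirce a b"
  "x \<in> peirce a b \<Longrightarrow> k \<cdot> x \<in> peirce a b"
  "x \<in> peirce a b \<Longrightarrow> y \<in> peirce a b \<Longrightarrow> x - y \<in> peirce a b"
  "0 \<in> peirce a b"
  by (simp_all add: peirce_def X_linear T_linear)

lemma frame_T:
  assumes "frame a b d"
  shows "T a a = 1" "T b b = 1" "T d d = 1" "T a b = 0" "T b d = 0" "T a d = 0"
proof -
  have p: "primitive a" "primitive b" "primitive d" using assms by (auto simp: frame_def)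
  then show "T a a = 1" "T b b = 1" "T d d = 1" by (simp_all add: primitive_X)
  show "T a b = 0" "T b d = 0" "T a d = 0"
    using T_unit_X[of a b] T_unit_X[of b d] T_unit_X[of d a] assms p
    by (auto simp: frame_def primitive_def T_commute[of a d])
qed

text \<open>In \<open>c \<times> x\<close> with \<open>c = a + b + d\<close> only \<open>d\<close>
  contributes, so \<open>d\<close> acts by -1. Hence \<open>sharp x = sharp (d \<times> x)\<close>,
  which is a multiple of \<open>d\<close> because \<open>d\<close> is primitive.\<close>

lemma peirce_third:
  assumes f: "frame a b d" and x: "x \<in> peirce a b"
  shows "T c x = 0" "T d x = 0" "X d x = - x" "sharp x = (- (T x x / 2)) \<cdot> d"
proof -
  have p: "primitive a" "primitive d" and c: "c = a + b + d" using f by (auto simp: frame_def)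
  have ax: "X a x = 0" "X b x = 0" "T a x = 0" "T b x = 0" using x by (auto simp: peirce_def)
  show Tc: "T c x = 0" using T_unit_X[of a x] ax p by (simp add: primitive_def)
  then show "T d x = 0" using ax by (simp add: c T_linear)
  have "X c x = X d x" using ax by (simp add: c X_linear)
  then show dx: "X d x = - x" by (simp add: X_unit Tc)
  have "T (sharp x) d = - (T x x / 2)"
    using T_X[of x x d] dx by (simp add: sharp_def T_linear X_commute[of x d])
  moreover have "sharp (X d x) = sharp x"
    using sharp_scale[of "-1" x] by (simp add: dx)
  ultimately show "sharp x = (- (T x x / 2)) \<cdot> d"
    using sharp_primitive_X[OF p(2), of x] by simp
qed

lemma peirce_orthogonal:
  assumes f: "frame a b d" and x: "x \<in> peirce a b" and y: "y \<in> peirce b d"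
  shows "T x y = 0"
proof -
  have "X a y = - y" using peirce_third(3)[OF frame_rotate[OF f] y] .
  moreover have "T x (X a y) = T (X a x) y" by (metis T_X X_commute)
  ultimately show ?thesis using x by (simp add: T_linear peirce_def)
qed

text \<open>Writing \<open>a\<close> and \<open>d\<close> as cross products of frame elements lets
  \<open>X_X_X_X\<close> move them onto \<open>x\<close> and \<open>y\<close>, which the frame
  elements annihilate or negate.\<close>

lemma peirce_X:
  assumes f: "frame a b d" and x: "x \<in> peirce a b" and y: "y \<in> peirce b d"
  shows "X x y \<in> peirce a d"
proof -
  note x' = peirce_third[OF f x] and y' = peirce_third[OF frame_rotate[OF f] y]
  have 0: "X a x = 0" "X b x = 0" "X b y = 0" "X d y = 0" "T a x = 0" "T b x = 0" "T b y = 0" "T d y = 0"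
    using x y by (auto simp: peirce_def)
  have bd: "X b d = a" "X d a = b" "X a b = d" using f by (auto simp: frame_def)
  note xy = peirce_orthogonal[OF f x y]
  have "X (X b d) (X x y) = 0"
    using X_X_X_X[of b d x y] by (simp add: 0 x' xy bd T_commute[of y x] X_commute[of y d] T_linear)
  moreover have "X (X a b) (X x y) = 0"
    using X_X_X_X[of b a y x] 0 x' y' xy bd by (simp add: X_commute[of b a] X_commute[of y x] T_linear T_commute[of y x])
  moreover have "T a (X x y) = 0" "T d (X x y) = 0"
    using T_X[of a x y] T_X[of d y x] 0 by (simp_all add: X_commute)
  ultimately show ?thesis by (simp add: peirce_def bd)
qed

text \<open>The right side of \<open>sharp_X\<close> vanishes by orthogonality, and the adjoints are
  multiples of frame elements. For \<open>n x = T x x / 2\<close> this is multiplicativity of the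
  norm.\<close>

lemma peirce_X_norm:
  assumes f: "frame a b d" and x: "x \<in> peirce a b" and y: "y \<in> peirce b d"
  shows "T (X x y) (X x y) = T x x * T y y / 2"
proof -
  note x' = peirce_third[OF f x] and y' = peirce_third[OF frame_rotate[OF f] y]
  have f': "frame a d b" using frame_swap[OF frame_rotate[OF frame_rotate[OF f]]] .
  have b: "T b b = 1" "X d a = b" using frame_T[OF f] f by (auto simp: frame_def)
  have "T a x = 0" "T d y = 0" using x y by (auto simp: peirce_def)
  then have "sharp (X x y) + (T x x * T y y / 4) \<cdot> b = 0"
    using sharp_X[of x y] b by (simp add: x' y' X_linear T_linear mult.commute[of "T y y"])
  then have "T (sharp (X x y) + (T x x * T y y / 4) \<cdot> b) b = 0" by simp
  then show ?thesis
    using peirce_third(4)[OF f' peirce_X[OF f x y]] b by (simp add: T_linear)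
qed

text \<open>\<open>X b\<close> exchanges \<open>a\<close> and \<open>d\<close>, is -1 on
  \<open>peirce a d\<close> and kills everything else, so this expression is the projection of
  \<open>v\<close> to \<open>peirce a d\<close>.\<close>

lemma peirce_component:
  assumes f: "frame a b d"
  shows "T v a \<cdot> d + T v d \<cdot> a - X b v \<in> peirce a d"
proof -
  have p: "primitive a" "primitive b" "primitive d" and
    bd: "X b d = a" "X d a = b" "X a b = d" using f by (auto simp: frame_def)
  have "X (X b d) (X b v) = T a v \<cdot> b" "X (X b a) (X b v) = T d v \<cdot> b"
    using X_X_X[of b d v] X_X_X[of b a v] p T_X[of d v b] T_X[of a v b]
     by (simp_all add: primitive_def T_commute)
       (metis T_X T_commute X_commute bd)+
  then show ?thesis
    using bd frame_T[OF f] p T_X[of a b v] T_X[of d b v]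
    by (simp add: peirce_def X_linear T_linear primitive_X X_commute[of b a] X_commute[of a d] T_commute[of d a] T_commute[of v] X_commute[of d b])
qed

text \<open>This is the unit law \<open>X c v = T c v \<cdot> c - v\<close>, expanded along
  \<open>c = a + b + d\<close>.\<close>

lemma peirce_sum:
  assumes f: "frame a b d"
  shows "v = T v a \<cdot> a + T v b \<cdot> b + T v d \<cdot> d + (T v a \<cdot> b + T v b \<cdot> a - X d v) +
      (T v b \<cdot> d + T v d \<cdot> b - X a v) + (T v a \<cdot> d + T v d \<cdot> a - X b v)"
proof -
  have c: "c = a + b + d" using f by (simp add: frame_def)
  show ?thesis
    using X_unit[of v]
    by (simp add: c X_linear T_linear T_commute[of v] scale_left_distrib scale_right_distrib algebra_simps)
qed

lemma peirce_decomposition: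
  assumes f: "frame a b d"
  obtains x y z where "x \<in> peirce a b" "y \<in> peirce b d" "z \<in> peirce a d"
    "v = T v a \<cdot> a + T v b \<cdot> b + T v d \<cdot> d + x + y + z"
proof (rule that[OF _ _ _ peirce_sum[OF f]])
  have f': "frame b a d" "frame a d b" using frame_swap[OF f] frame_rotate[OF frame_swap[OF f]] .
  show "T v a \<cdot> b + T v b \<cdot> a - X d v \<in> peirce a b" by (rule peirce_component[OF f'(2)])
  show "T v b \<cdot> d + T v d \<cdot> b - X a v \<in> peirce b d" by (rule peirce_component[OF f'(1)])
  show "T v a \<cdot> d + T v d \<cdot> a - X b v \<in> peirce a d" by (rule peirce_component[OF f])
qed

lemma peirce_nondegenerate:
  assumes f: "frame a b d" and x: "x \<in> peirce a b" and 0: "\<And>y. y \<in> peirce a b \<Longrightarrow> T x y = 0"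
  shows "x = 0"
proof (rule T_nondegenerate)
  fix v
  have f': "frame b a d" using frame_swap[OF f] .
  obtain x' y z where *: "x' \<in> peirce a b" "y \<in> peirce b d" "z \<in> peirce a d"
    "v = T v a \<cdot> a + T v b \<cdot> b + T v d \<cdot> d + x' + y + z"
    using peirce_decomposition[OF f] .
  have "T x a = 0" "T x b = 0" "T x d = 0"
    using x peirce_third(2)[OF f x] by (auto simp: peirce_def T_commute)
  moreover have "T x y = 0" using peirce_orthogonal[OF f x *(2)] .
  moreover have "T x z = 0" using peirce_orthogonal[OF f' _ *(3)] x peirce_commute by blast
  ultimately show "T x v = 0"
    using 0[OF *(1)] by (subst *(4)) (simp add: T_linear)
qed

text \<open>The norm law, polarized in \<open>y\<close>, determines \<open>T (X x (X x y)) z\<close>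
  because \<open>X x\<close> is self-adjoint; nondegeneracy on \<open>peirce b d\<close> does the
  rest. For \<open>T x x = 2\<close>, applying \<open>X x\<close> twice is the identity.\<close>

lemma peirce_X_X:
  assumes f: "frame a b d" and x: "x \<in> peirce a b" and y: "y \<in> peirce b d"
  shows "X x (X x y) = (T x x / 2) \<cdot> y"
proof -
  have bd: "frame b d a" "frame b a d" using frame_rotate[OF f] frame_swap[OF f] .
  have mem: "X x (X x y') \<in> peirce b d" if "y' \<in> peirce b d" for y'
    using peirce_X[OF bd(2) _ peirce_X[OF f x that]] x peirce_commute by blast
  have polar: "T (X x y) (X x z) = T x x * T y z / 2" if z: "z \<in> peirce b d" for z
  proof -
    have "T (X x (y + z)) (X x (y + z)) = T x x * T (y + z) (y + z) / 2"
      using peirce_X_norm[OF f x] peirce_linear(1)[OF y z] by blast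
    then have "2 * T (X x y) (X x z) = 2 * (T x x * T y z / 2)"
      using peirce_X_norm[OF f x y] peirce_X_norm[OF f x z]
      by (simp add: X_linear T_linear T_commute[of z y] T_commute[of "X x z" "X x y"] field_simps)
    then show ?thesis by (metis mult_cancel_left zero_neq_numeral)
  qed
  have "X x (X x y) - (T x x / 2) \<cdot> y = 0"
  proof (rule peirce_nondegenerate[OF bd(1)])
    show "X x (X x y) - (T x x / 2) \<cdot> y \<in> peirce b d"
      using mem[OF y] y by (intro peirce_linear)
    show "T (X x (X x y) - (T x x / 2) \<cdot> y) z = 0" if "z \<in> peirce b d" for z
      using polar[OF that] T_X[of "X x y" x z] by (simp add: T_linear X_commute[of x "X x y"])
  qed
  then show ?thesis by simp
qed

text \<open>Formally the determinant of a hermitian 3 by 3 matrix: \<open>T x x / 2\<close> plays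
  the norm of an entry and \<open>T (X x y) z\<close> the trace of the product of three
  entries.\<close>

lemma N_frame:
  assumes f: "frame a b d" and x: "x \<in> peirce a b" and y: "y \<in> peirce b d" and z: "z \<in> peirce a d"
  shows "N (\<alpha> \<cdot> a + \<beta> \<cdot> b + \<delta> \<cdot> d + x + y + z) =
     \<alpha> * \<beta> * \<delta> - \<delta> * T x x / 2 - \<alpha> * T y y / 2 - \<beta> * T z z / 2 + T (X x y) z"
proof -
  have f': "frame b d a" "frame a d b" "frame b a d"
    using frame_rotate[OF f] frame_swap[OF frame_rotate[OF frame_rotate[OF f]]] frame_swap[OF f] .
  have z': "z \<in> peirce d a" and x': "x \<in> peirce b a" and y': "y \<in> peirce d b"
    using z x y peirce_commute by blast+
  have p: "primitive a" "primitive b" "primitive d" and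
    bd: "X b d = a" "X d a = b" "X a b = d" using f by (auto simp: frame_def)
  note third = peirce_third[OF f x] peirce_third[OF f'(1) y] peirce_third[OF f'(2) z]
  have sh: "sharp a = 0" "sharp b = 0" "sharp d = 0" using p by (auto simp: primitive_def)
  have 0: "T a x = 0" "T b x = 0" "T b y = 0" "T d y = 0" "T a z = 0" "T d z = 0"
    using x y z by (auto simp: peirce_def)
  have xyz: "T x y = 0" "T x z = 0" "T z y = 0"
    using peirce_orthogonal[OF f x y] peirce_orthogonal[OF f'(3) x' z] peirce_orthogonal[OF f'(2) z y'] .
  have mem: "X x y \<in> peirce a d" "X x z \<in> peirce b d" "X z y \<in> peirce a b"
    using peirce_X[OF f x y] peirce_X[OF f'(3) x' z] peirce_X[OF f'(2) z y'] .
  have 1: "T a (X x y) = 0" "T d (X x y) = 0" "T b (X x z) = 0" "T d (X x z) = 0" "T a (X z y) = 0" "T b (X z y) = 0"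
    using mem by (auto simp: peirce_def)
  have 2: "T b (X x y) = 0" "T a (X x z) = 0" "T d (X z y) = 0"
    using peirce_third(2)[OF f'(2) mem(1)] peirce_third(2)[OF f'(1) mem(2)] peirce_third(2)[OF f mem(3)] .
  let ?u = "\<alpha> \<cdot> a + \<beta> \<cdot> b + \<delta> \<cdot> d" and ?w = "x + y + z"
  have su: "sharp ?u = (\<alpha> * \<beta>) \<cdot> d + (\<beta> * \<delta>) \<cdot> a + (\<alpha> * \<delta>) \<cdot> b"
    using bd by (simp add: sh sharp_add sharp_scale X_linear X_commute[of a d] scale_right_distrib mult_ac)
  have Nu: "N ?u = \<alpha> * \<beta> * \<delta>"
    by (simp add: N_sharp_self su T_linear frame_T[OF f] T_commute[of d a] T_commute[of d b] T_commute[of b a])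
  have 3: "T (sharp ?u) ?w = 0"
    by (simp add: su T_linear 0 third)
  have sw: "sharp ?w = (- (T x x / 2)) \<cdot> d + (- (T y y / 2)) \<cdot> a + (- (T z z / 2)) \<cdot> b + X x y + X x z + X z y"
    using third by (simp add: sharp_add X_linear X_commute[of y z])
  have 4: "T (sharp ?w) ?u = - \<delta> * T x x / 2 - \<alpha> * T y y / 2 - \<beta> * T z z / 2"
    by (simp add: sw T_linear frame_T[OF f] T_commute[of d a] T_commute[of d b] T_commute[of b a] 1 2
        T_commute[of "X x y"] T_commute[of "X x z"] T_commute[of "X z y"])
  have Nx: "N x = 0" "N y = 0" "N z = 0"
    using third 0 by (simp_all add: N_sharp_self T_linear)
  have Nw: "N ?w = T (X x y) z"
    using third 0 xyz by (simp add: N_add Nx sharp_add T_linear T_commute[of d])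
  have "N (?u + ?w) = \<alpha> * \<beta> * \<delta> - \<delta> * T x x / 2 - \<alpha> * T y y / 2 - \<beta> * T z z / 2 + T (X x y) z"
    unfolding N_add[of ?u ?w] Nu Nw 3 4 by simp
  then show ?thesis by (simp add: add.assoc)
qed

end


section \<open>Composition algebras\<close>

text \<open>The norm is \<open>T x x / 2\<close>. Outside \<open>W\<close> the multiplication is only required to be bilinear.\<close>

locale composition_algebra = vector_space s
  for s :: "'a::{alg_closed_field, field_char_0} \<Rightarrow> 'v::ab_group_add \<Rightarrow> 'v" (infixr "\<cdot>" 75) +
  fixes T :: "'v \<Rightarrow> 'v \<Rightarrow> 'a" and m :: "'v \<Rightarrow> 'v \<Rightarrow> 'v" (infixl "\<star>" 74) and W :: "'v set" and e :: 'v
  assumes T_add_left: "T (x + y) z = T x z + T y z"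
    and T_scale_left: "T (k \<cdot> x) z = k * T x z"
    and T_commute: "T x y = T y x"
    and m_add_left: "(x + y) \<star> z = x \<star> z + y \<star> z"
    and m_add_right: "z \<star> (x + y) = z \<star> x + z \<star> y"
    and m_scale_left: "(k \<cdot> x) \<star> z = k \<cdot> (x \<star> z)"
    and m_scale_right: "z \<star> (k \<cdot> x) = k \<cdot> (z \<star> x)"
    and W_add [simp]: "x \<in> W \<Longrightarrow> y \<in> W \<Longrightarrow> x + y \<in> W"
    and W_scale [simp]: "x \<in> W \<Longrightarrow> k \<cdot> x \<in> W"
    and W_mult [simp]: "x \<in> W \<Longrightarrow> y \<in> W \<Longrightarrow> x \<star> y \<in> W"
    and W_unit [simp]: "e \<in> W"
    and unit_left [simp]: "x \<in> W \<Longrightarrow> e \<star> x = x"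
    and unit_right [simp]: "x \<in> W \<Longrightarrow> x \<star> e = x"
    and T_unit [simp]: "T e e = 2"
    and composition: "x \<in> W \<Longrightarrow> y \<in> W \<Longrightarrow> T (x \<star> y) (x \<star> y) = T x x * T y y / 2"
    and T_nondegenerate: "x \<in> W \<Longrightarrow> (\<And>y. y \<in> W \<Longrightarrow> T x y = 0) \<Longrightarrow> x = 0"
begin

lemma T_add_right: "T z (x + y) = T z x + T z y"
  by (metis T_add_left T_commute)

lemma T_scale_right: "T z (k \<cdot> x) = k * T z x"
  by (metis T_scale_left T_commute)

lemma T_minus_left: "T (- x) z = - T x z"
  using T_scale_left[of "-1" x z] by simp

lemma T_minus_right: "T z (- x) = - T z x"
  by (metis T_minus_left T_commute)

lemma T_diff_left: "T (x - y) z = T x z - T y z"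
  using T_add_left[of x "- y"] by (simp add: T_minus_left)

lemma T_diff_right: "T z (x - y) = T z x - T z y"
  by (metis T_diff_left T_commute)

lemma T_zero [simp]: "T 0 z = 0" "T z 0 = 0"
  using T_scale_left[of 0 0 z] T_scale_right[of z 0 0] by simp_all

lemmas T_linear = T_add_left T_add_right T_scale_left T_scale_right
  T_minus_left T_minus_right T_diff_left T_diff_right

lemma m_minus: "(- x) \<star> z = - (x \<star> z)" "z \<star> (- x) = - (z \<star> x)"
  using m_scale_left[of "-1" x z] m_scale_right[of z "-1" x] by simp_all

lemma m_diff: "(x - y) \<star> z = x \<star> z - y \<star> z" "z \<star> (x - y) = z \<star> x - z \<star> y"
  using m_add_left[of x "- y" z] m_add_right[of z x "- y"] by (simp_all add: m_minus)

lemmas m_linear = m_add_left m_add_right m_scale_left m_scale_right m_minus m_diff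

lemma W_minus [simp]: "x \<in> W \<Longrightarrow> - x \<in> W"
  using W_scale[of x "-1"] by simp

lemma W_diff [simp]: "x \<in> W \<Longrightarrow> y \<in> W \<Longrightarrow> x - y \<in> W"
  using W_add[of x "- y"] by simp

lemma T_eqI:
  assumes "x \<in> W" "y \<in> W" "\<And>z. z \<in> W \<Longrightarrow> T x z = T y z"
  shows "x = y"
  using T_nondegenerate[of "x - y"] assms by (simp add: T_diff_left)

lemma composition_right:
  assumes "x \<in> W" "y \<in> W" "z \<in> W"
  shows "T (x \<star> y) (x \<star> z) = T x x * T y z / 2"
proof -
  have "2 * T (x \<star> y) (x \<star> z) = 2 * (T x x * T y z / 2)"
    using composition[of x "y + z"] composition[of x y] composition[of x z] assms
    by (simp add: m_linear T_linear T_commute[of z y] T_commute[of "x \<star> z" "x \<star> y"] field_simps)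
  then show ?thesis by (metis mult_cancel_left zero_neq_numeral)
qed

text \<open>The norm law linearized in both factors. Setting one argument to \<open>e\<close>
  produces the adjoints of left and right multiplication.\<close>

lemma composition_full:
  assumes "x \<in> W" "y \<in> W" "z \<in> W" "t \<in> W"
  shows "T (x \<star> y) (z \<star> t) + T (z \<star> y) (x \<star> t) = T x z * T y t"
proof -
  have "8 * (T (x \<star> y) (z \<star> t) + T (z \<star> y) (x \<star> t)) = 8 * (T x z * T y t)"
    using composition_right[of "x + z" y t] composition_right[of x y t] composition_right[of z y t] assms
    by (simp add: m_linear T_linear T_commute[of z x] field_simps)
  then show ?thesis by (metis mult_cancel_left zero_neq_numeral)
qed

definition conj :: "'v \<Rightarrow> 'v" where
  "conj x = T x e \<cdot> e - x"

lemma W_conj [simp]: "x \<in> W \<Longrightarrow> conj x \<in> W"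
  by (simp add: conj_def)

lemma conj_conj [simp]: "conj (conj x) = x"
  by (simp add: conj_def T_linear scale_left_distrib scale_left_diff_distrib algebra_simps)

lemma conj_orthogonal: "T x e = 0 \<Longrightarrow> conj x = - x"
  by (simp add: conj_def)

lemma T_conj: "T (conj x) y = T x (conj y)"
  by (simp add: conj_def T_linear T_commute[of e y])

lemma adjoint_left:
  assumes "x \<in> W" "y \<in> W" "z \<in> W"
  shows "T (x \<star> y) z = T y (conj x \<star> z)"
  using composition_full[of x y e z] assms by (simp add: conj_def m_linear T_linear algebra_simps)

lemma adjoint_right:
  assumes "x \<in> W" "y \<in> W" "z \<in> W"
  shows "T (x \<star> y) z = T x (z \<star> conj y)"
  using composition_full[of x y z e] assms
  by (simp add: conj_def m_linear T_linear T_commute[of "z \<star> y"] algebra_simps)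

lemma conj_mult:
  assumes "x \<in> W" "y \<in> W"
  shows "conj (x \<star> y) = conj y \<star> conj x"
proof (rule T_eqI)
  fix z assume z: "z \<in> W"
  have "T (conj (x \<star> y)) z = T y (conj x \<star> conj z)"
    using adjoint_left[of x y "conj z"] assms z by (simp add: T_conj)
  also have "\<dots> = T (y \<star> z) (conj x)"
    using adjoint_right[of y z "conj x"] assms z by simp
  also have "\<dots> = T (conj y \<star> conj x) z"
    using adjoint_left[of "conj y" "conj x" z] assms z by (simp add: T_commute)
  finally show "T (conj (x \<star> y)) z = T (conj y \<star> conj x) z" .
qed (use assms in auto)

text \<open>Linearized form of \<open>conj x \<star> (x \<star> y) = (T x x / 2) \<cdot> y\<close>;
  it is the substitute for associativity in what follows.\<close>

lemma conj_mult_mult: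
  assumes "x \<in> W" "z \<in> W" "y \<in> W"
  shows "conj x \<star> (z \<star> y) + conj z \<star> (x \<star> y) = T x z \<cdot> y"
proof (rule T_eqI)
  fix t assume t: "t \<in> W"
  then show "T (conj x \<star> (z \<star> y) + conj z \<star> (x \<star> y)) t = T (T x z \<cdot> y) t"
    using adjoint_left[of "conj x" "z \<star> y" t] adjoint_left[of "conj z" "x \<star> y" t]
      composition_full[of x y z t] assms
    by (simp add: T_linear add.commute)
qed (use assms in auto)

lemma mult_mult_conj:
  assumes "x \<in> W" "z \<in> W" "y \<in> W"
  shows "(y \<star> x) \<star> conj z + (y \<star> z) \<star> conj x = T x z \<cdot> y"
proof (rule T_eqI)
  fix t assume t: "t \<in> W"
  then show "T ((y \<star> x) \<star> conj z + (y \<star> z) \<star> conj x) t = T (T x z \<cdot> y) t"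
    using adjoint_right[of "y \<star> x" "conj z" t] adjoint_right[of "y \<star> z" "conj x" t]
      composition_full[of y x t z] assms
    by (simp add: T_linear T_commute[of "t \<star> x"] mult.commute)
qed (use assms in auto)

lemma scale_half_double: "(1/2) \<cdot> (x + x) = x"
  using scale_left_distrib[of "1/2" "1/2" x] by (simp add: scale_right_distrib)

lemma mult_conj:
  assumes "x \<in> W" "y \<in> W"
  shows "(y \<star> x) \<star> conj x = (T x x / 2) \<cdot> y"
  using scale_half_double[of "(y \<star> x) \<star> conj x"] mult_mult_conj[of x x y] assms by simp

lemma mult_self_orthogonal:
  assumes "x \<in> W" "y \<in> W" "T x e = 0"
  shows "(y \<star> x) \<star> x = (- (T x x / 2)) \<cdot> y"
proof -
  have "- ((y \<star> x) \<star> x) = (T x x / 2) \<cdot> y"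
    using mult_conj[of x y] assms by (simp add: conj_orthogonal m_linear)
  then show ?thesis by (metis add.inverse_inverse scale_minus_left)
qed

section \<open>Cayley-Dickson doubling\<close>

lemma mult_orthogonal_swap:
  assumes "x \<in> W" "a \<in> W" "T a e = 0" "T a x = 0"
  shows "x \<star> a = a \<star> conj x"
  using conj_mult_mult[of "conj x" a e] assms
  by (simp add: conj_orthogonal m_linear T_conj[of x] T_commute[of x a] T_linear)

text \<open>With the two rules after it, this is the Cayley-Dickson product: for \<open>a\<close>
  orthogonal to a subalgebra \<open>U\<close>, products in \<open>U + U \<star> a\<close> are
  expressed by products in \<open>U\<close>.\<close>

lemma doubling_left:
  assumes "x \<in> W" "y \<in> W" "a \<in> W" "T a e = 0" "T a x = 0" "T a y = 0" "T a (y \<star> x) = 0"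
  shows "x \<star> (y \<star> a) = (y \<star> x) \<star> a"
proof -
  have "T (conj x) a = 0"
    using assms by (simp add: T_conj T_commute[of x] conj_orthogonal T_linear)
  then have "x \<star> (a \<star> conj y) = a \<star> (conj x \<star> conj y)"
    using conj_mult_mult[of "conj x" a "conj y"] assms by (simp add: conj_orthogonal m_linear)
  then show ?thesis
    using mult_orthogonal_swap[of y a] mult_orthogonal_swap[of "y \<star> x" a] assms by (simp add: conj_mult)
qed

lemma doubling_right:
  assumes "y \<in> W" "z \<in> W" "a \<in> W" "T a e = 0" "T a y = 0"
  shows "(z \<star> a) \<star> y = (z \<star> conj y) \<star> a"
proof -
  have "T a (conj y) = 0"
    using assms by (simp add: conj_def T_linear)
  then show ?thesis
    using mult_mult_conj[of a "conj y" z] assms by (simp add: conj_orthogonal m_linear)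
qed

lemma doubling_both:
  assumes "x \<in> W" "y \<in> W" "a \<in> W" "T a e = 0" "T a x = 0" "T a y = 0" "T a (y \<star> x) = 0"
  shows "(x \<star> a) \<star> (y \<star> a) = (- (T a a / 2)) \<cdot> (conj y \<star> x)"
proof -
  have aa: "(z \<star> a) \<star> a = (- (T a a / 2)) \<cdot> z" if "z \<in> W" for z
    using mult_self_orthogonal assms that by blast
  have Ty: "T (y \<star> a) e = 0"
    using adjoint_left[of y a e] assms by (simp add: conj_def T_linear m_linear)
  have 1: "(x \<star> a) \<star> conj (y \<star> a) + (x \<star> (y \<star> a)) \<star> conj a = T a (y \<star> a) \<cdot> x"
    using mult_mult_conj[of a "y \<star> a" x] assms by simp
  have 2: "T a (y \<star> a) = T a a * T y e / 2"
    using composition_full[of e a y a] composition[of e a] assms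
    by (simp add: T_commute[of "y \<star> a" a] T_commute[of e y] field_simps)
  have "conj (y \<star> a) = - (y \<star> a)" "conj a = - a" using Ty assms by (simp_all add: conj_orthogonal)
  then have 3: "- ((x \<star> a) \<star> (y \<star> a)) - ((y \<star> x) \<star> a) \<star> a = (T a a * T y e / 2) \<cdot> x"
    using 1 2 doubling_left[of x y a] assms by (simp add: m_linear)
  have "(x \<star> a) \<star> (y \<star> a) = - (((y \<star> x) \<star> a) \<star> a) - (T a a * T y e / 2) \<cdot> x"
    by (simp add: 3[symmetric])
  also have "\<dots> = (- (T a a / 2)) \<cdot> (conj y \<star> x)"
    using aa[of "y \<star> x"] assms by (simp add: conj_def m_linear scale_right_diff_distrib algebra_simps)
  finally show ?thesis .
qed

text \<open>A doubling step \<open>U + U a\<close> inside \<open>W\<close> forces \<open>U\<close> to be associative.\<close>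

lemma doubling_associative:
  assumes W: "u \<in> W" "x \<in> W" "y \<in> W" "z \<in> W" "a \<in> W" and a: "T a e = 0" "T a a = 2"
    and 0: "T a x = 0" "T a y = 0" "T a z = 0" "T a u = 0"
      "T a (u \<star> y) = 0" "T a (u \<star> x) = 0" "T a (conj y \<star> x) = 0"
  shows "T (u \<star> (x \<star> z)) y = T ((u \<star> x) \<star> z) y"
proof -
  have 1: "T x (y \<star> a) = 0"
    using adjoint_left[of y a x] W 0 by (simp add: T_commute[of x])
  \<comment> \<open>The linearized composition law for \<open>x\<close>, \<open>z\<close>,
    \<open>y \<star> a\<close>, \<open>u \<star> a\<close> has right side zero, and the doubling
    rules turn both terms on the left into products inside \<open>U\<close>.\<close>
  have "T (x \<star> z) ((y \<star> a) \<star> (u \<star> a)) + T ((y \<star> a) \<star> z) (x \<star> (u \<star> a)) = 0"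
    using composition_full[of x z "y \<star> a" "u \<star> a"] W 1 by simp
  moreover have "(y \<star> a) \<star> (u \<star> a) = - (conj u \<star> y)"
    using doubling_both[of y u a] W a 0 by simp
  moreover have "(y \<star> a) \<star> z = (y \<star> conj z) \<star> a" "x \<star> (u \<star> a) = (u \<star> x) \<star> a"
    using doubling_right[of z y a] doubling_left[of x u a] W a 0 by simp_all
  moreover have "T ((y \<star> conj z) \<star> a) ((u \<star> x) \<star> a) = T (y \<star> conj z) (u \<star> x)"
    using composition_full[of "y \<star> conj z" a "u \<star> x" a] W a
    by (simp add: T_commute[of "(u \<star> x) \<star> a"])
  ultimately have "T (x \<star> z) (conj u \<star> y) = T (u \<star> x) (y \<star> conj z)"
    by (simp add: T_linear T_commute)
  then show ?thesis
    using adjoint_left[of u "x \<star> z" y] adjoint_right[of "u \<star> x" z y] W by simp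
qed

text \<open>The value 2 agrees with \<open>T_unit\<close>: these are vectors of norm 1 for the norm
  \<open>T x x / 2\<close>.\<close>

definition orthonormal :: "nat \<Rightarrow> (nat \<Rightarrow> 'v) \<Rightarrow> bool" where
  "orthonormal n w \<longleftrightarrow> (\<forall>p<n. w p \<in> W \<and> (\<forall>q<n. T (w p) (w q) = (if p = q then 2 else 0)))"

definition coordinates :: "nat \<Rightarrow> (nat \<Rightarrow> 'v) \<Rightarrow> 'v \<Rightarrow> nat \<Rightarrow> 'a" where
  "coordinates n w x p = (if p < n then T x (w p) / 2 else 0)"

definition orthonormal_basis :: "nat \<Rightarrow> (nat \<Rightarrow> 'v) \<Rightarrow> bool" where
  "orthonormal_basis n w \<longleftrightarrow> orthonormal n w \<and>
     (\<forall>x\<in>W. x = (\<Sum>p<n. coordinates n w x p \<cdot> w p))"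

lemma T_sum_left: "T (\<Sum>p\<in>S. g p) z = (\<Sum>p\<in>S. T (g p) z)"
  by (induction S rule: infinite_finite_induct) (simp_all add: T_add_left)

lemma W_sum:
  assumes "\<And>p. p \<in> S \<Longrightarrow> g p \<in> W"
  shows "(\<Sum>p\<in>S. g p) \<in> W"
proof -
  have "0 \<in> W" using W_scale[OF W_unit, of 0] by simp
  then show ?thesis using assms
    by (induction S rule: infinite_finite_induct) auto
qed

lemma orthonormal_sum:
  assumes "orthonormal n w" "q < n"
  shows "T (\<Sum>p<n. g p \<cdot> w p) (w q) = 2 * g q"
proof -
  have "T (\<Sum>p<n. g p \<cdot> w p) (w q) = (\<Sum>p<n. if p = q then 2 * g p else 0)"
    unfolding T_sum_left using assms by (intro sum.cong) (auto simp: orthonormal_def T_scale_left)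
  then show ?thesis using assms by simp
qed

lemma orthonormal_basis_bij:
  assumes "orthonormal_basis n w"
  shows "bij_betw (coordinates n w) W (coord_space n)"
proof (rule bij_betw_byWitness[where f' = "\<lambda>g. \<Sum>p<n. g p \<cdot> w p"])
  have on: "orthonormal n w" using assms by (simp add: orthonormal_basis_def)
  show "\<forall>x\<in>W. (\<Sum>p<n. coordinates n w x p \<cdot> w p) = x"
    using assms by (simp add: orthonormal_basis_def)
  show "\<forall>g\<in>coord_space n. coordinates n w (\<Sum>p<n. g p \<cdot> w p) = g"
    using orthonormal_sum[OF on] by (auto simp: fun_eq_iff coordinates_def coord_space_def)
  show "coordinates n w ` W \<subseteq> coord_space n" by (auto simp: coordinates_def coord_space_def)
  show "(\<lambda>g. \<Sum>p<n. g p \<cdot> w p) ` coord_space n \<subseteq> W"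
    using on by (auto intro!: W_sum simp: orthonormal_def)
qed

text \<open>If \<open>T x x\<close> vanished on the orthogonal complement, its polarization would
  vanish there too, and nondegeneracy would make the complement zero.\<close>

lemma orthonormal_extension:
  assumes on: "orthonormal n w" and not_basis: "\<not> orthonormal_basis n w"
  obtains a where "a \<in> W" "T a a = 2" "\<And>p. p < n \<Longrightarrow> T a (w p) = 0"
proof -
  define U where "U = {a \<in> W. \<forall>p<n. T a (w p) = 0}"
  define \<pi> where "\<pi> x = x - (\<Sum>p<n. coordinates n w x p \<cdot> w p)" for x
  have \<pi>: "\<pi> x \<in> U" if "x \<in> W" for x
    using on that orthonormal_sum[OF on] unfolding U_def \<pi>_def
    by (auto intro!: W_sum W_diff simp: orthonormal_def coordinates_def T_diff_left)
  have "\<exists>a\<in>U. T a a \<noteq> 0"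
  proof (rule ccontr)
    assume "\<not> ?thesis"
    then have 0: "T a a = 0" if "a \<in> U" for a using that by blast
    have 00: "T a b = 0" if "a \<in> U" "b \<in> U" for a b
    proof -
      have "a + b \<in> U" using that by (auto simp: U_def T_linear)
      then have "T (a + b) (a + b) = 0" by (rule 0)
      then have "2 * T a b = 0" using 0 that by (simp add: T_linear T_commute[of b a])
      then show ?thesis by simp
    qed
    have "a = 0" if a: "a \<in> U" for a
    proof (rule T_nondegenerate)
      show "a \<in> W" using a by (simp add: U_def)
      fix y assume y: "y \<in> W"
      have "T (\<Sum>p<n. coordinates n w y p \<cdot> w p) a = 0"
        unfolding T_sum_left using a by (auto simp: U_def T_scale_right T_commute[of _ a] intro!: sum.neutral)
      moreover have "T a (\<pi> y) = 0" using 00 a \<pi>[OF y] by blast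
      ultimately show "T a y = 0" by (simp add: \<pi>_def T_diff_right T_commute)
    qed
    then have "\<pi> x = 0" if "x \<in> W" for x using \<pi>[OF that] by blast
    then have "orthonormal_basis n w" using on by (auto simp: orthonormal_basis_def \<pi>_def)
    with not_basis show False by blast
  qed
  then obtain a where a: "a \<in> U" "T a a \<noteq> 0" by blast
  obtain k where k: "k\<^sup>2 = 2 / T a a" using nth_root_exists[of 2] by auto
  show ?thesis
  proof
    show "k \<cdot> a \<in> W" using a by (simp add: U_def)
    show "T (k \<cdot> a) (k \<cdot> a) = 2" using k a by (simp add: T_linear power2_eq_square flip: mult.assoc)
    show "T (k \<cdot> a) (w p) = 0" if "p < n" for p using a that by (simp add: U_def T_linear)
  qed
qed


section \<open>Quaternion and octonion subalgebras\<close>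

definition quat :: "'v \<Rightarrow> 'v \<Rightarrow> (nat \<Rightarrow> 'a) \<Rightarrow> 'v" where
  "quat i j g = g 0 \<cdot> e + g 1 \<cdot> i + g 2 \<cdot> j + g 3 \<cdot> (i \<star> j)"

definition quat_mult :: "(nat \<Rightarrow> 'a) \<Rightarrow> (nat \<Rightarrow> 'a) \<Rightarrow> nat \<Rightarrow> 'a" where
  "quat_mult c d = (\<lambda>_. 0)(0 := c 0 * d 0 - c 1 * d 1 - c 2 * d 2 - c 3 * d 3,
     1 := c 0 * d 1 + c 1 * d 0 + c 2 * d 3 - c 3 * d 2,
     2 := c 0 * d 2 - c 1 * d 3 + c 2 * d 0 + c 3 * d 1,
     3 := c 0 * d 3 + c 1 * d 2 - c 2 * d 1 + c 3 * d 0)"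

definition quat_conj :: "(nat \<Rightarrow> 'a) \<Rightarrow> nat \<Rightarrow> 'a" where
  "quat_conj c = (\<lambda>_. 0)(0 := c 0, 1 := - c 1, 2 := - c 2, 3 := - c 3)"

definition quat_form :: "(nat \<Rightarrow> 'a) \<Rightarrow> (nat \<Rightarrow> 'a) \<Rightarrow> 'a" where
  "quat_form c d = 2 * (c 0 * d 0 + c 1 * d 1 + c 2 * d 2 + c 3 * d 3)"

context
  fixes i j
  assumes W_ij [simp]: "i \<in> W" "j \<in> W"
    and T_ij [simp]: "T i e = 0" "T j e = 0" "T j i = 0" "T i i = 2" "T j j = 2"
begin

lemma T_ij' [simp]: "T e i = 0" "T e j = 0" "T i j = 0"
  by (simp_all add: T_commute[of e] T_commute[of i j])

lemma quat_T [simp]: "T (i \<star> j) e = 0" "T (i \<star> j) i = 0" "T (i \<star> j) j = 0" "T (i \<star> j) (i \<star> j) = 2"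
    "T e (i \<star> j) = 0" "T i (i \<star> j) = 0" "T j (i \<star> j) = 0"
proof -
  show "T (i \<star> j) e = 0"
    using adjoint_left[of i j e] by (simp add: conj_orthogonal m_linear T_linear)
  show "T (i \<star> j) i = 0"
    using composition_right[of i j e] by simp
  show "T (i \<star> j) j = 0"
    using composition_full[of i j e j] by (simp add: T_commute[of j "i \<star> j"])
  show "T (i \<star> j) (i \<star> j) = 2"
    using composition[of i j] by simp
  then show "T e (i \<star> j) = 0" "T i (i \<star> j) = 0" "T j (i \<star> j) = 0"
    using \<open>T (i \<star> j) e = 0\<close> \<open>T (i \<star> j) i = 0\<close> \<open>T (i \<star> j) j = 0\<close> by (metis T_commute)+
qed

lemma square_unit: "x \<in> W \<Longrightarrow> T x e = 0 \<Longrightarrow> T x x = 2 \<Longrightarrow> x \<star> x = - e"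
  using mult_self_orthogonal[of x e] by simp

lemma anticommute: "x \<in> W \<Longrightarrow> y \<in> W \<Longrightarrow> T x e = 0 \<Longrightarrow> T y e = 0 \<Longrightarrow> T y x = 0 \<Longrightarrow> y \<star> x = - (x \<star> y)"
  using mult_orthogonal_swap[of x y] by (simp add: conj_orthogonal m_linear)

lemma quat_table [simp]: "i \<star> i = - e" "j \<star> j = - e" "(i \<star> j) \<star> (i \<star> j) = - e" "j \<star> i = - (i \<star> j)"
  "i \<star> (i \<star> j) = - j" "(i \<star> j) \<star> i = j" "(i \<star> j) \<star> j = - i" "j \<star> (i \<star> j) = i"
proof -
  show "i \<star> i = - e" "j \<star> j = - e" "(i \<star> j) \<star> (i \<star> j) = - e"
    by (rule square_unit; simp)+
  show "j \<star> i = - (i \<star> j)" by (rule anticommute) simp_all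
  have "conj i \<star> (i \<star> j) = (1/2) \<cdot> (2 \<cdot> j)"
    using scale_half_double[of "conj i \<star> (i \<star> j)"] conj_mult_mult[of i i j] by simp
  then have 1: "- (i \<star> (i \<star> j)) = j" by (simp add: conj_orthogonal m_linear)
  then show 2: "i \<star> (i \<star> j) = - j" by (metis add.inverse_inverse)
  show 3: "(i \<star> j) \<star> j = - i"
    using mult_self_orthogonal[of j i] by simp
  show "(i \<star> j) \<star> i = j" using anticommute[of i "i \<star> j"] 2 by simp
  show "j \<star> (i \<star> j) = i" using anticommute[of "i \<star> j" j] 3 by simp
qed

lemma W_quat [simp]: "quat i j g \<in> W"
  by (simp add: quat_def)

lemma quat_mult: "quat i j c \<star> quat i j d = quat i j (quat_mult c d)"
  by (rule T_eqI) (simp_all add: quat_def quat_mult_def m_linear T_linear algebra_simps)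

lemma quat_conj: "conj (quat i j c) = quat i j (quat_conj c)"
  by (rule T_eqI) (simp_all add: quat_def quat_conj_def conj_def T_linear algebra_simps)

lemma quat_form: "T (quat i j c) (quat i j d) = quat_form c d"
  by (simp add: quat_def quat_form_def T_linear algebra_simps)

context
  fixes l
  assumes W_l [simp]: "l \<in> W"
    and T_l: "T l e = 0" "T l i = 0" "T l j = 0" "T l (i \<star> j) = 0" "T l l = 2"
begin

lemma T_l_quat [simp]: "T l (quat i j c) = 0"
  by (simp add: quat_def T_linear T_l)

lemma T_quat_l: "T (quat i j c) (quat i j d \<star> l) = 0"
proof -
  have "T (quat i j d \<star> l) (quat i j c) = 0"
    using adjoint_left[of "quat i j d" l "quat i j c"] by (simp add: quat_conj quat_mult)
  then show ?thesis by (simp add: T_commute)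
qed

lemma T_l_l: "T (quat i j c \<star> l) (quat i j d \<star> l) = quat_form c d"
  using composition_full[of "quat i j c" l "quat i j d" l]
  by (simp add: T_commute[of "quat i j d \<star> l"] T_l quat_form)

lemma oct_mult:
  "quat i j x \<star> (quat i j u \<star> l) = quat i j (quat_mult u x) \<star> l"
  "(quat i j y \<star> l) \<star> quat i j z = quat i j (quat_mult y (quat_conj z)) \<star> l"
  "(quat i j y \<star> l) \<star> (quat i j u \<star> l) = - quat i j (quat_mult (quat_conj u) y)"
  by (simp_all add: doubling_left doubling_right doubling_both quat_mult quat_conj T_l)

lemma oct_trilinear:
  "T ((quat i j x + quat i j y \<star> l) \<star> (quat i j z + quat i j u \<star> l)) (quat i j r + quat i j v \<star> l) =
    quat_form (quat_mult x z) r - quat_form (quat_mult (quat_conj u) y) r +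
    quat_form (quat_mult u x) v + quat_form (quat_mult y (quat_conj z)) v"
  by (simp add: m_linear T_linear quat_mult oct_mult quat_form T_quat_l T_l_l
      T_commute[of "quat i j x \<star> l" "quat i j y" for x y])

text \<open>A further unit vector would make the octonions associative by
  \<open>doubling_associative\<close>, but
  \<open>i \<star> (j \<star> l) = - ((i \<star> j) \<star> l)\<close>: tested against
  \<open>(i \<star> j) \<star> l\<close>, the two bracketings give -2 and 2.\<close>

lemma no_sedenions:
  assumes W_a [simp]: "a \<in> W" and T_a: "\<And>c. T a (quat i j c) = 0" "\<And>c. T a (quat i j c \<star> l) = 0" "T a a = 2"
  shows False
proof -
  define E where "E p = (\<lambda>q. if q = p then 1 else 0 :: 'a)" for p :: nat
  have E: "e = quat i j (E 0)" "i = quat i j (E 1)" "j = quat i j (E 2)" "i \<star> j = quat i j (E 3)"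
    by (simp_all add: quat_def E_def)
  have l: "l = quat i j (E 0) \<star> l" using E(1) by simp
  let ?x = "quat i j (E 2)" and ?u = "quat i j (E 1)" and ?z = "quat i j (E 0) \<star> l" and ?y = "quat i j (E 3) \<star> l"
  have "T (?u \<star> (?x \<star> ?z)) ?y = T ((?u \<star> ?x) \<star> ?z) ?y"
  proof (rule doubling_associative[where a = a])
    show "T a e = 0" using T_a(1)[of "E 0"] E by simp
    have "conj ?y = - ?y"
      using T_quat_l[of "E 0" "E 3"] E by (intro conj_orthogonal) (simp add: T_commute)
    then show "T a (conj ?y \<star> ?x) = 0" by (simp add: m_linear oct_mult T_a T_linear)
  qed (simp_all add: T_a quat_mult oct_mult)
  then show False
    by (simp add: quat_mult oct_mult T_l_l) (simp add: quat_form_def quat_mult_def E_def)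
qed

end

end

end


section \<open>Split coordinates\<close>

text \<open>A \<open>2 \<times> 2\<close> matrix is stored by its entries \<open>0, 1, 2, 3\<close> read along the rows.\<close>

definition mat2_mult :: "(nat \<Rightarrow> 'a::comm_ring_1) \<Rightarrow> (nat \<Rightarrow> 'a) \<Rightarrow> nat \<Rightarrow> 'a" where
  "mat2_mult g h = (\<lambda>_. 0)(0 := g 0 * h 0 + g 1 * h 2, 1 := g 0 * h 1 + g 1 * h 3,
     2 := g 2 * h 0 + g 3 * h 2, 3 := g 2 * h 1 + g 3 * h 3)"

definition mat2_adj :: "(nat \<Rightarrow> 'a::comm_ring_1) \<Rightarrow> nat \<Rightarrow> 'a" where
  "mat2_adj g = (\<lambda>_. 0)(0 := g 3, 1 := - g 1, 2 := - g 2, 3 := g 0)"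

text \<open>The polarization of the determinant.\<close>

definition mat2_form :: "(nat \<Rightarrow> 'a::comm_ring_1) \<Rightarrow> (nat \<Rightarrow> 'a) \<Rightarrow> 'a" where
  "mat2_form g h = g 0 * h 3 + g 3 * h 0 - g 1 * h 2 - g 2 * h 1"

definition split_norm :: "nat \<Rightarrow> (nat \<Rightarrow> 'a::comm_ring_1) \<Rightarrow> 'a" where
  "split_norm n g =
    (if n = 1 then (g 0)\<^sup>2
     else if n = 2 then g 0 * g 1
     else if n = 4 then g 0 * g 3 - g 1 * g 2
     else g 0 * g 3 - g 1 * g 2 + (g 4 * g 7 - g 5 * g 6))"

text \<open>Represents \<open>T (x \<star> y) z\<close>. For \<open>n = 8\<close> it is the right
  side of \<open>oct_trilinear\<close> with quaternions replaced by 2 by 2 matrices and conjugation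
  by the adjugate.\<close>

definition split_trilinear ::
    "nat \<Rightarrow> (nat \<Rightarrow> 'a::comm_ring_1) \<Rightarrow> (nat \<Rightarrow> 'a) \<Rightarrow> (nat \<Rightarrow> 'a) \<Rightarrow> 'a" where
  "split_trilinear n g h k =
    (if n = 1 then 2 * g 0 * h 0 * k 0
     else if n = 2 then g 0 * h 0 * k 1 + g 1 * h 1 * k 0
     else if n = 4 then mat2_form (mat2_mult g h) k
     else let g' = \<lambda>p. g (p + 4); h' = \<lambda>p. h (p + 4); k' = \<lambda>p. k (p + 4) in
       mat2_form (mat2_mult g h) k - mat2_form (mat2_mult (mat2_adj h') g') k +
       mat2_form (mat2_mult h' g) k' + mat2_form (mat2_mult g' (mat2_adj h)) k')"

lemma coord_space_eqI:
  "g \<in> coord_space n \<Longrightarrow> h \<in> coord_space n \<Longrightarrow> (\<And>p. p < n \<Longrightarrow> g p = h p) \<Longrightarrow> g = h"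
  by (auto simp: coord_space_def fun_eq_iff) (metis not_less)

definition split2 :: "'a::field \<Rightarrow> (nat \<Rightarrow> 'a) \<Rightarrow> nat \<Rightarrow> 'a" where
  "split2 \<iota> c = (\<lambda>_. 0)(0 := c 0 + \<iota> * c 1, 1 := c 0 - \<iota> * c 1)"

text \<open>The isomorphism of the quaternions with 2 by 2 matrices that sends \<open>i\<close> to
  \<open>diag(\<iota>, - \<iota>)\<close> and \<open>j\<close> to the matrix with rows
  \<open>0, 1\<close> and \<open>-1, 0\<close>.\<close>

definition split4 :: "'a::field \<Rightarrow> (nat \<Rightarrow> 'a) \<Rightarrow> nat \<Rightarrow> 'a" where
  "split4 \<iota> c = (\<lambda>_. 0)(0 := c 0 + \<iota> * c 1, 1 := c 2 + \<iota> * c 3, 2 := \<iota> * c 3 - c 2, 3 := c 0 - \<iota> * c 1)"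

definition split8 :: "'a::field \<Rightarrow> (nat \<Rightarrow> 'a) \<Rightarrow> nat \<Rightarrow> 'a" where
  "split8 \<iota> c = (\<lambda>p. if p < 4 then split4 \<iota> c p else split4 \<iota> (\<lambda>q. c (q + 4)) (p - 4))"

definition split4_inv :: "'a::field \<Rightarrow> (nat \<Rightarrow> 'a) \<Rightarrow> nat \<Rightarrow> 'a" where
  "split4_inv \<iota> g = (\<lambda>_. 0)(0 := (g 0 + g 3) / 2, 1 := - \<iota> * (g 0 - g 3) / 2,
     2 := (g 1 - g 2) / 2, 3 := - \<iota> * (g 1 + g 2) / 2)"

context
  fixes \<iota> :: "'a::field_char_0"
  assumes \<iota>: "\<iota>\<^sup>2 = - 1"
begin

lemma \<iota>_nonzero: "\<iota> \<noteq> 0"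
  using \<iota> by auto

lemma \<iota>_square: "\<iota> * \<iota> = - 1" "\<iota> * (\<iota> * x) = - x"
  using \<iota> by (simp_all add: power2_eq_square flip: mult.assoc)

lemma split2_bij: "bij_betw (split2 \<iota>) (coord_space 2) (coord_space 2)"
  by (rule bij_betw_byWitness[where
        f' = "\<lambda>g. (\<lambda>_. 0)(0 := (g 0 + g 1) / 2, 1 := - \<iota> * (g 0 - g 1) / 2)"])
     (auto simp: split2_def coord_space_def fun_eq_iff numeral_eq_Suc le_Suc_eq not_le \<iota>_square field_simps less_Suc_eq)

lemma split4_inverse: "p < 4 \<Longrightarrow> split4 \<iota> (split4_inv \<iota> g) p = g p"
  by (auto simp: split4_def split4_inv_def numeral_eq_Suc less_Suc_eq \<iota>_square field_simps)

lemma split4_inj: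
  assumes "\<And>p. p < 4 \<Longrightarrow> split4 \<iota> c p = split4 \<iota> d p" and "p < 4"
  shows "c p = d p"
proof -
  have *: "x = u \<and> y = v" if "x + \<iota> * y = u + \<iota> * v" "x - \<iota> * y = u - \<iota> * v" for x y u v
  proof -
    have "2 * x = 2 * u" "2 * \<iota> * y = 2 * \<iota> * v" using that by algebra+
    then show ?thesis using \<iota>_nonzero by simp
  qed
  have "c 0 = d 0 \<and> c 1 = d 1"
    using assms(1)[of 0] assms(1)[of 3] by (intro *) (simp_all add: split4_def)
  moreover have "\<iota> * c 3 - c 2 = \<iota> * d 3 - d 2"
    using assms(1)[of 2] by (simp add: split4_def)
  then have "c 2 - \<iota> * c 3 = d 2 - \<iota> * d 3" by algebra
  then have "c 2 = d 2 \<and> c 3 = d 3"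
    using assms(1)[of 1] by (intro *) (simp_all add: split4_def)
  ultimately show ?thesis
    using assms(2) by (auto simp: numeral_eq_Suc less_Suc_eq)
qed

lemma split4_bij: "bij_betw (split4 \<iota>) (coord_space 4) (coord_space 4)"
  unfolding bij_betw_def
proof
  show "inj_on (split4 \<iota>) (coord_space 4)"
    by (rule inj_onI, rule coord_space_eqI[of _ 4]) (auto intro: split4_inj)
  have "g \<in> split4 \<iota> ` coord_space 4" if "g \<in> coord_space 4" for g
  proof (rule image_eqI)
    show "g = split4 \<iota> (split4_inv \<iota> g)"
      using that by (rule coord_space_eqI) (auto simp: split4_inverse, simp add: coord_space_def split4_def)
    show "split4_inv \<iota> g \<in> coord_space 4" by (simp add: coord_space_def split4_inv_def)
  qed
  then show "split4 \<iota> ` coord_space 4 = coord_space 4"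
    by (auto simp: coord_space_def split4_def)
qed

lemma split8_bij: "bij_betw (split8 \<iota>) (coord_space 8) (coord_space 8)"
  unfolding bij_betw_def
proof
  have split8_mem: "split8 \<iota> c \<in> coord_space 8" for c
    by (auto simp: coord_space_def split8_def split4_def)
  show "inj_on (split8 \<iota>) (coord_space 8)"
  proof (rule inj_onI, rule coord_space_eqI[of _ 8])
    fix c d p assume eq: "split8 \<iota> c = split8 \<iota> d" and p: "p < (8::nat)"
    have 1: "split4 \<iota> c q = split4 \<iota> d q" if "q < 4" for q
      using fun_cong[OF eq, of q] that by (simp add: split8_def)
    have 2: "split4 \<iota> (\<lambda>q. c (q + 4)) q = split4 \<iota> (\<lambda>q. d (q + 4)) q" if "q < 4" for q
      using fun_cong[OF eq, of "q + 4"] by (simp add: split8_def)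
    show "c p = d p"
    proof (cases "p < 4")
      case False
      then have "p - 4 < 4" using p by simp
      from split4_inj[OF 2 this] False show ?thesis by simp
    qed (use split4_inj[OF 1] in auto)
  qed auto
  have "g \<in> split8 \<iota> ` coord_space 8" if g: "g \<in> coord_space 8" for g
  proof -
    define c where "c p = (if p < 4 then split4_inv \<iota> g p else split4_inv \<iota> (\<lambda>q. g (q + 4)) (p - 4))" for p
    have "split8 \<iota> c = g"
    proof (rule coord_space_eqI[OF split8_mem g])
      fix p :: nat assume p: "p < 8"
      have 1: "split4 \<iota> c = split4 \<iota> (split4_inv \<iota> g)" by (simp add: split4_def c_def)
      have 2: "(\<lambda>q. c (q + 4)) = split4_inv \<iota> (\<lambda>q. g (q + 4))" by (simp add: c_def)
      show "split8 \<iota> c p = g p"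
      proof (cases "p < 4")
        case True
        then show ?thesis unfolding split8_def 1 by (simp add: split4_inverse)
      next
        case False
        then have "p - 4 < 4" using p by simp
        then show ?thesis using False unfolding split8_def 2 by (simp add: split4_inverse)
      qed
    qed
    moreover have "c \<in> coord_space 8" by (auto simp: c_def split4_inv_def coord_space_def)
    ultimately show ?thesis by blast
  qed
  then show "split8 \<iota> ` coord_space 8 = coord_space 8"
    using split8_mem by auto
qed

end

context composition_algebra
begin

lemma coordinates_linear:
  "coordinates n w (x + y) = coordinates n w x + coordinates n w y"
  "coordinates n w (k \<cdot> x) = fun_scale k (coordinates n w x)"
  by (auto simp: fun_eq_iff coordinates_def fun_scale_def T_linear field_simps)

lemma split_linear:
  "split2 \<iota> (c + d) = split2 \<iota> c + split2 \<iota> d" "split2 \<iota> (fun_scale k c) = fun_scale k (split2 \<iota> c)"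
  "split4 \<iota> (c + d) = split4 \<iota> c + split4 \<iota> d" "split4 \<iota> (fun_scale k c) = fun_scale k (split4 \<iota> c)"
  "split8 \<iota> (c + d) = split8 \<iota> c + split8 \<iota> d" "split8 \<iota> (fun_scale k c) = fun_scale k (split8 \<iota> c)"
  by (auto simp: fun_eq_iff split2_def split4_def split8_def fun_scale_def algebra_simps)

lemma split4_quat:
  fixes \<iota> :: 'a
  assumes "\<iota>\<^sup>2 = - 1"
  shows "mat2_mult (split4 \<iota> c) (split4 \<iota> d) = split4 \<iota> (quat_mult c d)"
    and "mat2_adj (split4 \<iota> c) = split4 \<iota> (quat_conj c)"
    and "mat2_form (split4 \<iota> c) (split4 \<iota> d) = quat_form c d"
  by (simp_all add: \<iota>_square[OF assms] fun_eq_iff mat2_mult_def mat2_adj_def mat2_form_def quat_mult_def quat_conj_def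
      quat_form_def split4_def algebra_simps)

text \<open>At sizes 1, 2, 4 and 8 the orthonormal system either spans \<open>W\<close> or leaves
  room for a further unit vector, from which the next system is built; after 8 that vector
  contradicts \<open>no_sedenions\<close>.\<close>

theorem split_coordinates:
  obtains n \<kappa> where "n \<in> {1, 2, 4, 8}"
    "\<And>x y. \<kappa> (x + y) = \<kappa> x + \<kappa> y" "\<And>k x. \<kappa> (k \<cdot> x) = fun_scale k (\<kappa> x)"
    "bij_betw \<kappa> W (coord_space n)"
    "\<And>x. x \<in> W \<Longrightarrow> T x x = 2 * split_norm n (\<kappa> x)"
    "\<And>x y z. x \<in> W \<Longrightarrow> y \<in> W \<Longrightarrow> z \<in> W \<Longrightarrow> T (x \<star> y) z = split_trilinear n (\<kappa> x) (\<kappa> y) (\<kappa> z)"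
proof -
  obtain \<iota> :: 'a where \<iota>: "\<iota>\<^sup>2 = - 1" using nth_root_exists[of 2 "-1"] by auto
  note \<iota>2 = \<iota>_square[OF \<iota>]
  define w1 where "w1 = (\<lambda>p::nat. e)"
  have on1: "orthonormal 1 w1" by (simp add: orthonormal_def w1_def)
  show thesis
  proof (cases "orthonormal_basis 1 w1")
    case True
    have x: "x = (T x e / 2) \<cdot> e" if "x \<in> W" for x
    proof -
      have "x = (\<Sum>p<1. coordinates 1 w1 x p \<cdot> w1 p)" using True that unfolding orthonormal_basis_def by blast
      also have "\<dots> = (T x e / 2) \<cdot> e" by (simp add: coordinates_def w1_def)
      finally show ?thesis .
    qed
    show thesis
    proof (rule that[of 1 "coordinates 1 w1"])
      show "T x x = 2 * split_norm 1 (coordinates 1 w1 x)" if "x \<in> W" for x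
      proof -
        note x = x[OF that]
        then obtain k where k: "x = k \<cdot> e" by blast
        show ?thesis unfolding k by (simp add: T_linear split_norm_def coordinates_def w1_def power2_eq_square)
      qed
      show "T (x \<star> y) z = split_trilinear 1 (coordinates 1 w1 x) (coordinates 1 w1 y) (coordinates 1 w1 z)"
        if "x \<in> W" "y \<in> W" "z \<in> W" for x y z
      proof -
        note x[OF that(1)] x[OF that(2)] x[OF that(3)]
        then obtain k k' k'' where k: "x = k \<cdot> e" "y = k' \<cdot> e" "z = k'' \<cdot> e" by blast
        show ?thesis unfolding k by (simp add: T_linear m_linear split_trilinear_def coordinates_def w1_def)
      qed
    qed (use orthonormal_basis_bij[OF True] in \<open>simp_all add: coordinates_linear\<close>)
  next
    case False
    then obtain i where i: "i \<in> W" "T i i = 2" and "\<And>p. p < 1 \<Longrightarrow> T i (w1 p) = 0"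
      using orthonormal_extension[OF on1] by blast
    then have Tie: "T i e = 0" by (simp add: w1_def)
    note i = i Tie
    define w2 where "w2 = (\<lambda>p::nat. if p = 0 then e else i)"
    have Tei: "T e i = 0" using Tie by (metis T_commute)
    have ii: "i \<star> i = - e" using mult_self_orthogonal[of i e] i by simp
    have on2: "orthonormal 2 w2" using i Tei by (auto simp: orthonormal_def w2_def less_2_cases_iff)
    show thesis
    proof (cases "orthonormal_basis 2 w2")
      case True
      have x: "x = coordinates 2 w2 x 0 \<cdot> e + coordinates 2 w2 x 1 \<cdot> i" if "x \<in> W" for x
      proof -
        have "x = (\<Sum>p<2. coordinates 2 w2 x p \<cdot> w2 p)"
          using True that unfolding orthonormal_basis_def by blast
        also have "\<dots> = coordinates 2 w2 x 0 \<cdot> e + coordinates 2 w2 x 1 \<cdot> i"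
          by (simp add: w2_def numeral_2_eq_2 lessThan_Suc add.commute)
        finally show ?thesis .
      qed
      let ?k = "\<lambda>x. split2 \<iota> (coordinates 2 w2 x)"
      show thesis
      proof (rule that[of 2 ?k])
        show "bij_betw ?k W (coord_space 2)"
          using bij_betw_trans[OF orthonormal_basis_bij[OF True] split2_bij[OF \<iota>]] by (simp add: o_def)
        show "T x x = 2 * split_norm 2 (?k x)" if "x \<in> W" for x
          by (subst (1 2) x[OF that])
             (simp add: T_linear i Tei split_norm_def split2_def \<iota>2 algebra_simps)
        show "T (x \<star> y) z = split_trilinear 2 (?k x) (?k y) (?k z)" if "x \<in> W" "y \<in> W" "z \<in> W" for x y z
          by (subst x[OF that(1)], subst x[OF that(2)], subst x[OF that(3)])
             (simp add: T_linear m_linear i Tei ii split_trilinear_def split2_def \<iota>2 algebra_simps)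
      qed (simp_all add: coordinates_linear split_linear)
    next
      case False
      then obtain j where j: "j \<in> W" "T j j = 2" "\<And>p. p < 2 \<Longrightarrow> T j (w2 p) = 0"
        using orthonormal_extension[OF on2] by blast
      have j': "T j e = 0" "T j i = 0" using j(3)[of 0] j(3)[of 1] by (simp_all add: w2_def)
      note ij = i(1) j(1) i(3) j'(1,2) i(2) j(2)
      define E where "E p = (\<lambda>q. if q = p then 1 else 0 :: 'a)" for p :: nat
      have E_form: "quat_form (E p) (E q) = (if p = q then 2 else 0)" if "p < 4" "q < 4" for p q
        using that by (auto simp: quat_form_def E_def numeral_eq_Suc less_Suc_eq)
      define w4 where "w4 p = quat i j (E p)" for p
      have on4: "orthonormal 4 w4"
        by (simp add: orthonormal_def w4_def quat_form[OF ij] W_quat[OF ij] E_form)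
      have sum4: "(\<Sum>p<4. c p \<cdot> quat i j (E p)) = quat i j c" for c
        by (simp add: quat_def E_def eval_nat_numeral lessThan_Suc add_ac)
      show thesis
      proof (cases "orthonormal_basis 4 w4")
        case True
        have x: "x = quat i j (coordinates 4 w4 x)" if "x \<in> W" for x
          using True that unfolding orthonormal_basis_def w4_def sum4 by blast
        let ?k = "\<lambda>x. split4 \<iota> (coordinates 4 w4 x)"
        show thesis
        proof (rule that[of 4 ?k])
          show "bij_betw ?k W (coord_space 4)"
            using bij_betw_trans[OF orthonormal_basis_bij[OF True] split4_bij[OF \<iota>]] by (simp add: o_def)
          show "T x x = 2 * split_norm 4 (?k x)" if "x \<in> W" for x
            by (subst (1 2) x[OF that])
               (simp add: quat_form[OF ij] quat_form_def split_norm_def split4_def \<iota>2 algebra_simps)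
          show "T (x \<star> y) z = split_trilinear 4 (?k x) (?k y) (?k z)" if "x \<in> W" "y \<in> W" "z \<in> W" for x y z
            by (subst x[OF that(1)], subst x[OF that(2)], subst x[OF that(3)])
               (simp add: quat_mult[OF ij] quat_form[OF ij] split_trilinear_def split4_quat[OF \<iota>])
        qed (simp_all add: coordinates_linear split_linear)
      next
        case False
        then obtain l where l: "l \<in> W" "T l l = 2" "\<And>p. p < 4 \<Longrightarrow> T l (w4 p) = 0"
          using orthonormal_extension[OF on4] by blast
        have l': "T l e = 0" "T l i = 0" "T l j = 0" "T l (i \<star> j) = 0"
          using l(3)[of 0] l(3)[of 1] l(3)[of 2] l(3)[of 3] by (simp_all add: w4_def quat_def E_def)
        note ijl = ij l(1) l' l(2)
        define w8 where "w8 p = (if p < 4 then quat i j (E p) else quat i j (E (p - 4)) \<star> l)" for p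
        have on8: "orthonormal 8 w8"
          unfolding orthonormal_def
        proof (intro allI impI conjI)
          fix p q :: nat assume p: "p < 8" and q: "q < 8"
          show "w8 p \<in> W" using W_mult[OF W_quat[OF ij] l(1)] W_quat[OF ij] unfolding w8_def by (cases "p < 4") simp_all
          show "T (w8 p) (w8 q) = (if p = q then 2 else 0)"
            using p q by (auto simp: w8_def quat_form[OF ij] E_form T_quat_l[OF ijl] T_l_l[OF ijl]
                T_commute[of "quat i j c \<star> l" "quat i j d" for c d])
        qed
        have sum8: "(\<Sum>p<8. c p \<cdot> w8 p) = quat i j c + quat i j (\<lambda>q. c (q + 4)) \<star> l" for c
          by (simp add: quat_def E_def w8_def eval_nat_numeral lessThan_Suc m_linear add_ac)
        show thesis
        proof (cases "orthonormal_basis 8 w8")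
          case True
          have x: "x = quat i j (coordinates 8 w8 x) + quat i j (\<lambda>q. coordinates 8 w8 x (q + 4)) \<star> l"
            if "x \<in> W" for x
            using True that unfolding orthonormal_basis_def sum8 by blast
          let ?k = "\<lambda>x. split8 \<iota> (coordinates 8 w8 x)"
          have high: "(\<lambda>p. split8 \<iota> c (p + 4)) = split4 \<iota> (\<lambda>q. c (q + 4))" for c
            by (simp add: split8_def)
          have low: "mat2_mult (split8 \<iota> c) g = mat2_mult (split4 \<iota> c) g"
            "mat2_mult g (split8 \<iota> c) = mat2_mult g (split4 \<iota> c)"
            "mat2_adj (split8 \<iota> c) = mat2_adj (split4 \<iota> c)"
            "mat2_form g (split8 \<iota> c) = mat2_form g (split4 \<iota> c)" for g c
            by (simp_all add: mat2_mult_def mat2_adj_def mat2_form_def split8_def)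
          show thesis
          proof (rule that[of 8 ?k])
            show "bij_betw ?k W (coord_space 8)"
              using bij_betw_trans[OF orthonormal_basis_bij[OF True] split8_bij[OF \<iota>]] by (simp add: o_def)
            show "T x x = 2 * split_norm 8 (?k x)" if "x \<in> W" for x
              by (subst (1 2) x[OF that])
                 (simp add: T_linear quat_form[OF ij] T_quat_l[OF ijl] T_l_l[OF ijl]
                   T_commute[of "quat i j c \<star> l" "quat i j d" for c d]
                   quat_form_def split_norm_def split8_def split4_def \<iota>2 algebra_simps)
            show "T (x \<star> y) z = split_trilinear 8 (?k x) (?k y) (?k z)" if "x \<in> W" "y \<in> W" "z \<in> W" for x y z
              by (subst x[OF that(1)], subst x[OF that(2)], subst x[OF that(3)])
                 (simp add: oct_trilinear[OF ijl] split_trilinear_def high low split4_quat[OF \<iota>])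
          qed (simp_all add: coordinates_linear split_linear)
        next
          case False
          then obtain a where a: "a \<in> W" "T a a = 2" "\<And>p. p < 8 \<Longrightarrow> T a (w8 p) = 0"
            using orthonormal_extension[OF on8] by blast
          have 1: "T a (quat i j (E p)) = 0" "T a (quat i j (E p) \<star> l) = 0" if "p < 4" for p
            using a(3)[of p] a(3)[of "p + 4"] that by (simp_all add: w8_def)
          have 2: "T a (\<Sum>p<4. c p \<cdot> quat i j (E p)) = 0" "T a ((\<Sum>p<4. c p \<cdot> quat i j (E p)) \<star> l) = 0" for c
            using 1 by (simp_all add: eval_nat_numeral lessThan_Suc T_linear m_linear)
          have False
            by (rule no_sedenions[OF ijl a(1)]) (use 2[unfolded sum4] a(2) in auto)
          then show thesis ..
        qed
      qed
    qed
  qed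
qed

end


section \<open>Coordinates on a cubic norm structure\<close>

lemma vector_space_fun_scale: "vector_space (fun_scale :: 'a::field \<Rightarrow> ('i \<Rightarrow> 'a) \<Rightarrow> _)"
  by unfold_locales (auto simp: fun_scale_def fun_eq_iff algebra_simps)

lemma form_on_zero: "form_on s W d (\<lambda>_. 0)"
proof (induction d)
  case (Suc d)
  have "form_on s W (1 + d) (\<lambda>x. 0 * 0)"
    by (intro form_on.mult form_on.linear Suc) (simp add: linear_functional_on_def)
  then show ?case by simp
qed (rule form_on.const)

lemma form_on_sum:
  "(\<And>b. b \<in> S \<Longrightarrow> form_on s W d (p b)) \<Longrightarrow> form_on s W d (\<lambda>x. \<Sum>b\<in>S. p b x)"
  by (induction S rule: infinite_finite_induct) (auto intro: form_on_zero form_on.add)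

context finite_dimensional_vector_space
begin

lemma quadratic_form_on_bilinear:
  assumes "\<And>x y z. b (x + y) z = b x z + b y z" "\<And>k x z. b (scale k x) z = k * b x z"
    and "\<And>x y z. b z (x + y) = b z x + b z y" "\<And>k x z. b z (scale k x) = k * b z x"
  shows "quadratic_form_on scale UNIV (\<lambda>x. b x x)"
proof -
  have x: "(\<Sum>w\<in>Basis. scale (representation Basis x w) w) = x" for x
    by (rule sum_representation_eq) (auto simp: independent_Basis span_Basis finite_Basis)
  have b0: "b z 0 = 0" for z using assms(4)[of z 0 0] by simp
  have bsum: "b z (\<Sum>w\<in>S. scale (c w) w) = (\<Sum>w\<in>S. c w * b z w)" for z c S
    by (induction S rule: infinite_finite_induct) (simp_all add: b0 assms)
  have "form_on scale UNIV (1 + 1) (\<lambda>x. \<Sum>w\<in>Basis. representation Basis x w * b x w)"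
    by (intro form_on_sum form_on.mult form_on.linear)
       (auto simp: linear_functional_on_def assms representation_add representation_scale independent_Basis span_Basis)
  moreover have "(\<Sum>w\<in>Basis. representation Basis x w * b x w) = b x x" for x
    using bsum[of x "representation Basis x" Basis] x[of x] by simp
  ultimately show ?thesis by (simp add: numeral_2_eq_2)
qed

lemma subspace_coordinates:
  assumes "subspace W"
  obtains n w \<phi> where "\<And>g. (\<Sum>p<n. scale (g p) (w p)) \<in> W"
    "\<And>g. g \<in> coord_space n \<Longrightarrow> \<phi> (\<Sum>p<n. scale (g p) (w p)) = g"
    "\<And>x. x \<in> W \<Longrightarrow> \<phi> x \<in> coord_space n" "\<And>x. x \<in> W \<Longrightarrow> (\<Sum>p<n. scale (\<phi> x p) (w p)) = x"
proof -
  obtain C where C: "C \<subseteq> W" "independent C" "W \<subseteq> span C"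
    using maximal_independent_subset[of W] by blast
  then have fin: "finite C" using finiteI_independent by blast
  then obtain w where w: "bij_betw w {..<card C} C"
    using ex_bij_betw_nat_finite[of C] by (auto simp: atLeast0LessThan)
  then have wC: "w p \<in> C" if "p < card C" for p using that by (auto simp: bij_betw_def)
  let ?n = "card C"
  define \<phi> where "\<phi> x p = (if p < ?n then representation C x (w p) else 0)" for x p
  have sum: "(\<Sum>p<?n. scale (g p) (w p)) = (\<Sum>v\<in>C. scale (g (the_inv_into {..<?n} w v)) v)" for g
  proof -
    have "(\<Sum>p<?n. scale (g p) (w p)) = (\<Sum>p<?n. scale (g (the_inv_into {..<?n} w (w p))) (w p))"
      using w by (intro sum.cong) (auto simp: the_inv_into_f_f bij_betw_def)
    then show ?thesis by (simp add: sum.reindex_bij_betw[OF w, of "\<lambda>v. scale (g (the_inv_into {..<?n} w v)) v"])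
  qed
  show thesis
  proof (rule that[where n = ?n and w = w and \<phi> = \<phi>])
    show "(\<Sum>p<?n. scale (g p) (w p)) \<in> W" for g
      using assms C(1) wC by (intro subspace_sum subspace_scale) auto
    show "\<phi> x \<in> coord_space ?n" for x by (simp add: coord_space_def \<phi>_def)
    show "(\<Sum>p<?n. scale (\<phi> x p) (w p)) = x" if x: "x \<in> W" for x
    proof -
      have "(\<Sum>p<?n. scale (\<phi> x p) (w p)) = (\<Sum>p<?n. scale (representation C x (w p)) (w p))"
        by (simp add: \<phi>_def)
      also have "\<dots> = (\<Sum>v\<in>C. scale (representation C x v) v)"
        by (rule sum.reindex_bij_betw[OF w])
      also have "\<dots> = x"
        using C x fin by (intro sum_representation_eq) auto
      finally show ?thesis .
    qed
    show "\<phi> (\<Sum>p<?n. scale (g p) (w p)) = g" if g: "g \<in> coord_space ?n" for g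
    proof (rule coord_space_eqI[OF _ g])
      show "\<phi> (\<Sum>p<?n. scale (g p) (w p)) \<in> coord_space ?n" by (simp add: coord_space_def \<phi>_def)
      fix p assume p: "p < ?n"
      have "representation C (\<Sum>v\<in>C. scale (g (the_inv_into {..<?n} w v)) v) (w p) =
          (\<Sum>v\<in>C. g (the_inv_into {..<?n} w v) * (if v = w p then 1 else 0))"
        using C(2) by (simp add: representation_sum representation_scale span_base span_scale representation_basis)
           (auto intro!: sum.cong)
      also have "\<dots> = g p"
        using wC[OF p] fin w p by (simp add: the_inv_into_f_f bij_betw_def if_distrib cong: if_cong)
      finally show "\<phi> (\<Sum>p<?n. scale (g p) (w p)) p = g p"
        using p by (simp add: \<phi>_def sum)
    qed
  qed
qed

end

context cubic_norm_structure
begin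

lemma isomorphic_to_cube:
  assumes x: "\<And>x. x = (T c x / 3) \<cdot> c"
  shows "isomorphic_to s N (*) (UNIV :: 'a set) (\<lambda>x. x ^ 3)"
  unfolding isomorphic_to_def
proof (intro exI[of _ "\<lambda>x. T c x / 3"] conjI allI)
  have "vector_space ((*) :: 'a \<Rightarrow> 'a \<Rightarrow> 'a)" by unfold_locales (auto simp: algebra_simps)
  then show "Vector_Spaces.linear s (*) (\<lambda>x. T c x / 3)"
    unfolding Vector_Spaces.linear_iff by (simp add: vector_space_axioms T_linear add_divide_distrib)
  show "bij (\<lambda>x. T c x / 3)"
  proof (rule bijI)
    show "inj (\<lambda>x. T c x / 3)" by (rule injI) (metis x)
    show "surj (\<lambda>x. T c x / 3)" by (rule surjI[of _ "\<lambda>k. k \<cdot> c"]) (simp add: T_linear T_unit)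
  qed
  fix y
  have "N ((T c y / 3) \<cdot> c) = (T c y / 3) ^ 3" by (simp only: N_scale N_unit mult_1_right)
  then show "N y = (T c y / 3) ^ 3" using x[of y] by simp
qed

text \<open>Without a half space, \<open>V\<close> is the line of \<open>e\<close> plus the range of
  \<open>X e\<close>. There \<open>N\<close> vanishes and \<open>sharp y\<close> is
  \<open>q y \<cdot> e\<close>, so expanding \<open>N (k \<cdot> e + y)\<close> leaves only
  \<open>q y * k\<close>.\<close>

lemma isomorphic_to_quadratic:
  assumes e: "primitive e" and h0: "half e = {0}"
  shows "\<exists>n q. nondegenerate_quadratic_on fun_scale (coord_space n) q \<and>
    isomorphic_to s N (\<lambda>k (v, x). (fun_scale k v, k * x))
      (coord_space n \<times> (UNIV :: 'a set)) (\<lambda>(v, x). q v * x)"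
proof -
  let ?V = "range (X e)"
  have dec: "v = T e v \<cdot> e + X e (X e v)" for v
    using half_part[OF e, of v] h0 by (simp add: algebra_simps)
  have T_range: "T (X e p) h = T p (X e h)" for p h by (metis T_X X_commute)
  have PP: "X e (X e y) = y" if y: "y \<in> ?V" for y
    using dec[of y] y T_primitive_X[OF e] by auto
  have sub: "subspace ?V"
  proof (rule subspaceI)
    show "0 \<in> ?V" using X_zero_right[of e] by (metis rangeI)
    show "x + y \<in> ?V" if "x \<in> ?V" "y \<in> ?V" for x y
    proof -
      from that obtain p q where "x = X e p" "y = X e q" by auto
      then have "x + y = X e (p + q)" by (simp add: X_add_right)
      then show ?thesis by simp
    qed
    show "k \<cdot> x \<in> ?V" if x: "x \<in> ?V" for k x
    proof -
      from x obtain p where "x = X e p" by auto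
      then have "k \<cdot> x = X e (k \<cdot> p)" by (simp add: X_scale_right)
      then show ?thesis by simp
    qed
  qed
  obtain n w \<phi> where \<psi>V: "\<And>g. (\<Sum>p<n. g p \<cdot> w p) \<in> ?V"
    and \<phi>\<psi>: "\<And>g. g \<in> coord_space n \<Longrightarrow> \<phi> (\<Sum>p<n. g p \<cdot> w p) = g"
    and \<phi>V: "\<And>x. x \<in> ?V \<Longrightarrow> \<phi> x \<in> coord_space n"
    and \<psi>\<phi>: "\<And>x. x \<in> ?V \<Longrightarrow> (\<Sum>p<n. \<phi> x p \<cdot> w p) = x"
    by (rule subspace_coordinates[OF sub]) (rule that; assumption)
  define \<psi> where "\<psi> g = (\<Sum>p<n. g p \<cdot> w p)" for g
  note \<psi>V = \<psi>V[folded \<psi>_def] and \<phi>\<psi> = \<phi>\<psi>[folded \<psi>_def] and \<psi>\<phi> = \<psi>\<phi>[folded \<psi>_def]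
  have \<psi>_linear: "\<psi> (g + h) = \<psi> g + \<psi> h" "\<psi> (fun_scale k g) = k \<cdot> \<psi> g" for g h k
    by (simp_all add: \<psi>_def fun_scale_def scale_left_distrib sum.distrib scale_sum_right)
  have coord_linear: "g \<in> coord_space n \<Longrightarrow> h \<in> coord_space n \<Longrightarrow> g + h \<in> coord_space n"
      "g \<in> coord_space n \<Longrightarrow> fun_scale k g \<in> coord_space n" for g h :: "nat \<Rightarrow> 'a" and k
    by (simp_all add: coord_space_def fun_scale_def)
  define q where "q g = T (sharp (\<psi> g)) e" for g
  define \<Phi> where "\<Phi> v = (\<phi> (X e (X e v)), T e v)" for v
  have \<phi>_linear: "\<phi> (x + y) = \<phi> x + \<phi> y" "\<phi> (k \<cdot> x) = fun_scale k (\<phi> x)" if "x \<in> ?V" "y \<in> ?V" for x y k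
  proof -
    have "\<phi> (\<psi> (\<phi> x + \<phi> y)) = \<phi> x + \<phi> y" "\<phi> (\<psi> (fun_scale k (\<phi> x))) = fun_scale k (\<phi> x)"
      using that by (intro \<phi>\<psi> coord_linear \<phi>V; simp)+
    then show "\<phi> (x + y) = \<phi> x + \<phi> y" "\<phi> (k \<cdot> x) = fun_scale k (\<phi> x)"
      using that by (simp_all add: \<psi>_linear \<psi>\<phi>)
  qed
  have \<phi>_scale: "\<phi> (k \<cdot> x) = fun_scale k (\<phi> x)" if "x \<in> ?V" for k x
    using \<phi>_linear(2)[OF that that] .
  have "nondegenerate_quadratic_on fun_scale (coord_space n) q"
    unfolding nondegenerate_quadratic_on_def
  proof (intro conjI ballI impI)
    have "quadratic_form_on s UNIV (\<lambda>x. T (X x x) e / 2)"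
      by (rule quadratic_form_on_bilinear) (simp_all add: X_linear T_linear field_simps)
    then have "quadratic_form_on fun_scale (coord_space n) (\<lambda>g. T (X (\<psi> g) (\<psi> g)) e / 2)"
      by (rule form_on_compose) (simp_all add: \<psi>_linear)
    moreover have "q = (\<lambda>g. T (X (\<psi> g) (\<psi> g)) e / 2)"
      by (simp add: fun_eq_iff q_def sharp_def T_linear)
    ultimately show "quadratic_form_on fun_scale (coord_space n) q" by simp
  next
    fix u assume u: "u \<in> coord_space n" and 0: "\<forall>v\<in>coord_space n. q (u + v) - q u - q v = 0"
    \<comment> \<open>The polar form of \<open>q\<close> is \<open>T (\<psi> u) (X e y)\<close>.
      Every vector is a multiple of \<open>e\<close> plus some \<open>X e (X e v)\<close>, so its
      vanishing makes \<open>\<psi> u\<close> orthogonal to everything.\<close>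
    have *: "T (\<psi> u) (X e y) = 0" if y: "y \<in> ?V" for y
    proof -
      have "T (X (\<psi> u) y) e = 0"
        using 0 \<phi>V[OF y] \<psi>\<phi>[OF y] by (auto simp: q_def \<psi>_linear sharp_add T_linear)
      then show ?thesis using T_X[of "\<psi> u" y e] by (simp add: X_commute[of y e])
    qed
    have "T (\<psi> u) v = 0" for v
    proof -
      have "T (\<psi> u) e = 0" using \<psi>V[of u] T_primitive_X[OF e] by (auto simp: T_commute[of _ e])
      moreover have "T (\<psi> u) (X e (X e v)) = 0" by (rule *) simp
      ultimately show ?thesis by (subst dec[of v]) (simp add: T_linear)
    qed
    then have "\<psi> u = \<psi> 0" by (auto intro: T_nondegenerate simp: \<psi>_def)
    then show "u = 0" using \<phi>\<psi>[OF u] \<phi>\<psi>[of 0] by (simp add: coord_space_def)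
  qed
  moreover have "isomorphic_to s N (\<lambda>k (v, x). (fun_scale k v, k * x))
      (coord_space n \<times> (UNIV :: 'a set)) (\<lambda>(v, x). q v * x)"
    unfolding isomorphic_to_def
  proof (intro exI[of _ \<Phi>] conjI allI)
    have "vector_space (\<lambda>k (v, x). (fun_scale k v, k * x) :: (nat \<Rightarrow> 'a) \<times> 'a)"
      by unfold_locales (auto simp: fun_scale_def fun_eq_iff algebra_simps)
    then show "Vector_Spaces.linear s (\<lambda>k (v, x). (fun_scale k v, k * x)) \<Phi>"
      unfolding Vector_Spaces.linear_iff using vector_space_axioms by (simp add: \<Phi>_def T_linear X_linear \<phi>_linear(1) \<phi>_scale)
    have e0: "T e e = 1" "X e e = 0" using primitive_X[OF e] by auto
    show "bij_betw \<Phi> UNIV (coord_space n \<times> UNIV)"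
    proof (rule bij_betw_byWitness[where f' = "\<lambda>(g, k). k \<cdot> e + \<psi> g"])
      show "\<forall>v\<in>UNIV. (case \<Phi> v of (g, k) \<Rightarrow> k \<cdot> e + \<psi> g) = v"
        using dec by (simp add: \<Phi>_def \<psi>\<phi>)
      have "T e (\<psi> g) = 0" for g using \<psi>V[of g] T_primitive_X[OF e] by auto
      then show "\<forall>x\<in>coord_space n \<times> UNIV. \<Phi> (case x of (g, k) \<Rightarrow> k \<cdot> e + \<psi> g) = x"
        by (auto simp: \<Phi>_def X_linear T_linear e0 PP[OF \<psi>V] \<phi>\<psi>)
    qed (auto simp: \<Phi>_def intro: \<phi>V)
    fix v
    let ?y = "X e (X e v)"
    have sy: "sharp ?y = T (sharp ?y) e \<cdot> e"
      using sharp_primitive_X[OF e, of "X e v"] e0 by (simp add: T_linear)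
    have "N ?y = 0" using T_primitive_X[OF e] sy by (metis N_sharp_self T_scale_left div_0 mult_zero_right)
    moreover have "sharp e = 0" using e by (simp add: primitive_def)
    ultimately have "N (T e v \<cdot> e + ?y) = T (sharp ?y) e * T e v"
      by (simp add: N_add N_scale sharp_scale T_linear N_sharp_self[of e])
    then show "N v = (case \<Phi> v of (g, x) \<Rightarrow> q g * x)"
      using dec[of v] by (simp add: \<Phi>_def q_def \<psi>\<phi>)
  qed
  ultimately show ?thesis by blast
qed

end

text \<open>
  The norm form of the hermitian \<open>3 \<times> 3\<close> matrices over the split composition algebra of dimension
  \<open>n\<close>: three diagonal entries followed by three blocks of length \<open>n\<close>.
\<close>

definition hermitian_norm :: "nat \<Rightarrow> (nat \<Rightarrow> 'a::comm_ring_1) \<Rightarrow> 'a" where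
  "hermitian_norm n g =
    (let x = \<lambda>p. g (3 + p); y = \<lambda>p. g (3 + n + p); z = \<lambda>p. g (3 + 2 * n + p) in
     g 0 * g 1 * g 2 - g 2 * split_norm n x - g 0 * split_norm n y - g 1 * split_norm n z
       + split_trilinear n x y z)"

lemma split_cong:
  assumes "n \<in> {1, 2, 4, 8}" "\<And>p. p < n \<Longrightarrow> g p = g' p" "\<And>p. p < n \<Longrightarrow> h p = h' p" "\<And>p. p < n \<Longrightarrow> k p = k' p"
  shows "split_norm n g = split_norm n g'" "split_trilinear n g h k = split_trilinear n g' h' k'"
  using assms by (auto simp: split_norm_def split_trilinear_def mat2_form_def mat2_mult_def mat2_adj_def)

context cubic_norm_structure_alg_closed
begin

section \<open>Hermitian coordinates attached to a frame\<close>

lemma peirce_unit: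
  assumes f: "frame a b d" and "peirce a b \<noteq> {0}"
  obtains u where "u \<in> peirce a b" "T u u = 2"
proof -
  have "\<exists>u\<in>peirce a b. T u u \<noteq> 0"
  proof (rule ccontr)
    assume "\<not> ?thesis"
    then have 0: "T u u = 0" if "u \<in> peirce a b" for u using that by blast
    have "T u v = 0" if "u \<in> peirce a b" "v \<in> peirce a b" for u v
    proof -
      have "T (u + v) (u + v) = 0" using that by (intro 0 peirce_linear)
      then have "2 * T u v = 0" using 0 that by (simp add: T_linear T_commute[of v u])
      then show ?thesis by simp
    qed
    then have "u = 0" if "u \<in> peirce a b" for u using peirce_nondegenerate[OF f that] that by blast
    then show False using assms(2) peirce_linear(4) by blast
  qed
  then obtain u where u: "u \<in> peirce a b" "T u u \<noteq> 0" by blast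
  obtain k where k: "k\<^sup>2 = 2 / T u u" using square_root by blast
  have "T (k \<cdot> u) (k \<cdot> u) = 2"
    using k u by (simp add: T_linear power2_eq_square flip: mult.assoc)
  with u show thesis by (intro that[of "k \<cdot> u"] peirce_linear)
qed

text \<open>By \<open>peirce_X_X\<close> and \<open>peirce_X_norm\<close>, \<open>X v\<close> and
  \<open>X u\<close> carry \<open>peirce a d\<close> isometrically to the two other spaces and undo
  themselves, so the norm law transfers. The unit laws hold because \<open>X v (X u v) = u\<close>
  and \<open>X u (X u v) = v\<close>.\<close>

lemma frame_composition_algebra:
  assumes f: "frame a b d" and u: "u \<in> peirce a b" "T u u = 2" and v: "v \<in> peirce b d" "T v v = 2"
  shows "composition_algebra s T (\<lambda>x y. X (X v x) (X u y)) (peirce a d) (X u v)"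
proof -
  have f': "frame b a d" "frame a d b" "frame d b a" "frame b d a"
    using frame_swap frame_rotate f by blast+
  have sym: "peirce b a = peirce a b" "peirce d b = peirce b d" "peirce d a = peirce a d"
    by (rule peirce_commute)+
  have Xu: "X u x \<in> peirce b d" "X u (X u x) = x" "T (X u x) (X u x) = T x x" if "x \<in> peirce a d" for x
    using peirce_X[OF f'(1), of u x] peirce_X_X[OF f'(1), of u x] peirce_X_norm[OF f'(1), of u x] u that sym by auto
  have Xv: "X v x \<in> peirce a b" "X v (X v x) = x" "T (X v x) (X v x) = T x x" if "x \<in> peirce a d" for x
    using peirce_X[OF f'(4), of v x] peirce_X_X[OF f'(4), of v x] peirce_X_norm[OF f'(4), of v x] v that sym by auto
  have w: "X u v \<in> peirce a d" using peirce_X[OF f u(1) v(1)] .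
  have uv: "X u (X u v) = v" "X v (X u v) = u"
    using peirce_X_X[OF f u(1) v(1)] peirce_X_X[OF f'(3), of v u] u v sym by (simp_all add: X_commute[of v u])
  have Tw: "T (X u v) (X u v) = 2" using peirce_X_norm[OF f u(1) v(1)] u v by simp
  show ?thesis
  proof unfold_locales
    show "X (X v x) (X u y) \<in> peirce a d" if "x \<in> peirce a d" "y \<in> peirce a d" for x y
      using peirce_X[OF f Xv(1)[OF that(1)] Xu(1)[OF that(2)]] .
    show "T (X (X v x) (X u y)) (X (X v x) (X u y)) = T x x * T y y / 2"
      if "x \<in> peirce a d" "y \<in> peirce a d" for x y
      using peirce_X_norm[OF f Xv(1)[OF that(1)] Xu(1)[OF that(2)]] Xu(3) Xv(3) that by simp
    show "X (X v (X u v)) (X u x) = x" if "x \<in> peirce a d" for x using Xu that by (simp add: uv)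
    show "X (X v x) (X u (X u v)) = x" if "x \<in> peirce a d" for x
      using Xv that by (simp add: uv X_commute[of "X v x" v])
    show "x = 0" if "x \<in> peirce a d" "\<And>y. y \<in> peirce a d \<Longrightarrow> T x y = 0" for x
      using peirce_nondegenerate[OF f'(2) that(1)] that(2) by blast
    show "T x y = T y x" for x y by (rule T_commute)
  qed (simp_all add: T_linear X_linear peirce_linear w Tw)
qed

text \<open>The components in \<open>peirce a b\<close> and \<open>peirce b d\<close> are moved to
  \<open>peirce a d\<close> by \<open>X v\<close> and \<open>X u\<close>, so one coordinate map
  serves all three; undoing the moves turns \<open>T (X x y) z\<close> into the trilinear form of
  the algebra.\<close>

theorem frame_coordinates:
  assumes f: "frame a b d" and "peirce a b \<noteq> {0}" "peirce b d \<noteq> {0}"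
  obtains n \<kappa> where "n \<in> {1, 2, 4, 8}" "Vector_Spaces.linear s fun_scale \<kappa>"
    "bij_betw \<kappa> UNIV (coord_space (3 + 3 * n))" "\<And>x. N x = hermitian_norm n (\<kappa> x)"
proof -
  have f': "frame b d a" "frame a d b" "frame b a d"
    using frame_swap frame_rotate f by blast+
  have sym: "peirce b a = peirce a b" "peirce d b = peirce b d" "peirce d a = peirce a d"
    by (rule peirce_commute)+
  obtain u where u: "u \<in> peirce a b" "T u u = 2" using peirce_unit[OF f assms(2)] by blast
  obtain v where v: "v \<in> peirce b d" "T v v = 2" using peirce_unit[OF f'(1) assms(3)] by blast
  obtain n \<kappa> where n: "n \<in> {1, 2, 4, 8}"
    and \<kappa>_add: "\<And>x y. \<kappa> (x + y) = \<kappa> x + \<kappa> y" and \<kappa>_scale: "\<And>k x. \<kappa> (k \<cdot> x) = fun_scale k (\<kappa> x)"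
    and \<kappa>_bij: "bij_betw \<kappa> (peirce a d) (coord_space n)"
    and \<kappa>_norm: "\<And>x. x \<in> peirce a d \<Longrightarrow> T x x = 2 * split_norm n (\<kappa> x)"
    and \<kappa>_tri: "\<And>x y z. x \<in> peirce a d \<Longrightarrow> y \<in> peirce a d \<Longrightarrow> z \<in> peirce a d \<Longrightarrow>
      T (X (X v x) (X u y)) z = split_trilinear n (\<kappa> x) (\<kappa> y) (\<kappa> z)"
  proof (rule composition_algebra.split_coordinates[OF frame_composition_algebra[OF f u v]], goal_cases)
    case (1 n \<kappa>)
    from 1(2-7) show ?case by (rule 1(1)[of n \<kappa>])
  qed
  have Xu: "X u x \<in> peirce b d" "X u (X u x) = x" "T (X u x) (X u x) = T x x" if "x \<in> peirce a d" for x
    using peirce_X[OF f'(3), of u x] peirce_X_X[OF f'(3), of u x] peirce_X_norm[OF f'(3), of u x] u that sym by auto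
  have Xv: "X v x \<in> peirce a b" "X v (X v x) = x" "T (X v x) (X v x) = T x x" if "x \<in> peirce a d" for x
    using peirce_X[OF f'(1), of v x] peirce_X_X[OF f'(1), of v x]
      peirce_X_norm[OF f'(1), of v x] v that sym by auto
  have Xu': "X u y \<in> peirce a d" "X u (X u y) = y" if "y \<in> peirce b d" for y
    using peirce_X[OF f u(1) that] peirce_X_X[OF f u(1) that] u by simp_all
  have Xv': "X v x \<in> peirce a d" "X v (X v x) = x" if "x \<in> peirce a b" for x
    using peirce_X[OF frame_rotate[OF f'(2)], of v x] peirce_X_X[OF frame_rotate[OF f'(2)], of v x] that v sym
    by simp_all
  define x where "x t = T t a \<cdot> b + T t b \<cdot> a - X d t" for t
  define y where "y t = T t b \<cdot> d + T t d \<cdot> b - X a t" for t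
  define z where "z t = T t a \<cdot> d + T t d \<cdot> a - X b t" for t
  have xyz: "x t \<in> peirce a b" "y t \<in> peirce b d" "z t \<in> peirce a d" for t
    unfolding x_def y_def z_def
    by (rule peirce_component[OF f'(2)], rule peirce_component[OF f'(3)], rule peirce_component[OF f])
  have dec: "t = T t a \<cdot> a + T t b \<cdot> b + T t d \<cdot> d + x t + y t + z t" for t
    unfolding x_def y_def z_def by (rule peirce_sum[OF f])
  define K where "K t p =
    (if p < 3 then (if p = 0 then T t a else if p = 1 then T t b else T t d)
     else if p < 3 + n then \<kappa> (X v (x t)) (p - 3)
     else if p < 3 + 2 * n then \<kappa> (X u (y t)) (p - (3 + n))
     else if p < 3 + 3 * n then \<kappa> (z t) (p - (3 + 2 * n)) else 0)" for t p
  have K: "K t 0 = T t a" "K t 1 = T t b" "K t 2 = T t d" "\<And>p. p < n \<Longrightarrow> K t (3 + p) = \<kappa> (X v (x t)) p"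
    "\<And>p. p < n \<Longrightarrow> K t (3 + n + p) = \<kappa> (X u (y t)) p" "\<And>p. p < n \<Longrightarrow> K t (3 + 2 * n + p) = \<kappa> (z t) p" for t
    by (simp_all add: K_def)
  show thesis
  proof (rule that[OF n])
    show "Vector_Spaces.linear s fun_scale K"
    proof -
      have "x (t + t') = x t + x t'" "y (t + t') = y t + y t'" "z (t + t') = z t + z t'"
        "x (k \<cdot> t) = k \<cdot> x t" "y (k \<cdot> t) = k \<cdot> y t" "z (k \<cdot> t) = k \<cdot> z t" for t t' k
        by (simp_all add: x_def y_def z_def T_linear X_linear scale_left_distrib scale_right_distrib
            scale_right_diff_distrib)
      then show ?thesis
        unfolding Vector_Spaces.linear_iff
        by (auto simp: vector_space_axioms vector_space_fun_scale fun_eq_iff fun_scale_def K_def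
            T_linear X_linear \<kappa>_add \<kappa>_scale)
    qed
    show "bij_betw K UNIV (coord_space (3 + 3 * n))"
      unfolding bij_betw_def
    proof
      have \<kappa>_eq: "p = q" if "p \<in> peirce a d" "q \<in> peirce a d" "\<And>i. i < n \<Longrightarrow> \<kappa> p i = \<kappa> q i" for p q
      proof -
        have "\<kappa> p \<in> coord_space n" "\<kappa> q \<in> coord_space n" using \<kappa>_bij that by (auto simp: bij_betw_def)
        then have "\<kappa> p = \<kappa> q" using that(3) by (rule coord_space_eqI)
        then show ?thesis using \<kappa>_bij that by (auto simp: bij_betw_def inj_on_def)
      qed
      show "inj K"
      proof (rule injI)
        fix t t' assume eq: "K t = K t'"
        have "X v (x t) = X v (x t')" "X u (y t) = X u (y t')" "z t = z t'"
          using K(4-6)[of _ t] K(4-6)[of _ t'] eq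
          by (auto intro!: \<kappa>_eq Xv' Xu' xyz)
        then have "x t = x t'" "y t = y t'" "z t = z t'" using Xv'(2) Xu'(2) xyz by metis+
        moreover have "T t a = T t' a" "T t b = T t' b" "T t d = T t' d" using K(1-3)[of t] K(1-3)[of t'] eq by auto
        ultimately show "t = t'" using dec by metis
      qed
      have "g \<in> range K" if g: "g \<in> coord_space (3 + 3 * n)" for g
      proof -
        have "\<exists>p\<in>peirce a d. \<forall>i<n. \<kappa> p i = g (k + i)" for k
        proof -
          have "(\<lambda>i. if i < n then g (k + i) else 0) \<in> coord_space n" by (simp add: coord_space_def)
          then have "(\<lambda>i. if i < n then g (k + i) else 0) \<in> \<kappa> ` peirce a d"
            using \<kappa>_bij by (simp add: bij_betw_def)
          then obtain p where "p \<in> peirce a d" "(\<lambda>i. if i < n then g (k + i) else 0) = \<kappa> p"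
            by (rule imageE) auto
          note p = this(1) and eq = this(2)
          have "\<kappa> p i = g (k + i)" if "i < n" for i using fun_cong[OF eq, of i] that by simp
          with p show ?thesis by blast
        qed
        then obtain p where p: "p k \<in> peirce a d" "i < n \<Longrightarrow> \<kappa> (p k) i = g (k + i)" for k i by metis
        define t where "t = g 0 \<cdot> a + g 1 \<cdot> b + g 2 \<cdot> d + X v (p 3) + X u (p (3 + n)) + p (3 + 2 * n)"
        let ?x = "X v (p 3)" and ?y = "X u (p (3 + n))" and ?z = "p (3 + 2 * n)"
        have mem: "?x \<in> peirce a b" "?y \<in> peirce b d" "?z \<in> peirce a d" using Xv(1) Xu(1) p(1) by auto
        have third: "T d ?x = 0" "X d ?x = - ?x" "T a ?y = 0" "X a ?y = - ?y" "T b ?z = 0" "X b ?z = - ?z"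
          using peirce_third[OF f mem(1)] peirce_third[OF f'(1) mem(2)] peirce_third[OF f'(2) mem(3)] by auto
        have 0: "X a ?x = 0" "X b ?x = 0" "X b ?y = 0" "X d ?y = 0" "X a ?z = 0" "X d ?z = 0"
          "T a ?x = 0" "T b ?x = 0" "T b ?y = 0" "T d ?y = 0" "T a ?z = 0" "T d ?z = 0"
          using mem by (auto simp: peirce_def)
        have fr: "X a a = 0" "X b b = 0" "X d d = 0" "X b d = a" "X d a = b" "X a b = d"
          "X d b = a" "X a d = b" "X b a = d"
          using f primitive_X(1) by (auto simp: frame_def X_commute)
        have fT: "T a a = 1" "T b b = 1" "T d d = 1" "T a b = 0" "T b d = 0" "T a d = 0" "T b a = 0" "T d b = 0" "T d a = 0"
          using frame_T[OF f] by (auto simp: T_commute)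
        have Tt: "T a t = g 0" "T b t = g 1" "T d t = g 2"
          unfolding t_def T_linear third 0 fT by simp_all
        have xyz_t: "x t = ?x" "y t = ?y" "z t = ?z"
          unfolding x_def y_def z_def T_commute[of t] Tt
          unfolding t_def X_linear third 0 fr by (simp_all add: algebra_simps)
        have "K t = g"
        proof (rule coord_space_eqI[OF _ g])
          show "K t \<in> coord_space (3 + 3 * n)" by (simp add: coord_space_def K_def)
          fix i assume "i < 3 + 3 * n"
          then consider "i = 0" | "i = 1" | "i = 2" | "3 \<le> i" "i < 3 + n"
            | "3 + n \<le> i" "i < 3 + 2 * n" | "3 + 2 * n \<le> i" "i < 3 + 3 * n" by linarith
          then show "K t i = g i"
          proof cases
            case 4
            then show ?thesis
              using K(4)[of "i - 3" t] p(2)[of "i - 3" 3] by (simp add: xyz_t Xv(2)[OF p(1)])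
          next
            case 5
            then show ?thesis
              using K(5)[of "i - (3 + n)" t] p(2)[of "i - (3 + n)" "3 + n"] by (simp add: xyz_t Xu(2)[OF p(1)])
          next
            case 6
            then show ?thesis
              using K(6)[of "i - (3 + 2 * n)" t] p(2)[of "i - (3 + 2 * n)" "3 + 2 * n"] by (simp add: xyz_t)
          qed (use Tt K(1-3)[of t] in \<open>simp_all add: T_commute[of t]\<close>)
        qed
        then show ?thesis by blast
      qed
      moreover have "range K \<subseteq> coord_space (3 + 3 * n)" by (auto simp: coord_space_def K_def)
      ultimately show "range K = coord_space (3 + 3 * n)" by blast
    qed
    show "N t = hermitian_norm n (K t)" for t
    proof -
      have mem: "X v (x t) \<in> peirce a d" "X u (y t) \<in> peirce a d"
        using Xv'(1)[OF xyz(1)] Xu'(1)[OF xyz(2)] .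
      have 1: "T (x t) (x t) = 2 * split_norm n (\<lambda>p. K t (3 + p))"
        using Xv(3)[OF mem(1)] Xv'(2)[OF xyz(1)] \<kappa>_norm[OF mem(1)] split_cong(1)[OF n, of "\<lambda>p. K t (3 + p)"]
          K(4) by metis
      have 2: "T (y t) (y t) = 2 * split_norm n (\<lambda>p. K t (3 + n + p))"
        using Xu(3)[OF mem(2)] Xu'(2)[OF xyz(2)] \<kappa>_norm[OF mem(2)] split_cong(1)[OF n, of "\<lambda>p. K t (3 + n + p)"]
          K(5) by metis
      have 3: "T (z t) (z t) = 2 * split_norm n (\<lambda>p. K t (3 + 2 * n + p))"
        using \<kappa>_norm[OF xyz(3)] split_cong(1)[OF n, of "\<lambda>p. K t (3 + 2 * n + p)"] K(6) by metis
      have 4: "T (X (x t) (y t)) (z t) =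
          split_trilinear n (\<lambda>p. K t (3 + p)) (\<lambda>p. K t (3 + n + p)) (\<lambda>p. K t (3 + 2 * n + p))"
        using \<kappa>_tri[OF mem xyz(3)] split_cong(2)[OF n K(4) K(5) K(6)] Xv'(2)[OF xyz(1)] Xu'(2)[OF xyz(2)]
        by simp
      have "N t = N (T t a \<cdot> a + T t b \<cdot> b + T t d \<cdot> d + x t + y t + z t)" using dec[of t] by simp
      also have "\<dots> = hermitian_norm n (K t)"
        unfolding N_frame[OF f xyz] 1 2 3 4 hermitian_norm_def Let_def K(1-3) by simp
      finally show ?thesis .
    qed
  qed
qed


text \<open>\<open>X a\<close> is injective on the span of \<open>b\<close>, \<open>d\<close> and
  \<open>peirce b d\<close>, so a vector of \<open>half a\<close> has components only in the two
  Peirce spaces adjacent to \<open>a\<close>.\<close>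

lemma half_components:
  assumes f: "frame a b d" and "half a \<noteq> {0}"
  shows "peirce a b \<noteq> {0} \<or> peirce a d \<noteq> {0}"
proof (rule ccontr)
  assume "\<not> ?thesis"
  then have 0: "peirce a b = {0}" "peirce a d = {0}" by auto
  have "x = 0" if x: "x \<in> half a" for x
  proof -
    obtain p y z where pyz: "p \<in> peirce a b" "y \<in> peirce b d" "z \<in> peirce a d"
      and x_eq: "x = T x a \<cdot> a + T x b \<cdot> b + T x d \<cdot> d + p + y + z"
      using peirce_decomposition[OF f] .
    have y: "T b y = 0" "T d y = 0" "X a y = - y"
      using pyz peirce_third[OF frame_rotate[OF f]] by (auto simp: peirce_def)
    have fr: "X a a = 0" "X a b = d" "X a d = b" using f primitive_X(1) by (auto simp: frame_def X_commute)
    have "p = 0" "z = 0" using 0 pyz by auto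
    moreover have "T x a = 0" using x by (simp add: half_def T_commute)
    ultimately have x_eq: "x = T x b \<cdot> b + T x d \<cdot> d + y" using x_eq by simp
    have "X a x = 0" using x by (simp add: half_def)
    then have *: "T x b \<cdot> d + T x d \<cdot> b - y = 0" by (subst (asm) x_eq) (simp add: X_linear fr y)
    from arg_cong[OF *, of "T b"] arg_cong[OF *, of "T d"]
    have "T x b = 0" "T x d = 0"
      by (simp_all add: T_linear y frame_T[OF f] T_commute[of d b])
    then show ?thesis using * x_eq by simp
  qed
  moreover have "0 \<in> half a" by (simp add: half_def)
  ultimately show False using assms(2) by blast
qed

theorem classification:
  obtains
    (cube) "isomorphic_to s N (*) (UNIV :: 'a set) (\<lambda>x. x ^ 3)"
  | (quadratic) n q where "nondegenerate_quadratic_on fun_scale (coord_space n) q"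
      "isomorphic_to s N (\<lambda>k (v, x). (fun_scale k v, k * x))
        (coord_space n \<times> (UNIV :: 'a set)) (\<lambda>(v, x). q v * x)"
  | (hermitian) n where "n \<in> {1, 2, 4, 8}"
      "isomorphic_to s N fun_scale (coord_space (3 + 3 * n)) (hermitian_norm n)"
proof (cases "\<exists>e. primitive e")
  case False
  then show thesis using cube isomorphic_to_cube[OF unit_spans_or_primitive] by blast
next
  case True
  then obtain e where e: "primitive e" by blast
  show thesis
  proof (cases "\<exists>e. primitive e \<and> half e = {0}")
    case True
    then obtain e where "primitive e" "half e = {0}" by blast
    from isomorphic_to_quadratic[OF this] obtain n q where
      "nondegenerate_quadratic_on fun_scale (coord_space n) q"
      "isomorphic_to s N (\<lambda>k (v, x). (fun_scale k v, k * x))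
        (coord_space n \<times> (UNIV :: 'a set)) (\<lambda>(v, x). q v * x)" by blast
    then show thesis by (rule quadratic)
  next
    case False
    then have h: "half a \<noteq> {0}" if "primitive a" for a using that by blast
    obtain b d where f: "frame e b d" using frame_extends_primitive[OF e h[OF e]] .
    have *: thesis if f: "frame a b d" "peirce a b \<noteq> {0}" "peirce b d \<noteq> {0}" for a b d
    proof -
      obtain n \<kappa> where "n \<in> {1, 2, 4, 8}" "Vector_Spaces.linear s fun_scale \<kappa>"
        "bij_betw \<kappa> UNIV (coord_space (3 + 3 * n))" "\<And>x. N x = hermitian_norm n (\<kappa> x)"
      proof (rule frame_coordinates[OF f], goal_cases)
        case (1 n \<kappa>)
        from 1(2-5) show ?case by (rule 1(1)[of n \<kappa>])
      qed
      then show thesis by (intro hermitian[of n]) (auto simp: isomorphic_to_def)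
    qed
    have f': "frame b d e" "frame b e d" "frame e d b" "frame d e b"
      using f frame_rotate frame_swap by blast+
    have p: "primitive e" "primitive b" "primitive d" using f by (auto simp: frame_def)
    \<comment> \<open>Each frame element is adjacent to a nonzero Peirce space, so at least two of
      the three spaces are nonzero. They share a frame element, and relabelling puts it in the
      middle.\<close>
    have 1: "peirce e b \<noteq> {0} \<or> peirce e d \<noteq> {0}" using half_components[OF f h[OF p(1)]] .
    have 2: "peirce e b \<noteq> {0} \<or> peirce b d \<noteq> {0}"
      using half_components[OF f'(2) h[OF p(2)]] unfolding peirce_commute[of b e] .
    have 3: "peirce e d \<noteq> {0} \<or> peirce b d \<noteq> {0}"
      using half_components[OF f'(4) h[OF p(3)]] unfolding peirce_commute[of d e] peirce_commute[of d b] .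
    from 1 2 3 consider "peirce e b \<noteq> {0}" "peirce b d \<noteq> {0}" | "peirce e b \<noteq> {0}" "peirce e d \<noteq> {0}"
      | "peirce e d \<noteq> {0}" "peirce b d \<noteq> {0}" by argo
    then show thesis
    proof cases
      case 1
      then show thesis by (rule *[OF f])
    next
      case 2
      then show thesis unfolding peirce_commute[of e b] by (rule *[OF f'(2)])
    next
      case 3
      then show thesis unfolding peirce_commute[of b d] by (rule *[OF f'(3)])
    qed
  qed
qed

end


section \<open>The matrix models\<close>

subsection \<open>The Pfaffian\<close>

lemma UNIV6: "(UNIV::6 set) = {1,2,3,4,5,6}"
proof -
  have "x \<in> {1,2,3,4,5,6}" for x :: 6
  proof (cases x)
    case (of_int z)
    then have "0 \<le> z" "z < 6" by simp_all
    then have "z = 0 \<or> z = 1 \<or> z = 2 \<or> z = 3 \<or> z = 4 \<or> z = 5" by arith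
    with of_int show ?thesis by auto
  qed
  then show ?thesis by auto
qed

definition alternating_sum :: "'i set \<Rightarrow> (('i \<Rightarrow> 'i) \<Rightarrow> 'a::comm_ring_1) \<Rightarrow> 'a" where
  "alternating_sum S f = (\<Sum>p | p permutes S. of_int (sign p) * f p)"

lemma alternating_sum_empty: "alternating_sum {} f = f id"
  by (simp add: alternating_sum_def)

text \<open>Unfolds a signed sum over the permutations of a concrete set one element at a
  time.\<close>

lemma alternating_sum_insert:
  assumes "finite S" "a \<notin> S"
  shows "alternating_sum (insert a S) f = alternating_sum S f - (\<Sum>b\<in>S. alternating_sum S (\<lambda>q. f (Transposition.transpose a b \<circ> q)))"
proof -
  have s: "sign (Transposition.transpose a b \<circ> q) = (if b = a then sign q else - sign q)" if "q permutes S" for b q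
    using that assms by (subst sign_compose) (auto simp: sign_swap_id permutation_swap_id intro: permutes_imp_permutation)
  have "alternating_sum (insert a S) f = (\<Sum>b\<in>insert a S. \<Sum>q | q permutes S. of_int (sign (Transposition.transpose a b \<circ> q)) * f (Transposition.transpose a b \<circ> q))"
    unfolding alternating_sum_def by (rule sum_over_permutations_insert[OF assms])
  also have "\<dots> = alternating_sum S f + (\<Sum>b\<in>S. - alternating_sum S (\<lambda>q. f (Transposition.transpose a b \<circ> q)))"
    using assms by (auto simp: alternating_sum_def s sum_negf[symmetric] intro!: sum.cong)
  finally show ?thesis by (simp add: sum_negf)
qed

lemma distinct6: "distinct [1, 2, 3, 4, 5, 6 :: 6]"
proof (rule card_distinct)
  have "set [1, 2, 3, 4, 5, 6 :: 6] = UNIV" by (simp add: UNIV6)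
  then show "card (set [1, 2, 3, 4, 5, 6 :: 6]) = length [1, 2, 3, 4, 5, 6 :: 6]" by (simp del: list.set)
qed

lemma neq6: "(1::6) \<noteq> 2" "(1::6) \<noteq> 3" "(1::6) \<noteq> 4" "(1::6) \<noteq> 5" "(1::6) \<noteq> 6"
  "(2::6) \<noteq> 3" "(2::6) \<noteq> 4" "(2::6) \<noteq> 5" "(2::6) \<noteq> 6" "(3::6) \<noteq> 4" "(3::6) \<noteq> 5" "(3::6) \<noteq> 6"
  "(4::6) \<noteq> 5" "(4::6) \<noteq> 6" "(5::6) \<noteq> 6"
  using distinct6 by (simp_all only: distinct.simps list.set insert_iff empty_iff de_Morgan_disj simp_thms)

text \<open>Here the transposition acts on argument positions; passing to inverse permutations
  reduces this to \<open>alternating_sum_insert\<close>.\<close>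

lemma alternating_sum_insert_right:
  fixes f :: "('i \<Rightarrow> 'i) \<Rightarrow> 'a::comm_ring_1"
  assumes "finite S" "a \<notin> S"
  shows "alternating_sum (insert a S) f = alternating_sum S f -
    (\<Sum>b\<in>S. alternating_sum S (\<lambda>q. f (q \<circ> Transposition.transpose a b)))"
proof -
  have inv: "alternating_sum S' f = alternating_sum S' (\<lambda>p. f (inv p))" if "finite S'" for S' and f :: "('i \<Rightarrow> 'i) \<Rightarrow> 'a"
  proof -
    have "alternating_sum S' f = (\<Sum>p | p permutes S'. of_int (sign (inv p)) * f (inv p))"
      unfolding alternating_sum_def by (rule sum_permutations_inverse)
    also have "\<dots> = alternating_sum S' (\<lambda>p. f (inv p))"
      unfolding alternating_sum_def
      using that by (intro sum.cong refl) (auto simp: sign_inverse permutes_imp_permutation)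
    finally show ?thesis .
  qed
  have "inv (Transposition.transpose a b \<circ> q) = inv q \<circ> Transposition.transpose a b" if "q permutes S" for q b
    using that by (subst o_inv_distrib) (auto simp: permutes_bij)
  then have "alternating_sum S (\<lambda>q. f (inv (Transposition.transpose a b \<circ> q))) =
      alternating_sum S (\<lambda>q. f (inv q \<circ> Transposition.transpose a b))" for b
    unfolding alternating_sum_def by (intro sum.cong) auto
  then show ?thesis
    using assms inv[of "insert a S" f] inv[of S f]
      inv[of S "\<lambda>q. f (q \<circ> Transposition.transpose a b)" for b]
    by (simp add: alternating_sum_insert)
qed

lemma alternating_sum_transpose:
  assumes "finite S" "a \<in> S" "b \<in> S" "a \<noteq> b"
  shows "alternating_sum S (\<lambda>q. f (q \<circ> Transposition.transpose a b)) = - alternating_sum S f"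
proof -
  have t: "Transposition.transpose a b permutes S" using assms by (intro permutes_swap_id)
  have "alternating_sum S f = (\<Sum>q | q permutes S. of_int (sign (q \<circ> Transposition.transpose a b)) * f (q \<circ> Transposition.transpose a b))"
    unfolding alternating_sum_def by (rule sum_permutations_compose_right[OF t])
  also have "\<dots> = (\<Sum>q | q permutes S. - (of_int (sign q) * f (q \<circ> Transposition.transpose a b)))"
  proof (intro sum.cong refl)
    fix q assume "q \<in> {q. q permutes S}"
    then have "permutation q" using assms by (auto intro: permutes_imp_permutation)
    then have "sign (q \<circ> Transposition.transpose a b) = - sign q"
      using assms by (simp add: sign_compose sign_swap_id permutation_swap_id)
    then show "of_int (sign (q \<circ> Transposition.transpose a b)) * f (q \<circ> Transposition.transpose a b) =
       - (of_int (sign q) * f (q \<circ> Transposition.transpose a b))" by simp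
  qed
  also have "\<dots> = - alternating_sum S (\<lambda>q. f (q \<circ> Transposition.transpose a b))"
    unfolding alternating_sum_def by (rule sum_negf)
  finally show ?thesis by simp
qed

lemma alternating_sum_neg: "alternating_sum S (\<lambda>q. - f q) = - alternating_sum S f"
  by (simp add: alternating_sum_def sum_negf)

text \<open>The denominator 48 is removed as 6 times 8: symmetry in position 1 gives the factor 6,
  and only the 120 permutations of the other five indices are unfolded, which hit each of the 15
  perfect matchings 8 times.\<close>

lemma pfaffian6_expand:
  fixes A :: "'a::field_char_0^6^6"
  assumes "A \<in> skew_symmetric_matrices"
  shows "pfaffian6 A =
    A$1$2 * A$3$4 * A$5$6 - A$1$2 * A$3$5 * A$4$6 + A$1$2 * A$3$6 * A$4$5
    - A$1$3 * A$2$4 * A$5$6 + A$1$3 * A$2$5 * A$4$6 - A$1$3 * A$2$6 * A$4$5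
    + A$1$4 * A$2$3 * A$5$6 - A$1$4 * A$2$5 * A$3$6 + A$1$4 * A$2$6 * A$3$5
    - A$1$5 * A$2$3 * A$4$6 + A$1$5 * A$2$4 * A$3$6 - A$1$5 * A$2$6 * A$3$4
    + A$1$6 * A$2$3 * A$4$5 - A$1$6 * A$2$4 * A$3$5 + A$1$6 * A$2$5 * A$3$4"
    (is "_ = ?P")
proof -
  define g where "g p = A $ p 1 $ p 2 * A $ p 3 $ p 4 * A $ p 5 $ p 6" for p :: "6 \<Rightarrow> 6"
  let ?S = "{2, 3, 4, 5, 6 :: 6}"
  let ?t = "Transposition.transpose :: 6 \<Rightarrow> 6 \<Rightarrow> 6 \<Rightarrow> 6"
  have skew: "A $ i $ j = - A $ j $ i" for i j
  proof -
    have "Finite_Cartesian_Product.transpose A = - A" using assms by (simp add: skew_symmetric_matrices_def)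
    then have "Finite_Cartesian_Product.transpose A $ j $ i = (- A) $ j $ i" by simp
    then show ?thesis by (simp add: Finite_Cartesian_Product.transpose_def)
  qed
  \<comment> \<open>By skew symmetry, moving position 1 to another pair has the same effect as a
    transposition that fixes 1, and exchanging 1 with 2 changes the sign. So each of the five terms
    contributes \<open>- alternating_sum ?S g\<close>.\<close>
  have swap: "g (q \<circ> ?t 1 2) = - g q" "g (q \<circ> ?t 1 3) = g (q \<circ> ?t 2 4)" "g (q \<circ> ?t 1 4) = g (q \<circ> ?t 2 3)"
      "g (q \<circ> ?t 1 5) = g (q \<circ> ?t 2 6)" "g (q \<circ> ?t 1 6) = g (q \<circ> ?t 2 5)" for q
  proof -
    have vals: "g (q \<circ> ?t 1 2) = A $ q 2 $ q 1 * A $ q 3 $ q 4 * A $ q 5 $ q 6"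
      "g (q \<circ> ?t 1 3) = A $ q 3 $ q 2 * A $ q 1 $ q 4 * A $ q 5 $ q 6"
      "g (q \<circ> ?t 2 4) = A $ q 1 $ q 4 * A $ q 3 $ q 2 * A $ q 5 $ q 6"
      "g (q \<circ> ?t 1 4) = A $ q 4 $ q 2 * A $ q 3 $ q 1 * A $ q 5 $ q 6"
      "g (q \<circ> ?t 2 3) = A $ q 1 $ q 3 * A $ q 2 $ q 4 * A $ q 5 $ q 6"
      "g (q \<circ> ?t 1 5) = A $ q 5 $ q 2 * A $ q 3 $ q 4 * A $ q 1 $ q 6"
      "g (q \<circ> ?t 2 6) = A $ q 1 $ q 6 * A $ q 3 $ q 4 * A $ q 5 $ q 2"
      "g (q \<circ> ?t 1 6) = A $ q 6 $ q 2 * A $ q 3 $ q 4 * A $ q 5 $ q 1"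
      "g (q \<circ> ?t 2 5) = A $ q 1 $ q 5 * A $ q 3 $ q 4 * A $ q 2 $ q 6"
      by (simp_all add: g_def Transposition.transpose_def neq6 neq6[symmetric])
    show "g (q \<circ> ?t 1 2) = - g q"
      unfolding vals by (subst skew[of "q 2" "q 1"]) (simp add: g_def)
    show "g (q \<circ> ?t 1 3) = g (q \<circ> ?t 2 4)" "g (q \<circ> ?t 1 5) = g (q \<circ> ?t 2 6)"
      unfolding vals by (simp_all only: mult_ac)
    show "g (q \<circ> ?t 1 4) = g (q \<circ> ?t 2 3)"
      unfolding vals skew[of "q 4" "q 2"] skew[of "q 3" "q 1"] by (simp add: mult_ac)
    show "g (q \<circ> ?t 1 6) = g (q \<circ> ?t 2 5)"
      unfolding vals skew[of "q 6" "q 2"] skew[of "q 5" "q 1"] by (simp add: mult_ac)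
  qed
  have "alternating_sum UNIV g = alternating_sum (insert 1 ?S) g" by (simp add: UNIV6)
  also have "\<dots> = alternating_sum ?S g - (\<Sum>b\<in>?S. alternating_sum ?S (\<lambda>q. g (q \<circ> ?t 1 b)))"
    by (rule alternating_sum_insert_right) (simp_all add: neq6)
  also have "(\<Sum>b\<in>?S. alternating_sum ?S (\<lambda>q. g (q \<circ> ?t 1 b))) = - 5 * alternating_sum ?S g"
    using neq6 by (simp add: neq6[symmetric] swap alternating_sum_neg alternating_sum_transpose)
  finally have 1: "alternating_sum UNIV g = 6 * alternating_sum ?S g" by simp
  have "pfaffian6 A = alternating_sum UNIV g / 48"
    by (simp add: pfaffian6_def alternating_sum_def g_def mult.assoc)
  also have "\<dots> = alternating_sum ?S g / 8" unfolding 1 by simp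
  also have "alternating_sum ?S g = 8 * ?P"
    unfolding g_def
    by (simp add: alternating_sum_insert alternating_sum_empty Transposition.transpose_def neq6 neq6[symmetric])
       (simp add: skew[of 2 1] skew[of 3 1] skew[of 4 1] skew[of 5 1] skew[of 6 1] skew[of 3 2] skew[of 4 2]
         skew[of 5 2] skew[of 6 2] skew[of 4 3] skew[of 5 3] skew[of 6 3] skew[of 5 4] skew[of 6 4] skew[of 6 5])
  finally have "pfaffian6 A = 8 * ?P / 8" .
  then show ?thesis by (metis nonzero_mult_div_cancel_left zero_neq_numeral)
qed


subsection \<open>Isomorphisms with the models\<close>

lemma isomorphic_to_compose:
  assumes iso: "isomorphic_to s f fun_scale (coord_space m) P" and "vector_space s'"
    and "\<And>g h. \<tau> (g + h) = \<tau> g + \<tau> h" "\<And>k g. \<tau> (fun_scale k g) = s' k (\<tau> g)"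
    and "bij_betw \<tau> (coord_space m) W" "\<And>g. g \<in> coord_space m \<Longrightarrow> P g = Q (\<tau> g)"
  shows "isomorphic_to s f s' W Q"
proof -
  obtain \<phi> where \<phi>: "Vector_Spaces.linear s fun_scale \<phi>" "bij_betw \<phi> UNIV (coord_space m)" "\<And>x. f x = P (\<phi> x)"
    using iso unfolding isomorphic_to_def by blast
  have "Vector_Spaces.linear s s' (\<lambda>x. \<tau> (\<phi> x))"
    using \<phi>(1) assms(2-4) unfolding Vector_Spaces.linear_iff by simp
  moreover have "bij_betw (\<lambda>x. \<tau> (\<phi> x)) UNIV W"
    using bij_betw_trans[OF \<phi>(2) assms(5)] by (simp add: o_def)
  moreover have "\<phi> x \<in> coord_space m" for x using \<phi>(2) by (auto simp: bij_betw_def)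
  then have "f x = Q (\<tau> (\<phi> x))" for x using \<phi>(3) assms(6) by simp
  ultimately show ?thesis unfolding isomorphic_to_def by blast
qed

lemma vector_space_mat_scale: "vector_space (mat_scale :: 'a::field \<Rightarrow> 'a^'n^'m \<Rightarrow> _)"
  by unfold_locales (auto simp: mat_scale_def vec_eq_iff algebra_simps)

lemma coord_space_eq_nth:
  assumes "length xs = n" "g \<in> coord_space n" "\<And>p. p < n \<Longrightarrow> g p = xs ! p"
  shows "(\<lambda>p. if p < length xs then xs ! p else 0) = g"
  using assms by (auto simp: coord_space_def fun_eq_iff)

lemma isomorphic_to_symmetric_matrices:
  fixes s :: "'a::field_char_0 \<Rightarrow> 'v::ab_group_add \<Rightarrow> 'v"
  assumes "isomorphic_to s f fun_scale (coord_space 6) (hermitian_norm 1)"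
  shows "isomorphic_to s f mat_scale (symmetric_matrices :: ('a^3^3) set) det"
proof (rule isomorphic_to_compose[OF assms vector_space_mat_scale])
  let ?t = "\<lambda>g. vector [vector [g 0, g 3, g 5], vector [g 3, g 1, g 4], vector [g 5, g 4, g 2]] :: 'a^3^3"
  let ?l = "\<lambda>A :: 'a^3^3. [A$1$1, A$2$2, A$3$3, A$1$2, A$2$3, A$1$3]"
  show "?t (g + h) = ?t g + ?t h" "?t (fun_scale k g) = mat_scale k (?t g)" for g h k
    by (simp_all add: vec_eq_iff forall_3 mat_scale_def fun_scale_def)
  show "hermitian_norm 1 g = det (?t g)" for g
    by (simp add: hermitian_norm_def split_norm_def split_trilinear_def det_3 power2_eq_square algebra_simps)
  show "bij_betw ?t (coord_space 6) symmetric_matrices"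
  proof (rule bij_betw_byWitness[where f' = "\<lambda>A p. if p < length (?l A) then ?l A ! p else 0"])
    show "\<forall>g\<in>coord_space 6. (\<lambda>p. if p < length (?l (?t g)) then ?l (?t g) ! p else 0) = g"
    proof (intro ballI coord_space_eq_nth)
      fix g :: "nat \<Rightarrow> 'a" and p :: nat
      assume "p < 6"
      then have "p = 0 \<or> p = 1 \<or> p = 2 \<or> p = 3 \<or> p = 4 \<or> p = 5" by arith
      then show "g p = ?l (?t g) ! p" by (elim disjE) simp_all
    qed auto
    show "\<forall>A\<in>symmetric_matrices. ?t (\<lambda>p. if p < length (?l A) then ?l A ! p else 0) = A"
    proof
      fix A :: "'a^3^3" assume "A \<in> symmetric_matrices"
      then have A: "Finite_Cartesian_Product.transpose A $ i $ j = A $ i $ j" for i j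
        by (simp add: symmetric_matrices_def)
      have "A $ 2 $ 1 = A $ 1 $ 2" "A $ 3 $ 1 = A $ 1 $ 3" "A $ 3 $ 2 = A $ 2 $ 3"
        using A[of 1 2] A[of 1 3] A[of 2 3] by (simp_all add: Finite_Cartesian_Product.transpose_def)
      then show "?t (\<lambda>p. if p < length (?l A) then ?l A ! p else 0) = A"
        by (simp add: vec_eq_iff forall_3)
    qed
    show "?t ` coord_space 6 \<subseteq> symmetric_matrices"
      by (auto simp: symmetric_matrices_def vec_eq_iff forall_3 Finite_Cartesian_Product.transpose_def)
  qed (auto simp: coord_space_def)
qed

text \<open>The two coordinates of a block are a pair of mirror entries, so the norm terms are the
  transpositions of the determinant and \<open>split_trilinear 2\<close> gives its two
  3-cycles.\<close>

lemma isomorphic_to_matrices: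
  fixes s :: "'a::field_char_0 \<Rightarrow> 'v::ab_group_add \<Rightarrow> 'v"
  assumes "isomorphic_to s f fun_scale (coord_space 9) (hermitian_norm 2)"
  shows "isomorphic_to s f mat_scale (UNIV :: ('a^3^3) set) det"
proof (rule isomorphic_to_compose[OF assms vector_space_mat_scale])
  let ?t = "\<lambda>g. vector [vector [g 0, g 3, g 7], vector [g 4, g 1, g 5], vector [g 8, g 6, g 2]] :: 'a^3^3"
  let ?l = "\<lambda>A :: 'a^3^3. [A$1$1, A$2$2, A$3$3, A$1$2, A$2$1, A$2$3, A$3$2, A$1$3, A$3$1]"
  show "?t (g + h) = ?t g + ?t h" "?t (fun_scale k g) = mat_scale k (?t g)" for g h k
    by (simp_all add: vec_eq_iff forall_3 mat_scale_def fun_scale_def)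
  show "hermitian_norm 2 g = det (?t g)" for g
    by (simp add: hermitian_norm_def split_norm_def split_trilinear_def det_3 power2_eq_square algebra_simps)
  show "bij_betw ?t (coord_space 9) UNIV"
  proof (rule bij_betw_byWitness[where f' = "\<lambda>A p. if p < length (?l A) then ?l A ! p else 0"])
    show "\<forall>g\<in>coord_space 9. (\<lambda>p. if p < length (?l (?t g)) then ?l (?t g) ! p else 0) = g"
    proof (intro ballI coord_space_eq_nth)
      fix g :: "nat \<Rightarrow> 'a" and p :: nat
      assume "p < 9"
      then have "p = 0 \<or> p = 1 \<or> p = 2 \<or> p = 3 \<or> p = 4 \<or> p = 5 \<or> p = 6 \<or> p = 7 \<or> p = 8" by arith
      then show "g p = ?l (?t g) ! p" by (elim disjE) simp_all
    qed auto
    show "\<forall>A\<in>UNIV. ?t (\<lambda>p. if p < length (?l A) then ?l A ! p else 0) = A"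
      by (auto simp: vec_eq_iff forall_3)
  qed (auto simp: coord_space_def)
qed

lemma forall_6: "(\<forall>i::6. P i) \<longleftrightarrow> P 1 \<and> P 2 \<and> P 3 \<and> P 4 \<and> P 5 \<and> P 6"
  using UNIV6 by (metis UNIV_I insertE singletonD)

text \<open>An entry \<open>(i, j, c, k)\<close> places \<open>c\<close> times the \<open>k\<close>-th coordinate in position \<open>(i, j)\<close>.\<close>

definition skew_entries :: "(6 \<times> 6 \<times> int \<times> nat) list" where
  "skew_entries = [(1, 2, 1, 0), (3, 4, 1, 1), (5, 6, 1, 2), (1, 4, 1, 3), (1, 3, -1, 4), (2, 4, 1, 5), (2, 3, -1, 6),
     (3, 5, 1, 7), (3, 6, 1, 8), (4, 5, 1, 9), (4, 6, 1, 10), (1, 5, 1, 11), (1, 6, 1, 12), (2, 5, 1, 13), (2, 6, 1, 14)]"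

definition upper_entry :: "(6 \<times> 6 \<times> int \<times> nat) list \<Rightarrow> (nat \<Rightarrow> 'a::comm_ring_1) \<Rightarrow> 6 \<Rightarrow> 6 \<Rightarrow> 'a" where
  "upper_entry L g i j = (\<Sum>(a, b, c, k)\<leftarrow>L. if i = a \<and> j = b then of_int c * g k else 0)"

lemma upper_entry_linear:
  "upper_entry L (g + h) i j = upper_entry L g i j + upper_entry L h i j"
  "upper_entry L (fun_scale k g) i j = k * upper_entry L g i j"
  by (induction L) (auto simp: upper_entry_def fun_scale_def algebra_simps)

text \<open>The matrix is read in 2 by 2 blocks, with one free entry in each diagonal block. The
  Pfaffian joins the first off-diagonal block to the second through the symplectic form; that block
  therefore carries a symplectic factor, visible as the order and signs of coordinates 3 to
  6.\<close>

lemma isomorphic_to_skew_symmetric_matrices: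
  fixes s :: "'a::field_char_0 \<Rightarrow> 'v::ab_group_add \<Rightarrow> 'v"
  assumes "isomorphic_to s f fun_scale (coord_space 15) (hermitian_norm 4)"
  shows "isomorphic_to s f mat_scale (skew_symmetric_matrices :: ('a^6^6) set) pfaffian6"
proof (rule isomorphic_to_compose[OF assms vector_space_mat_scale])
  let ?t = "\<lambda>g. (\<chi> i j. upper_entry skew_entries g i j - upper_entry skew_entries g j i) :: 'a^6^6"
  let ?l = "\<lambda>A :: 'a^6^6. [A$1$2, A$3$4, A$5$6, A$1$4, - A$1$3, A$2$4, - A$2$3, A$3$5, A$3$6, A$4$5, A$4$6,
     A$1$5, A$1$6, A$2$5, A$2$6]"
  show "?t (g + h) = ?t g + ?t h" "?t (fun_scale k g) = mat_scale k (?t g)" for g h k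
    by (simp_all add: vec_eq_iff mat_scale_def upper_entry_linear algebra_simps)
  have skew: "?t g \<in> skew_symmetric_matrices" for g
    by (simp add: skew_symmetric_matrices_def vec_eq_iff Finite_Cartesian_Product.transpose_def)
  note entries = upper_entry_def skew_entries_def neq6 neq6[symmetric]
  show "hermitian_norm 4 g = pfaffian6 (?t g)" for g
    unfolding pfaffian6_expand[OF skew]
    by (simp add: entries hermitian_norm_def split_norm_def split_trilinear_def mat2_form_def mat2_mult_def algebra_simps)
  show "bij_betw ?t (coord_space 15) skew_symmetric_matrices"
  proof (rule bij_betw_byWitness[where f' = "\<lambda>A p. if p < length (?l A) then ?l A ! p else 0"])
    show "\<forall>g\<in>coord_space 15. (\<lambda>p. if p < length (?l (?t g)) then ?l (?t g) ! p else 0) = g"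
    proof (intro ballI coord_space_eq_nth)
      fix g :: "nat \<Rightarrow> 'a" and p :: nat
      assume "p < 15"
      moreover have "?l (?t g) = map g [0..<15]" by (simp add: entries) (simp add: upt_rec numeral_eq_Suc)
      ultimately show "g p = ?l (?t g) ! p" by (simp only:) simp
    qed auto
    show "\<forall>A\<in>skew_symmetric_matrices. ?t (\<lambda>p. if p < length (?l A) then ?l A ! p else 0) = A"
    proof
      fix A :: "'a^6^6" assume A: "A \<in> skew_symmetric_matrices"
      have skew: "A $ i $ j = - A $ j $ i" for i j
      proof -
        have "Finite_Cartesian_Product.transpose A = - A" using A by (simp add: skew_symmetric_matrices_def)
        then have "Finite_Cartesian_Product.transpose A $ j $ i = (- A) $ j $ i" by simp
        then show ?thesis by (simp add: Finite_Cartesian_Product.transpose_def)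
      qed
      have diag: "A $ i $ i = 0" for i using skew[of i i] by simp
      show "?t (\<lambda>p. if p < length (?l A) then ?l A ! p else 0) = A"
        by (simp add: vec_eq_iff forall_6 entries diag skew[of 2 1] skew[of 3 1] skew[of 4 1] skew[of 5 1] skew[of 6 1]
            skew[of 3 2] skew[of 4 2] skew[of 5 2] skew[of 6 2] skew[of 4 3] skew[of 5 3] skew[of 6 3] skew[of 5 4]
            skew[of 6 4] skew[of 6 5])
    qed
  qed (auto simp: coord_space_def skew)
qed


section \<open>The representation of \<open>E\<^sub>6\<close> on \<open>27\<close> coordinates\<close>

text \<open>Sparse integer matrices: the entry \<open>((p, q), c)\<close> sends the \<open>p\<close>-th basis vector to \<open>c\<close> times
  the \<open>q\<close>-th one.\<close>

type_synonym sparse = "((int \<times> int) \<times> int) list"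

definition act :: "sparse \<Rightarrow> (nat \<Rightarrow> 'a::comm_ring_1) \<Rightarrow> nat \<Rightarrow> 'a" where
  "act A g r = (\<Sum>((p, q), c)\<leftarrow>A. of_int c * (if r = nat q then g (nat p) else 0))"

definition sparse_from :: "int \<Rightarrow> sparse \<Rightarrow> sparse" where
  "sparse_from p A = filter (\<lambda>((p', q), c). p' = p) A"

definition sparse_mult :: "sparse \<Rightarrow> sparse \<Rightarrow> sparse" where
  "sparse_mult A B = concat (map (\<lambda>((p, q), c).
     map (\<lambda>((p', q'), c'). ((p, q'), c * c')) (sparse_from q A)) B)"

definition sparse_scale :: "int \<Rightarrow> sparse \<Rightarrow> sparse" where
  "sparse_scale k A = map (\<lambda>(pq, c). (pq, k * c)) A"

definition sparse_bracket :: "sparse \<Rightarrow> sparse \<Rightarrow> sparse" where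
  "sparse_bracket A B = sparse_mult A B @ sparse_scale (- 1) (sparse_mult B A)"

text \<open>Keys may repeat, so a list can denote zero without being empty; collecting the
  coefficients key by key decides this by evaluation.\<close>

fun cancels :: "('k \<times> int) list \<Rightarrow> bool" where
  "cancels [] = True"
| "cancels ((k, c) # P) = (c + (\<Sum>(k', c')\<leftarrow>P. if k' = k then c' else 0) = 0 \<and>
     cancels (filter (\<lambda>(k', c'). k' \<noteq> k) P))"

text \<open>Simple root vectors in the coordinates of \<open>hermitian_norm 8\<close>. The
  representation is minuscule: entries are 1 or -1, and each simple root has six strings of length
  2.\<close>

definition e6_table :: "sparse list" where
  "e6_table = [
     [((2, 23), 1), ((11, 7), 1), ((12, 8), 1), ((17, 5), - 1), ((18, 3), 1), ((26, 0), 1)],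
     [((2, 17), 1), ((16, 1), - 1), ((19, 9), - 1), ((20, 10), - 1), ((23, 5), - 1), ((24, 6), - 1)],
     [((1, 17), 1), ((3, 25), 1), ((4, 26), 1), ((7, 21), 1), ((8, 22), 1), ((16, 2), - 1)],
     [((5, 7), 1), ((10, 4), 1), ((14, 16), - 1), ((17, 11), - 1), ((22, 24), - 1), ((25, 19), - 1)],
     [((7, 8), 1), ((9, 10), 1), ((11, 12), 1), ((13, 14), 1), ((19, 20), 1), ((21, 22), 1)],
     [((6, 9), 1), ((8, 3), 1), ((12, 18), 1), ((15, 13), 1), ((22, 25), 1), ((24, 19), 1)]]"

definition e6_diagonals :: "(int \<times> int) list list" where
  "e6_diagonals = [
     [(0, 1), (2, - 1), (3, 1), (5, 1), (7, 1), (8, 1), (11, - 1), (12, - 1), (17, - 1), (18, - 1), (23, 1), (26, - 1)],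
     [(1, 1), (2, - 1), (5, 1), (6, 1), (9, 1), (10, 1), (16, - 1), (17, 1), (19, - 1), (20, - 1), (23, - 1), (24, - 1)],
     [(1, - 1), (2, 1), (3, - 1), (4, - 1), (7, - 1), (8, - 1), (16, - 1), (17, 1), (21, 1), (22, 1), (25, 1), (26, 1)],
     [(4, 1), (5, - 1), (7, 1), (10, - 1), (11, 1), (14, - 1), (16, 1), (17, - 1), (19, 1), (22, - 1), (24, 1), (25, - 1)],
     [(7, - 1), (8, 1), (9, - 1), (10, 1), (11, - 1), (12, 1), (13, - 1), (14, 1), (19, - 1), (20, 1), (21, - 1), (22, 1)],
     [(3, 1), (6, - 1), (8, - 1), (9, 1), (12, - 1), (13, 1), (15, - 1), (18, 1), (19, 1), (22, - 1), (24, - 1), (25, 1)]]"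

definition e6_e :: "nat \<Rightarrow> sparse" where
  "e6_e i = e6_table ! (i - 1)"

text \<open>On weight strings of length 2 with entries 1 or -1, transposition produces the matching
  opposite root vector.\<close>

definition e6_f :: "nat \<Rightarrow> sparse" where
  "e6_f i = map (\<lambda>((p, q), c). ((q, p), c)) (e6_e i)"

definition e6_h :: "nat \<Rightarrow> sparse" where
  "e6_h i = map (\<lambda>(r, c). ((r, r), c)) (e6_diagonals ! (i - 1))"

text \<open>\<open>hermitian_norm 8\<close> multiplied out: 45 monomials, each a triple of
  coordinates whose weights sum to zero.\<close>

definition e6_cubic :: "(int list \<times> int) list" where
  "e6_cubic = [([0, 1, 2], 1), ([0, 11, 14], - 1), ([0, 12, 13], 1), ([0, 15, 18], - 1),
     ([0, 16, 17], 1), ([1, 19, 22], - 1), ([1, 20, 21], 1), ([1, 23, 26], - 1),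
     ([1, 24, 25], 1), ([2, 3, 6], - 1), ([2, 4, 5], 1), ([2, 7, 10], - 1),
     ([2, 8, 9], 1), ([3, 11, 22], 1), ([3, 12, 21], - 1), ([3, 15, 26], 1),
     ([3, 17, 24], - 1), ([4, 13, 22], 1), ([4, 14, 21], - 1), ([4, 15, 25], - 1),
     ([4, 17, 23], 1), ([5, 11, 20], - 1), ([5, 12, 19], 1), ([5, 16, 26], 1),
     ([5, 18, 24], - 1), ([6, 13, 20], - 1), ([6, 14, 19], 1), ([6, 16, 25], - 1),
     ([6, 18, 23], 1), ([7, 12, 25], 1), ([7, 14, 26], 1), ([7, 17, 20], - 1),
     ([7, 18, 22], - 1), ([8, 11, 25], - 1), ([8, 13, 26], - 1), ([8, 17, 19], 1),
     ([8, 18, 21], 1), ([9, 12, 23], - 1), ([9, 14, 24], - 1), ([9, 15, 20], 1),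
     ([9, 16, 22], 1), ([10, 11, 23], 1), ([10, 13, 24], 1), ([10, 15, 19], - 1),
     ([10, 16, 21], - 1)]"

definition cubic_value :: "(int list \<times> int) list \<Rightarrow> (nat \<Rightarrow> 'a::comm_ring_1) \<Rightarrow> 'a" where
  "cubic_value L g = (\<Sum>(k, c)\<leftarrow>L. of_int c * (g (nat (k ! 0)) * g (nat (k ! 1)) * g (nat (k ! 2))))"

text \<open>Indices are sorted so that equal monomials can be matched.\<close>

definition cubic_derivative :: "sparse \<Rightarrow> (int list \<times> int) list \<Rightarrow> (int list \<times> int) list" where
  "cubic_derivative A L = concat (map (\<lambda>(k, c). concat (map (\<lambda>t.
     map (\<lambda>((p, q), c'). (sort (k[t := p]), c * c')) (filter (\<lambda>((p, q), c'). q = k ! t) A)) [0, 1, 2])) L)"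

text \<open>An integer combination of the Cartan generators that separates the \<open>27\<close> weights.\<close>

definition e6_weight :: "int list" where
  "e6_weight = [5, 1, - 6, 13, 11, - 5, - 7, 21, 2, 4, - 15, 6, - 13, 8, - 11, - 3, 15, - 20, - 2, 18, - 1, 0, - 19, 9, 7, - 8, - 10]"

definition e6_separator :: sparse where
  "e6_separator = concat (map2 (\<lambda>k i. sparse_scale k (e6_h i)) [5, - 4, - 5, 6, - 5, 3] [1..<7])"

text \<open>A spanning tree of the weight diagram: \<open>(p, q, i)\<close> stands for the edge from \<open>p\<close> to \<open>q\<close> along
  the \<open>i\<close>-th simple root.\<close>

definition e6_tree :: "(int \<times> int \<times> nat) list" where
  "e6_tree = [(26, 0, 1), (4, 26, 3), (10, 4, 4), (20, 10, 2), (9, 10, 5), (19, 20, 5), (6, 9, 6), (25, 19, 4), (24, 19, 6), (3, 25, 3), (22, 25, 6), (18, 3, 1), (8, 3, 6), (21, 22, 5), (12, 18, 6), (7, 8, 5), (11, 12, 5), (5, 7, 4), (17, 11, 4), (23, 5, 2), (2, 17, 2), (1, 17, 3), (16, 2, 3), (14, 16, 4), (13, 14, 5), (15, 13, 6)]"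

text \<open>All finite checks by one evaluation; the statements about operators on \<open>V\<close>
  follow from them through \<open>act\<close>.\<close>

lemma e6_computations:
  "(\<forall>i\<in>set [1..<7]. \<forall>j\<in>set [1..<7].
      cancels (sparse_bracket (e6_h i) (e6_h j)) \<and>
      cancels (sparse_bracket (e6_e i) (e6_f j) @ sparse_scale (- (if i = j then 1 else 0)) (e6_h i)) \<and>
      cancels (sparse_bracket (e6_h i) (e6_e j) @ sparse_scale (- e6_cartan i j) (e6_e j)) \<and>
      cancels (sparse_bracket (e6_h i) (e6_f j) @ sparse_scale (e6_cartan i j) (e6_f j)) \<and>
      (i \<noteq> j \<longrightarrow> cancels ((sparse_bracket (e6_e i) ^^ nat (1 - e6_cartan i j)) (e6_e j)) \<and>
        cancels ((sparse_bracket (e6_f i) ^^ nat (1 - e6_cartan i j)) (e6_f j)))) \<and>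
   (\<forall>i\<in>set [1..<7]. cancels (cubic_derivative (e6_e i) e6_cubic) \<and>
      cancels (cubic_derivative (e6_f i) e6_cubic) \<and> cancels (cubic_derivative (e6_h i) e6_cubic)) \<and>
   cancels (e6_separator @ map2 (\<lambda>r w. ((r, r), - w)) [0..26] e6_weight) \<and>
   (\<forall>(p, q, i)\<in>set e6_tree. i \<in> set [1..<7] \<and>
     sparse_from p (e6_e i) \<in> {[((p, q), 1)], [((p, q), - 1)]} \<and>
     sparse_from q (e6_f i) \<in> {[((q, p), 1)], [((q, p), - 1)]})"
  by code_simp

lemmas e6_relations = e6_computations[THEN conjunct1]
  and e6_cubic_invariant = e6_computations[THEN conjunct2, THEN conjunct1]
  and e6_separator_check = e6_computations[THEN conjunct2, THEN conjunct2, THEN conjunct1]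
  and e6_tree_check = e6_computations[THEN conjunct2, THEN conjunct2, THEN conjunct2]

lemma hermitian_norm_8: "hermitian_norm 8 g = cubic_value e6_cubic g"
  by (simp add: hermitian_norm_def split_norm_def split_trilinear_def mat2_form_def mat2_mult_def mat2_adj_def
      Let_def e6_cubic_def cubic_value_def algebra_simps)


section \<open>Soundness of the sparse integer calculus\<close>

lemma cancels_sum:
  "cancels P \<Longrightarrow> (\<Sum>(k, c)\<leftarrow>P. of_int c * \<nu> k) = (0 :: 'a::comm_ring_1)"
proof (induction P rule: cancels.induct)
  case (2 k c P)
  have split: "(\<Sum>(k', c')\<leftarrow>P. of_int c' * \<nu> k') =
     of_int (\<Sum>(k', c')\<leftarrow>P. if k' = k then c' else 0) * \<nu> k +
     (\<Sum>(k', c')\<leftarrow>filter (\<lambda>(k', c'). k' \<noteq> k) P. of_int c' * \<nu> k')" for P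
    by (induction P) (auto simp: algebra_simps)
  have 0: "c + (\<Sum>(k', c')\<leftarrow>P. if k' = k then c' else 0) = 0" using 2(2) by simp
  have IH: "(\<Sum>(k', c')\<leftarrow>filter (\<lambda>(k', c'). k' \<noteq> k) P. of_int c' * \<nu> k') = 0" using 2 by simp
  have "(\<Sum>(k', c')\<leftarrow>(k, c) # P. of_int c' * \<nu> k') = of_int c * \<nu> k + (\<Sum>(k', c')\<leftarrow>P. of_int c' * \<nu> k')"
    by simp
  also have "\<dots> = of_int (c + (\<Sum>(k', c')\<leftarrow>P. if k' = k then c' else 0)) * \<nu> k"
    unfolding split[of P] IH by (simp add: algebra_simps)
  finally show ?case unfolding 0 by simp
qed simp

lemma act_cancels: "cancels A \<Longrightarrow> act A g r = 0"
  using cancels_sum[of A "\<lambda>(p, q). if r = nat q then g (nat p) else 0"]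
  by (simp add: act_def case_prod_beta')

lemma act_append: "act (A @ B) g r = act A g r + act B g r"
  by (simp add: act_def)

lemma act_scale: "act (sparse_scale k A) g r = of_int k * act A g r"
  by (induction A) (auto simp: act_def sparse_scale_def algebra_simps)

lemma act_linear:
  "act A (\<lambda>r. g r + h r) r = act A g r + act A h r" "act A (\<lambda>r. k * g r) r = k * act A g r"
  by (induction A) (auto simp: act_def algebra_simps)

text \<open>Indices are integers converted by \<open>nat\<close>: the lower bound keeps this
  conversion injective, and the upper bound keeps \<open>act\<close> inside
  \<open>coord_space 27\<close>.\<close>

definition index_bounded :: "sparse \<Rightarrow> bool" where
  "index_bounded A \<longleftrightarrow> (\<forall>((p, q), c)\<in>set A. p \<in> {0..<27} \<and> q \<in> {0..<27})"

lemma act_mult: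
  assumes "index_bounded A" "index_bounded B"
  shows "act (sparse_mult A B) g r = act A (act B g) r"
  using assms(2)
proof (induction B)
  case Nil
  show ?case using act_linear(2)[of A 0 "\<lambda>_. 0" r] by (simp add: sparse_mult_def act_def)
next
  case (Cons b B)
  obtain p q c where b: "b = ((p, q), c)" by (metis prod.exhaust)
  have "act (map (\<lambda>((p', q'), c'). ((p, q'), c * c')) (sparse_from q A)) g r =
      act A (\<lambda>r. of_int c * (if r = nat q then g (nat p) else 0)) r"
    using assms(1) Cons.prems unfolding b
    by (induction A) (auto simp: act_def sparse_from_def index_bounded_def algebra_simps nat_eq_iff eq_nat_nat_iff)
  moreover have "act (b # B) g = (\<lambda>r. of_int c * (if r = nat q then g (nat p) else 0) + act B g r)"
    by (simp add: act_def b fun_eq_iff)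
  moreover have "act (sparse_mult A (b # B)) g r =
      act (map (\<lambda>((p', q'), c'). ((p, q'), c * c')) (sparse_from q A)) g r + act (sparse_mult A B) g r"
    by (simp add: sparse_mult_def b act_append)
  ultimately show ?case using Cons by (simp add: act_linear(1) index_bounded_def)
qed

lemma index_bounded_bracket:
  "index_bounded A \<Longrightarrow> index_bounded B \<Longrightarrow> index_bounded (sparse_bracket A B)"
  by (fastforce simp: index_bounded_def sparse_bracket_def sparse_mult_def sparse_from_def sparse_scale_def)

lemma act_bracket:
  assumes "index_bounded A" "index_bounded B"
  shows "act (sparse_bracket A B) g r = act A (act B g) r - act B (act A g) r"
  using assms by (simp add: sparse_bracket_def act_append act_scale act_mult)

lemma act_coord_space: "index_bounded A \<Longrightarrow> act A g \<in> coord_space 27"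
  unfolding coord_space_def
proof (intro CollectI allI impI)
  fix r :: nat assume "27 \<le> r" "index_bounded A"
  then show "act A g r = 0" by (induction A) (auto simp: act_def index_bounded_def)
qed

lemma index_bounded_e6:
  assumes "i \<in> {1..6}"
  shows "index_bounded (e6_e i)" "index_bounded (e6_f i)" "index_bounded (e6_h i)"
proof -
  have i: "i = 1 \<or> i = 2 \<or> i = 3 \<or> i = 4 \<or> i = 5 \<or> i = 6" using assms by auto
  then show e: "index_bounded (e6_e i)"
    by (elim disjE) (simp_all add: e6_e_def e6_table_def index_bounded_def)
  then show f: "index_bounded (e6_f i)"
    by (auto simp: e6_f_def index_bounded_def)
  from i show "index_bounded (e6_h i)"
    by (elim disjE) (simp_all add: e6_h_def e6_diagonals_def index_bounded_def)
qed

lemma e6_weight_distinct: "distinct e6_weight" "length e6_weight = 27"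
  by (simp_all add: e6_weight_def)

lemma act_e6_separator:
  assumes "r < 27"
  shows "act e6_separator g r = of_int (e6_weight ! r) * g r"
proof -
  let ?D = "map (\<lambda>i. ((int i, int i), - (e6_weight ! i))) [0..<27]"
  have entries: "map2 (\<lambda>r w. ((r, r), - w)) [0..26] e6_weight = ?D"
    by (rule nth_equalityI) (auto simp: e6_weight_distinct)
  have D: "act ?D g r = - (of_int (e6_weight ! r) * g r)"
  proof -
    have "act ?D g r = (\<Sum>i<27. of_int (- (e6_weight ! i)) * (if r = i then g i else 0))"
      unfolding act_def map_map o_def
      by (subst sum_set_upt_conv_sum_list_nat[symmetric]) (simp add: atLeast0LessThan cong: if_cong)
    also have "\<dots> = (\<Sum>i<27. if i = r then - (of_int (e6_weight ! r) * g r) else 0)"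
      by (rule sum.cong) auto
    finally show ?thesis using assms by simp
  qed
  show ?thesis
    using act_cancels[OF e6_separator_check, of g r] unfolding entries act_append D by simp
qed

lemma e6_tree_connected:
  assumes "\<forall>(p, q, i)\<in>set e6_tree. S (nat p) = S (nat q)" and "k < 27" "l < 27" "S k"
  shows "S l"
proof -
  have "S k = S 0" if k: "k < 27" for k
  proof -
    have "k = 0 \<or> k = 1 \<or> k = 2 \<or> k = 3 \<or> k = 4 \<or> k = 5 \<or> k = 6 \<or> k = 7 \<or> k = 8 \<or> k = 9 \<or> k = 10 \<or>
        k = 11 \<or> k = 12 \<or> k = 13 \<or> k = 14 \<or> k = 15 \<or> k = 16 \<or> k = 17 \<or> k = 18 \<or> k = 19 \<or> k = 20 \<or>
        k = 21 \<or> k = 22 \<or> k = 23 \<or> k = 24 \<or> k = 25 \<or> k = 26" using k by arith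
    then show ?thesis using assms(1) unfolding e6_tree_def by (elim disjE) simp_all
  qed
  then show ?thesis using assms by blast
qed

definition unit_coord :: "nat \<Rightarrow> nat \<Rightarrow> 'a::zero_neq_one" where
  "unit_coord k r = (if r = k then 1 else 0)"

lemma act_unit_coord:
  assumes "index_bounded A" "0 \<le> p"
  shows "act A (unit_coord (nat p)) = act (sparse_from p A) (unit_coord (nat p))"
  using assms(1) by (induction A) (use assms(2) in \<open>auto simp: act_def sparse_from_def index_bounded_def unit_coord_def fun_eq_iff eq_nat_nat_iff\<close>)

lemma act_single:
  "act [((p, q), c)] (unit_coord (nat p)) r = of_int c * unit_coord (nat q) r"
  by (simp add: act_def unit_coord_def)

definition cubic_directional :: "(int list \<times> int) list \<Rightarrow> (nat \<Rightarrow> 'a::comm_ring_1) \<Rightarrow> (nat \<Rightarrow> 'a) \<Rightarrow> 'a" where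
  "cubic_directional L g h = (\<Sum>(k, c)\<leftarrow>L. of_int c * (h (nat (k ! 0)) * g (nat (k ! 1)) * g (nat (k ! 2)) +
        g (nat (k ! 0)) * h (nat (k ! 1)) * g (nat (k ! 2)) + g (nat (k ! 0)) * g (nat (k ! 1)) * h (nat (k ! 2))))"

lemma cubic_value_line:
  "\<exists>a. \<forall>t. cubic_value L (\<lambda>r. g r + t * h r) =
     poly [:cubic_value L g, cubic_directional L g h,
       a, cubic_value L h:] t"
proof (induction L)
  case (Cons b L)
  obtain k c where b: "b = (k, c)" by (metis prod.exhaust)
  from Cons obtain a where a: "\<forall>t. cubic_value L (\<lambda>r. g r + t * h r) =
     poly [:cubic_value L g, cubic_directional L g h,
       a, cubic_value L h:] t" by blast
  show ?case
    by (rule exI[of _ "a + of_int c * (h (nat (k ! 0)) * h (nat (k ! 1)) * g (nat (k ! 2)) +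
        h (nat (k ! 0)) * g (nat (k ! 1)) * h (nat (k ! 2)) + g (nat (k ! 0)) * h (nat (k ! 1)) * h (nat (k ! 2)))"])
       (use a in \<open>simp add: b cubic_value_def cubic_directional_def algebra_simps\<close>)
qed (auto simp: cubic_value_def cubic_directional_def intro: exI[of _ 0])

text \<open>An entry \<open>((p, q), c')\<close> adds \<open>c' * g p\<close> to coordinate
  \<open>q\<close> of \<open>act A g\<close>, so the product rule replaces one index
  \<open>q\<close> of a monomial by \<open>p\<close>; sorting does not change the product.\<close>

lemma cubic_derivative_value:
  assumes A: "index_bounded A" and L: "\<forall>(k, c)\<in>set L. length k = 3 \<and> (\<forall>x\<in>set k. 0 \<le> x)"
  shows "cubic_directional L g (act A g) =
    (\<Sum>(k, c)\<leftarrow>cubic_derivative A L. of_int c * (prod_list (map (\<lambda>x. g (nat x)) k) :: 'a::comm_ring_1))"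
proof -
  have sort: "prod_list (map f (sort xs)) = prod_list (map f xs)" for f :: "int \<Rightarrow> 'a" and xs
    by (metis mset_map mset_sort prod_mset_prod_list)
  have act: "(\<Sum>(k, c)\<leftarrow>map (\<lambda>((p, q), c'). (sort (F p), c * c')) (filter (\<lambda>((p, q), c'). q = x) A).
      of_int c * prod_list (map (\<lambda>x. g (nat x)) k)) = of_int c * (act A g (nat x) * y)"
    if "0 \<le> x" "\<And>p. prod_list (map (\<lambda>x. g (nat x)) (F p)) = g (nat p) * y" for F c x y
    using A that
    by (induction A) (auto simp: act_def index_bounded_def sort algebra_simps eq_nat_nat_iff)
  show ?thesis using L
  proof (induction L)
    case (Cons b L)
    obtain k c where b: "b = (k, c)" by (metis prod.exhaust)
    have k: "length k = 3" "\<forall>x\<in>set k. 0 \<le> x" using Cons.prems by (auto simp: b)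
    then obtain x y z where xyz: "k = [x, y, z]"
      by (auto simp: numeral_3_eq_3 length_Suc_conv)
    have "of_int c * (act A g (nat x) * g (nat y) * g (nat z) + g (nat x) * act A g (nat y) * g (nat z) +
        g (nat x) * g (nat y) * act A g (nat z)) =
      of_int c * (act A g (nat x) * (g (nat y) * g (nat z))) + of_int c * (act A g (nat y) * (g (nat x) * g (nat z)))
       + of_int c * (act A g (nat z) * (g (nat x) * g (nat y)))"
      by (simp add: algebra_simps)
    also have "\<dots> = (\<Sum>(k, c)\<leftarrow>cubic_derivative A [b]. of_int c * prod_list (map (\<lambda>x. g (nat x)) k))"
    proof -
      have "of_int c * (act A g (nat x) * (g (nat y) * g (nat z))) =
        (\<Sum>(k, c)\<leftarrow>map (\<lambda>((p, q), c'). (sort [p, y, z], c * c')) (filter (\<lambda>((p, q), c'). q = x) A).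
          of_int c * prod_list (map (\<lambda>x. g (nat x)) k))"
        using k by (intro act[symmetric]) (simp_all add: xyz)
      moreover have "of_int c * (act A g (nat y) * (g (nat x) * g (nat z))) =
        (\<Sum>(k, c)\<leftarrow>map (\<lambda>((p, q), c'). (sort [x, p, z], c * c')) (filter (\<lambda>((p, q), c'). q = y) A).
          of_int c * prod_list (map (\<lambda>x. g (nat x)) k))"
        using k by (intro act[symmetric]) (simp_all add: xyz mult_ac)
      moreover have "of_int c * (act A g (nat z) * (g (nat x) * g (nat y))) =
        (\<Sum>(k, c)\<leftarrow>map (\<lambda>((p, q), c'). (sort [x, y, p], c * c')) (filter (\<lambda>((p, q), c'). q = z) A).
          of_int c * prod_list (map (\<lambda>x. g (nat x)) k))"
        using k by (intro act[symmetric]) (simp_all add: xyz mult_ac)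
      ultimately show ?thesis
        by (simp add: cubic_derivative_def b xyz numeral_2_eq_2)
    qed
    finally show ?case
      using Cons by (simp add: cubic_derivative_def cubic_directional_def b xyz)
  qed (simp add: cubic_derivative_def cubic_directional_def)
qed


section \<open>The operators on \<open>V\<close> and their irreducibility\<close>

locale e6_coordinates = vector_space s
  for s :: "'a::field_char_0 \<Rightarrow> 'v::ab_group_add \<Rightarrow> 'v" (infixr "\<cdot>" 75) +
  fixes \<phi> :: "'v \<Rightarrow> nat \<Rightarrow> 'a"
  assumes \<phi>_add: "\<phi> (x + y) r = \<phi> x r + \<phi> y r"
    and \<phi>_scale: "\<phi> (k \<cdot> x) r = k * \<phi> x r"
    and \<phi>_bij: "bij_betw \<phi> UNIV (coord_space 27)"
begin

definition \<psi> :: "(nat \<Rightarrow> 'a) \<Rightarrow> 'v" where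
  "\<psi> g = inv_into UNIV \<phi> g"

lemma \<phi>_\<psi>: "g \<in> coord_space 27 \<Longrightarrow> \<phi> (\<psi> g) = g"
  unfolding \<psi>_def using \<phi>_bij by (intro f_inv_into_f) (simp add: bij_betw_def)

lemma \<psi>_\<phi>: "\<psi> (\<phi> v) = v"
  unfolding \<psi>_def using \<phi>_bij by (intro inv_into_f_f) (auto simp: bij_betw_def)

lemma \<phi>_eqI: "(\<And>r. \<phi> x r = \<phi> y r) \<Longrightarrow> x = y"
  by (metis \<psi>_\<phi> ext)

lemma \<phi>_high: "27 \<le> r \<Longrightarrow> \<phi> v r = 0"
  using \<phi>_bij by (auto simp: bij_betw_def coord_space_def)

lemma \<phi>_zero: "\<phi> 0 r = 0"
  using \<phi>_scale[of 0 0 r] by simp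

lemma \<phi>_diff: "\<phi> (x - y) r = \<phi> x r - \<phi> y r"
  using \<phi>_add[of "x - y" y r] by simp

definition operator :: "sparse \<Rightarrow> 'v \<Rightarrow> 'v" where
  "operator A v = \<psi> (act A (\<phi> v))"

lemma \<phi>_operator: "index_bounded A \<Longrightarrow> \<phi> (operator A v) = act A (\<phi> v)"
  unfolding operator_def by (rule \<phi>_\<psi>) (rule act_coord_space)

lemma linear_operator:
  assumes "index_bounded A"
  shows "Vector_Spaces.linear s s (operator A)"
  unfolding Vector_Spaces.linear_iff
proof (intro conjI allI vector_space_axioms)
  show "operator A (x + y) = operator A x + operator A y" for x y
  proof (rule \<phi>_eqI)
    have "\<phi> (x + y) = (\<lambda>r. \<phi> x r + \<phi> y r)" by (simp add: fun_eq_iff \<phi>_add)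
    then show "\<phi> (operator A (x + y)) r = \<phi> (operator A x + operator A y) r" for r
      by (simp add: \<phi>_operator[OF assms] \<phi>_add act_linear)
  qed
  show "operator A (k \<cdot> x) = k \<cdot> operator A x" for k x
  proof (rule \<phi>_eqI)
    have "\<phi> (k \<cdot> x) = (\<lambda>r. k * \<phi> x r)" by (simp add: fun_eq_iff \<phi>_scale)
    then show "\<phi> (operator A (k \<cdot> x)) r = \<phi> (k \<cdot> operator A x) r" for r
      by (simp add: \<phi>_operator[OF assms] \<phi>_scale act_linear)
  qed
qed

lemma commutator_operator:
  assumes "index_bounded A" "index_bounded B"
  shows "commutator (operator A) (operator B) = operator (sparse_bracket A B)"
proof (rule ext, rule \<phi>_eqI)
  fix v r
  show "\<phi> (commutator (operator A) (operator B) v) r = \<phi> (operator (sparse_bracket A B) v) r"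
    using assms by (simp add: commutator_def \<phi>_diff \<phi>_operator index_bounded_bracket act_bracket)
qed

lemma commutator_power_operator:
  assumes "index_bounded A" "index_bounded B"
  shows "index_bounded ((sparse_bracket A ^^ n) B) \<and>
    (commutator (operator A) ^^ n) (operator B) = operator ((sparse_bracket A ^^ n) B)"
  by (induction n) (use assms in \<open>auto simp: commutator_operator index_bounded_bracket\<close>)

lemma operator_cancels: "cancels A \<Longrightarrow> index_bounded A \<Longrightarrow> operator A = (\<lambda>_. 0)"
  by (intro ext \<phi>_eqI) (simp add: \<phi>_operator act_cancels \<phi>_zero)

lemma operator_cancels_scale:
  assumes "cancels (A @ sparse_scale (- k) B)" "index_bounded A" "index_bounded B"
  shows "operator A = (\<lambda>v. of_int k \<cdot> operator B v)"
proof (intro ext \<phi>_eqI)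
  fix v r
  show "\<phi> (operator A v) r = \<phi> (of_int k \<cdot> operator B v) r"
    using act_cancels[OF assms(1), of "\<phi> v" r] assms(2,3)
    by (simp add: \<phi>_operator \<phi>_scale act_append act_scale)
qed

sublocale e6_representation s "\<lambda>i. operator (e6_e i)" "\<lambda>i. operator (e6_f i)" "\<lambda>i. operator (e6_h i)"
proof (intro e6_representation.intro e6_representation_axioms.intro vector_space_axioms)
  have upt: "i \<in> set [1..<7] \<longleftrightarrow> i \<in> {1..6}" for i by auto
  note bounded = index_bounded_e6 index_bounded_bracket
  fix i :: nat assume i: "i \<in> {1..6}"
  show "Vector_Spaces.linear s s (operator (e6_e i))" "Vector_Spaces.linear s s (operator (e6_f i))"
    "Vector_Spaces.linear s s (operator (e6_h i))"
    by (rule linear_operator[OF index_bounded_e6(1)[OF i]], rule linear_operator[OF index_bounded_e6(2)[OF i]],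
        rule linear_operator[OF index_bounded_e6(3)[OF i]])
  fix j :: nat assume j: "j \<in> {1..6}"
  have ij: "i \<in> set [1..<7]" "j \<in> set [1..<7]" using i j by auto
  have relations: "cancels (sparse_bracket (e6_h i) (e6_h j))"
      "cancels (sparse_bracket (e6_e i) (e6_f j) @ sparse_scale (- (if i = j then 1 else 0)) (e6_h i))"
      "cancels (sparse_bracket (e6_h i) (e6_e j) @ sparse_scale (- e6_cartan i j) (e6_e j))"
      "cancels (sparse_bracket (e6_h i) (e6_f j) @ sparse_scale (- (- e6_cartan i j)) (e6_f j))"
    using e6_relations ij by auto
  show "commutator (operator (e6_h i)) (operator (e6_h j)) = (\<lambda>_. 0)"
    using i j relations(1) by (simp add: commutator_operator operator_cancels bounded)
  have "operator (sparse_bracket (e6_e i) (e6_f j)) = (\<lambda>v. of_int (if i = j then 1 else 0) \<cdot> operator (e6_h i) v)"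
    using i j by (intro operator_cancels_scale[OF relations(2)] bounded)
  then show "commutator (operator (e6_e i)) (operator (e6_f j)) = (if i = j then operator (e6_h i) else (\<lambda>_. 0))"
    using i j by (simp add: commutator_operator bounded)
  show "commutator (operator (e6_h i)) (operator (e6_e j)) = (\<lambda>v. of_int (e6_cartan i j) \<cdot> operator (e6_e j) v)"
    using i j by (simp only: commutator_operator bounded) (intro operator_cancels_scale[OF relations(3)] bounded)
  show "commutator (operator (e6_h i)) (operator (e6_f j)) = (\<lambda>v. of_int (- e6_cartan i j) \<cdot> operator (e6_f j) v)"
    using i j by (simp only: commutator_operator bounded) (intro operator_cancels_scale[OF relations(4)] bounded)
  assume "i \<noteq> j"
  then have "cancels ((sparse_bracket (e6_e i) ^^ nat (1 - e6_cartan i j)) (e6_e j))"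
    "cancels ((sparse_bracket (e6_f i) ^^ nat (1 - e6_cartan i j)) (e6_f j))"
    using e6_relations ij by auto
  then show "(commutator (operator (e6_e i)) ^^ nat (1 - e6_cartan i j)) (operator (e6_e j)) = (\<lambda>_. 0)"
    "(commutator (operator (e6_f i)) ^^ nat (1 - e6_cartan i j)) (operator (e6_f j)) = (\<lambda>_. 0)"
    using commutator_power_operator[OF index_bounded_e6(1)[OF i] index_bounded_e6(1)[OF j]]
      commutator_power_operator[OF index_bounded_e6(2)[OF i] index_bounded_e6(2)[OF j]]
    by (simp_all add: operator_cancels)
qed

definition basis :: "nat \<Rightarrow> 'v" where
  "basis k = \<psi> (unit_coord k)"

lemma \<phi>_basis: "k < 27 \<Longrightarrow> \<phi> (basis k) = unit_coord k"
  unfolding basis_def by (rule \<phi>_\<psi>) (auto simp: coord_space_def unit_coord_def)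

lemma \<phi>_sum: "\<phi> (\<Sum>k\<in>S. x k) r = (\<Sum>k\<in>S. \<phi> (x k) r)"
  by (induction S rule: infinite_finite_induct) (simp_all add: \<phi>_zero \<phi>_add)

lemma basis_coefficient: "r < 27 \<Longrightarrow> \<phi> (\<Sum>k<27. u k \<cdot> basis k) r = u r"
  by (simp add: \<phi>_sum \<phi>_scale \<phi>_basis unit_coord_def if_distrib cong: if_cong)

lemma basis_sum: "(\<Sum>k<27. \<phi> v k \<cdot> basis k) = v"
proof (rule \<phi>_eqI)
  show "\<phi> (\<Sum>k<27. \<phi> v k \<cdot> basis k) r = \<phi> v r" for r
    by (cases "r < 27") (simp_all add: basis_coefficient \<phi>_high)
qed

lemma dim_UNIV: "dim (UNIV :: 'v set) = 27"
proof (rule dim_unique)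
  have inj: "inj_on basis {..<27}"
  proof (rule inj_onI)
    fix j k :: nat assume "j \<in> {..<27}" "k \<in> {..<27}" "basis j = basis k"
    then have "(unit_coord j :: nat \<Rightarrow> 'a) j = unit_coord k j" by (metis \<phi>_basis lessThan_iff)
    then show "j = k" by (simp add: unit_coord_def split: if_splits)
  qed
  show "card (basis ` {..<27}) = 27" by (simp add: card_image inj)
  show "basis ` {..<27} \<subseteq> UNIV" by simp
  show "UNIV \<subseteq> span (basis ` {..<27})"
  proof
    fix v
    have "(\<Sum>k<27. \<phi> v k \<cdot> basis k) \<in> span (basis ` {..<27})"
      by (intro span_sum span_scale span_base) auto
    then show "v \<in> span (basis ` {..<27})" by (simp add: basis_sum)
  qed
  show "independent (basis ` {..<27})"
  proof (rule notI)
    assume "dependent (basis ` {..<27})"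
    then obtain u where u: "\<exists>v\<in>basis ` {..<27}. u v \<noteq> 0" "(\<Sum>v\<in>basis ` {..<27}. u v \<cdot> v) = 0"
      using dependent_finite[of "basis ` {..<27}"] by auto
    then have 0: "(\<Sum>k<27. u (basis k) \<cdot> basis k) = 0" by (simp add: sum.reindex[OF inj])
    have "u (basis k) = 0" if "k < 27" for k
      using basis_coefficient[OF that, of "\<lambda>k. u (basis k)"] unfolding 0 by (simp add: \<phi>_zero)
    with u(1) show False by auto
  qed
qed

text \<open>Weight argument: the separator is diagonal with 27 distinct eigenvalues, so a nonzero
  invariant subspace contains a basis vector, and the root vectors along the spanning tree carry it
  to all the others.\<close>

lemma irreducible: irreducible_rep
  unfolding irreducible_rep_def
proof (intro conjI allI impI)
  have "\<phi> (basis 0) 0 = 1" by (simp add: \<phi>_basis unit_coord_def)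
  then have "basis 0 \<noteq> 0" using \<phi>_zero[of 0] by auto
  then show "(UNIV :: 'v set) \<noteq> {0}" by blast
  fix W :: "'v set" assume W: "subspace W \<and> (\<forall>X\<in>generators. X ` W \<subseteq> W)"
  then have sub: "subspace W" by simp
  have ops: "operator (e6_e i) v \<in> W" "operator (e6_f i) v \<in> W" "operator (e6_h i) v \<in> W"
    if "i \<in> {1..6}" "v \<in> W" for i v
    using W that unfolding generators_def by blast+
  show "W = {0} \<or> W = UNIV"
  proof (cases "W = {0}")
    case False
    then obtain v where v: "v \<in> W" "v \<noteq> 0" using subspace_0[OF sub] by blast
    then obtain k where k: "\<phi> v k \<noteq> 0" using \<phi>_eqI[of v 0] \<phi>_zero by auto
    then have k27: "k < 27" using \<phi>_high[of k v] not_le by blast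
    define \<mu> where "\<mu> r = (of_int (e6_weight ! r) :: 'a)" for r
    have "\<exists>y\<in>W. \<forall>r<27. \<phi> y r = \<mu> r * \<phi> x r" if x: "x \<in> W" for x
    proof -
      have combination: "\<exists>y\<in>W. \<phi> y = act (concat (map2 (\<lambda>k i. sparse_scale k (e6_h i)) ks l)) (\<phi> x)"
        if "set l \<subseteq> {1..6}" for ks l
        using that
      proof (induction ks l rule: list_induct2')
        case (4 k ks i l)
        then obtain y where y: "y \<in> W" "\<phi> y = act (concat (map2 (\<lambda>k i. sparse_scale k (e6_h i)) ks l)) (\<phi> x)"
          by auto
        have i: "i \<in> {1..6}" using 4 by simp
        have "of_int k \<cdot> operator (e6_h i) x + y \<in> W"
          using sub ops(3)[OF i x] y(1) by (intro subspace_add subspace_scale)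
        moreover have "\<phi> (of_int k \<cdot> operator (e6_h i) x + y) =
            act (concat (map2 (\<lambda>k i. sparse_scale k (e6_h i)) (k # ks) (i # l))) (\<phi> x)"
          using i by (simp add: fun_eq_iff \<phi>_add \<phi>_scale \<phi>_operator index_bounded_e6 y(2) act_append act_scale)
        ultimately show ?case by blast
      qed (use subspace_0[OF sub] in \<open>auto simp: act_def \<phi>_zero fun_eq_iff intro!: bexI[of _ 0]\<close>)
      have "\<exists>y\<in>W. \<phi> y = act e6_separator (\<phi> x)"
        unfolding e6_separator_def by (rule combination) auto
      then obtain y where "y \<in> W" "\<phi> y = act e6_separator (\<phi> x)" by blast
      then show ?thesis by (intro bexI[of _ y]) (simp_all add: \<mu>_def act_e6_separator)
    qed
    then obtain H where H: "H x \<in> W" "r < 27 \<Longrightarrow> \<phi> (H x) r = \<mu> r * \<phi> x r" if "x \<in> W" for x r by metis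
    \<comment> \<open>These are products of the operators \<open>H - \<mu> j\<close> applied to
      \<open>v\<close>. With all \<open>j \<noteq> k\<close> in the list only coordinate
      \<open>k\<close> survives, times a nonzero factor.\<close>
    have proj: "\<exists>y\<in>W. \<forall>r<27. \<phi> y r = (\<Prod>j\<leftarrow>js. \<mu> r - \<mu> j) * \<phi> v r" for js
    proof (induction js)
      case (Cons j js)
      then obtain y where y: "y \<in> W" "\<forall>r<27. \<phi> y r = (\<Prod>j\<leftarrow>js. \<mu> r - \<mu> j) * \<phi> v r" by blast
      have "H y - \<mu> j \<cdot> y \<in> W" using sub H(1) y(1) by (intro subspace_diff subspace_scale)
      moreover have "\<forall>r<27. \<phi> (H y - \<mu> j \<cdot> y) r = (\<Prod>j\<leftarrow>j # js. \<mu> r - \<mu> j) * \<phi> v r"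
        using H(2) y by (simp add: \<phi>_diff \<phi>_scale algebra_simps)
      ultimately show ?case by blast
    qed (use v in auto)
    define S where "S k \<longleftrightarrow> basis k \<in> W" for k
    have "S k"
    proof -
      obtain y where y: "y \<in> W" "\<forall>r<27. \<phi> y r = (\<Prod>j\<leftarrow>filter (\<lambda>j. j \<noteq> k) [0..<27]. \<mu> r - \<mu> j) * \<phi> v r"
        using proj by blast
      let ?c = "(\<Prod>j\<leftarrow>filter (\<lambda>j. j \<noteq> k) [0..<27]. \<mu> k - \<mu> j) * \<phi> v k"
      have "\<mu> k - \<mu> j \<noteq> 0" if "j < 27" "j \<noteq> k" for j
        using e6_weight_distinct that k27 by (auto simp: \<mu>_def nth_eq_iff_index_eq)
      then have c: "?c \<noteq> 0" using k by (auto simp: prod_list_zero_iff)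
      have "y = ?c \<cdot> basis k"
      proof (rule \<phi>_eqI)
        fix r
        have "(\<Prod>j\<leftarrow>filter (\<lambda>j. j \<noteq> k) [0..<27]. \<mu> r - \<mu> j) = 0" if "r < 27" "r \<noteq> k"
          using that by (auto simp: prod_list_zero_iff)
        then show "\<phi> y r = \<phi> (?c \<cdot> basis k) r"
          using y(2) k27 by (cases "r < 27") (auto simp: \<phi>_scale \<phi>_basis unit_coord_def \<phi>_high)
      qed
      then have "basis k = (1 / ?c) \<cdot> y" using c by simp
      then show ?thesis unfolding S_def using y(1) sub subspace_scale by metis
    qed
    have step: "S (nat q)" if A: "index_bounded A" "\<And>v. v \<in> W \<Longrightarrow> operator A v \<in> W"
        and S: "S (nat p)" and p: "0 \<le> p" "p < 27" "q < 27"
        and edge: "sparse_from p A \<in> {[((p, q), 1)], [((p, q), - 1)]}" for A p q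
    proof -
      obtain c :: int where c: "sparse_from p A = [((p, q), c)]" "c * c = 1"
        using edge by auto
      then have cc: "of_int c * (of_int c :: 'a) = 1" by (metis of_int_1 of_int_mult)
      have "operator A (basis (nat p)) = of_int c \<cdot> basis (nat q)"
      proof (rule \<phi>_eqI)
        show "\<phi> (operator A (basis (nat p))) r = \<phi> (of_int c \<cdot> basis (nat q)) r" for r
          using p by (simp add: \<phi>_operator[OF A(1)] \<phi>_scale \<phi>_basis act_unit_coord[OF A(1)] c act_single)
      qed
      then have "basis (nat q) = of_int c \<cdot> operator A (basis (nat p))" by (simp add: cc)
      moreover have "operator A (basis (nat p)) \<in> W" using A(2) S by (simp add: S_def)
      ultimately show ?thesis unfolding S_def using sub subspace_scale by metis
    qed
    have tree: "\<forall>(p, q, i)\<in>set e6_tree. S (nat p) = S (nat q)"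
    proof (intro ballI, clarify, rule iffI)
      fix p q i assume t: "(p, q, i) \<in> set e6_tree"
      have i: "i \<in> {1..6}" and
        fe: "sparse_from p (e6_e i) \<in> {[((p, q), 1)], [((p, q), - 1)]}" and
        ff: "sparse_from q (e6_f i) \<in> {[((q, p), 1)], [((q, p), - 1)]}"
        using e6_tree_check t by auto
      have "((p, q), 1) \<in> set (sparse_from p (e6_e i)) \<or> ((p, q), - 1) \<in> set (sparse_from p (e6_e i))"
        using fe by auto
      then have "((p, q), 1) \<in> set (e6_e i) \<or> ((p, q), - 1) \<in> set (e6_e i)"
        by (auto simp: sparse_from_def)
      then have pq: "0 \<le> p" "p < 27" "0 \<le> q" "q < 27"
        using index_bounded_e6(1)[OF i] by (auto simp: index_bounded_def)
      show "S (nat q)" if "S (nat p)"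
        using step[OF index_bounded_e6(1)[OF i] ops(1)[OF i] that _ _ _ fe] pq by simp
      show "S (nat p)" if "S (nat q)"
        using step[OF index_bounded_e6(2)[OF i] ops(2)[OF i] that _ _ _ ff] pq by simp
    qed
    have "S l" if "l < 27" for l
      using e6_tree_connected[where S = S, OF tree k27 that \<open>S k\<close>] .
    then have "(\<Sum>k<27. \<phi> x k \<cdot> basis k) \<in> W" for x
      using sub unfolding S_def by (intro subspace_sum subspace_scale) auto
    then show ?thesis by (auto simp: basis_sum)
  qed simp
qed

end

theorem is_e6_cubic_hermitian_norm:
  fixes s :: "'a::field_char_0 \<Rightarrow> 'v::ab_group_add \<Rightarrow> 'v"
  assumes "isomorphic_to s f fun_scale (coord_space 27) (hermitian_norm 8)" and "cubic_form_on s UNIV f"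
  shows "is_e6_cubic s f"
proof -
  obtain \<phi> where lin: "Vector_Spaces.linear s fun_scale \<phi>" and \<phi>: "bij_betw \<phi> UNIV (coord_space 27)"
    and f: "\<And>x. f x = hermitian_norm 8 (\<phi> x)"
    using assms(1) unfolding isomorphic_to_def by blast
  interpret vector_space s using lin by (simp add: Vector_Spaces.linear_iff)
  interpret e6_coordinates s \<phi>
    using lin \<phi> by unfold_locales (simp_all add: Vector_Spaces.linear_iff fun_scale_def)
  have invariant: "differential s f v (operator A v) = 0"
    if A: "index_bounded A" "cancels (cubic_derivative A e6_cubic)" for A v
  proof (rule differential_eq)
    let ?g = "\<phi> v" and ?h = "act A (\<phi> v)"
    obtain a where a: "\<forall>t. cubic_value e6_cubic (\<lambda>r. ?g r + t * ?h r) =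
      poly [:cubic_value e6_cubic ?g, cubic_directional e6_cubic ?g ?h,
       a, cubic_value e6_cubic ?h:] t"
      using cubic_value_line by blast
    have indices: "\<forall>(k, c)\<in>set e6_cubic. length k = 3 \<and> (\<forall>x\<in>set k. 0 \<le> x)"
      by (simp add: e6_cubic_def)
    have "cubic_directional e6_cubic ?g ?h = 0"
      unfolding cubic_derivative_value[OF A(1) indices] by (rule cancels_sum[OF A(2)])
    with a have line: "cubic_value e6_cubic (\<lambda>r. ?g r + t * ?h r) =
        poly [:cubic_value e6_cubic ?g, 0, a, cubic_value e6_cubic ?h:] t" for t by (simp only:)
    have "f (v + s t (operator A v)) = cubic_value e6_cubic (\<lambda>r. ?g r + t * ?h r)" for t
    proof -
      have "\<phi> (v + s t (operator A v)) = (\<lambda>r. ?g r + t * ?h r)"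
        by (simp add: fun_eq_iff \<phi>_add \<phi>_scale \<phi>_operator[OF A(1)])
      then show ?thesis by (simp add: f hermitian_norm_8)
    qed
    then show "has_line_derivative s f v (operator A v) 0"
      unfolding has_line_derivative_def line
      by (intro exI[of _ "[:cubic_value e6_cubic ?g, 0, a, cubic_value e6_cubic ?h:]"] exI[of _ 1])
         (simp add: pderiv_pCons)
  qed
  have "invariant_form f"
    unfolding invariant_form_def
  proof (intro ballI allI)
    fix Y v assume "Y \<in> generators"
    then obtain i where i: "i \<in> {1..6}" and Y: "Y = operator (e6_e i) \<or> Y = operator (e6_f i) \<or> Y = operator (e6_h i)"
      unfolding generators_def by blast
    have "i \<in> set [1..<7]" using i by auto
    then have "cancels (cubic_derivative (e6_e i) e6_cubic)" "cancels (cubic_derivative (e6_f i) e6_cubic)"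
      "cancels (cubic_derivative (e6_h i) e6_cubic)"
      using e6_cubic_invariant by blast+
    then show "differential s f v (Y v) = 0"
      using Y invariant index_bounded_e6[OF i] by auto
  qed
  moreover have "\<exists>v. f v \<noteq> 0"
  proof
    \<comment> \<open>The identity matrix: diagonal entries 1 and zero blocks, where the form has
      value 1.\<close>
    let ?g = "\<lambda>r :: nat. if r < 3 then 1 else 0 :: 'a"
    have "?g \<in> coord_space 27" by (simp add: coord_space_def)
    then show "f (\<psi> ?g) \<noteq> 0"
      by (simp add: f \<phi>_\<psi> hermitian_norm_def split_norm_def split_trilinear_def mat2_form_def mat2_mult_def mat2_adj_def)
  qed
  ultimately show ?thesis
    unfolding is_e6_cubic_def using e6_representation_axioms irreducible dim_UNIV assms(2) by blast
qed


theorem theorem3p10: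
  fixes s :: "'a::{alg_closed_field, field_char_0} \<Rightarrow> 'v::ab_group_add \<Rightarrow> 'v"
    and B :: "'v set"
    and f :: "'v \<Rightarrow> 'a"
    and f_star :: "('v \<Rightarrow> 'a) \<Rightarrow> 'a"
  assumes "finite_dimensional_vector_space s B"
    and "cubic_form_on s UNIV f"
    and "is_mult_legendre_transform s B f f_star"
    and "cubic_form_on fun_scale (dual_space s) f_star"
  shows "isomorphic_to s f (*) (UNIV :: 'a set) (\<lambda>x. x ^ 3)
    \<or> isomorphic_to s f (*s) (UNIV :: ('a^3) set) (\<lambda>x. x $ 1 * x $ 2 * x $ 3)
    \<or> isomorphic_to s f mat_scale (symmetric_matrices :: ('a^3^3) set) det
    \<or> isomorphic_to s f mat_scale (UNIV :: ('a^3^3) set) det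
    \<or> isomorphic_to s f mat_scale (skew_symmetric_matrices :: ('a^6^6) set) pfaffian6
    \<or> is_e6_cubic s f
    \<or> (\<exists>N q. nondegenerate_quadratic_on fun_scale (coord_space N) q \<and>
         isomorphic_to s f (\<lambda>c (v, x). (fun_scale c v, c * x))
           (coord_space N \<times> (UNIV :: 'a set)) (\<lambda>(v, x). q v * x))"
proof -
  obtain T X c where "cubic_norm_structure s B T X c" and f: "f = trace_product.N T X"
    using legendre_cubic_norm_structure[OF assms] by blast
  then interpret cubic_norm_structure_alg_closed s B T X c
    by (simp add: cubic_norm_structure_alg_closed_def)
  show ?thesis
  proof (rule classification)
    assume "isomorphic_to s N (*) (UNIV :: 'a set) (\<lambda>x. x ^ 3)"
    then show ?thesis unfolding f by (rule disjI1)
  next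
    fix n q
    assume "nondegenerate_quadratic_on fun_scale (coord_space n) q"
      "isomorphic_to s N (\<lambda>k (v, x). (fun_scale k v, k * x))
        (coord_space n \<times> (UNIV :: 'a set)) (\<lambda>(v, x). q v * x)"
    then show ?thesis unfolding f by blast
  next
    fix n :: nat
    assume n: "n \<in> {1, 2, 4, 8}"
      and iso: "isomorphic_to s N fun_scale (coord_space (3 + 3 * n)) (hermitian_norm n)"
    from n consider "n = 1" | "n = 2" | "n = 4" | "n = 8" by blast
    then show ?thesis
    proof cases
      case 1
      have "isomorphic_to s N mat_scale (symmetric_matrices :: ('a^3^3) set) det"
        using iso unfolding 1 by (intro isomorphic_to_symmetric_matrices) simp
      then show ?thesis unfolding f by blast
    next
      case 2
      have "isomorphic_to s N mat_scale (UNIV :: ('a^3^3) set) det"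
        using iso unfolding 2 by (intro isomorphic_to_matrices) simp
      then show ?thesis unfolding f by blast
    next
      case 3
      have "isomorphic_to s N mat_scale (skew_symmetric_matrices :: ('a^6^6) set) pfaffian6"
        using iso unfolding 3 by (intro isomorphic_to_skew_symmetric_matrices) simp
      then show ?thesis unfolding f by blast
    next
      case 4
      have "is_e6_cubic s N"
        using iso assms(2) unfolding 4 f by (intro is_e6_cubic_hermitian_norm) simp_all
      then show ?thesis unfolding f by blast
    qed
  qed
qed

end
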